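(* Let $p\ge 1$, let $\mathcal{P}$ be the closed $p$-tuple of pants, and let $U=\mathbb{Z}\langle E,F\rangle/(E^2,F^2,EF+FE)$. Let $e_1,\dots,e_p,\sigma_1,\dots,\sigma_p$ be the basis of $H_1(\mathcal{P},P)$ described in the context. Define a map $$\mathbf{Z}^P_{\delta_{1/2},\pi_{1/2}}(\mathcal{P})\to U^{\otimes p}$$ by sending the basis element $$\varepsilon_{\mathcal{P}}\otimes(e_1^{\delta_1}\wedge\sigma_1^{\delta'_1})\wedge\cdots\wedge(e_p^{\delta_p}\wedge\sigma_p^{\delta'_p})\qquad(\delta_i,\delta'_i\in\{0,1\})$$ to $(E^{1-\delta_1}F^{\delta'_1})\otimes\cdots\otimes(E^{1-\delta_p}F^{\delta'_p})$. This map is an isomorphism of $\mathbb{Z}$-graded bimodules over $(U,U^{\otimes p})$, where $U^{\otimes p}$ acts on the right of $U^{\otimes p}$ by multiplication and the left action of $U$ on $U^{\otimes p}$ is induced by the coproduct $$\Delta(E)=E\otimes1+1\otimes E,\qquad\Delta(F)=F\otimes1+1\otimes F.$$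
   Context: **The surface.** The closed $p$-tuple of pants $\mathcal{P}$ is the connected oriented genus-zero surface with $p+1$ boundary circles, viewed as an open-closed cobordism from $(S^1)^{\sqcup p}$ to $S^1$: there are $p$ ordered incoming circles $C_1,\dots,C_p$ and one outgoing circle $C_0$; all boundary circles belong to the gluing boundary $S_+$, and the non-gluing boundary $S_-$ is empty. $P=\{p_0,\dots,p_p\}$ with $p_i\in C_i$. **The basis.** $e_i$ is an arc joining $p_0$ and $p_i$, and $\sigma_i$ is the class of the circle $C_i$, for $1\le i\le p$. Orientations alternate: $e_p$ is oriented from the outgoing boundary to the incoming boundary, $e_{p-1}$ from the incoming to the outgoing boundary, and so on; $\sigma_p$ has the opposite of the boundary orientation of $C_p$ induced from $\mathcal{P}$, $\sigma_{p-1}$ has the boundary orientation of $C_{p-1}$, and so on. **State space.** Here $\delta_{1/2}(\mathcal{P})=-p$ and $\pi_{1/2}(\mathcal{P})=p\bmod2$. Thus $$\mathbf{Z}^P_{\delta_{1/2},\pi_{1/2}}(\mathcal{P})=(\mathbb{Z}^{0|1})^{\otimes\pi}\otimes\wedge^*H_1(\mathcal{P},P;\mathbb{Z})\{-p\},\qquad\pi=\pi_{1/2}(\mathcal{P}),$$ where $\wedge^k$ has parity $k$ mod 2 and after the shift has degree $k-p$; $\mathbb{Z}^{0|1}$ is $\mathbb{Z}$ in odd parity and degree $0$; $\varepsilon_{\mathcal{P}}$ is the standard basis element of $(\mathbb{Z}^{0|1})^{\otimes\pi}$. **Bimodule structure.** Let $\phi_i\colon H_1(\mathcal{P},P)\to\mathbb{Z}$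 be the boundary map $H_1(\mathcal{P},P)\to H_0(P)$ followed by taking the coefficient of $p_i$. The left action of $U$ is $$E\cdot(\varepsilon_{\mathcal P}\otimes x_1\wedge\cdots\wedge x_k)=(-1)^{\pi}\varepsilon_{\mathcal P}\otimes\sum_m(-1)^{m-1}\phi_0(x_m)\,x_1\wedge\cdots\widehat{x_m}\cdots\wedge x_k,$$ $$F\cdot(\varepsilon_{\mathcal P}\otimes\omega)=(-1)^{\pi}\varepsilon_{\mathcal P}\otimes([C_0]\wedge\omega),$$ with $C_0$ given the boundary orientation. The right action of $U^{\otimes p}$ is given, for $E_i$ and $F_i$ denoting $E$ and $F$ in the $i$-th tensor factor, by $$(\varepsilon_{\mathcal P}\otimes x_1\wedge\cdots\wedge x_k)\cdot E_i=\varepsilon_{\mathcal P}\otimes\sum_m(-1)^{k-m}\phi_i(x_m)\,x_1\wedge\cdots\widehat{x_m}\cdots\wedge x_k,$$ $$(\varepsilon_{\mathcal P}\otimes\omega)\cdot F_i=\varepsilon_{\mathcal P}\otimes(\omega\wedge[C_i]),$$ with $C_i$ given the reverse of the boundary orientation. **Conventions.** $U$ is a super ring with $E,F$ odd, $\mathbb{Z}$-graded by $\deg E=-1$, $\deg F=1$; $U^{\otimes p}$ is the super tensor product (Koszul signs); the $p$-fold coproduct is the iterate of $\Delta$. *)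

theory Defs
  imports "HOL-Homology.Homology" "HOL-Algebra.QuotRing"
    "HOL-Algebra.Generated_Groups" "HOL-Algebra.Free_Abelian_Groups" "HOL-Library.Z2"
begin

section \<open>Graded super rings and graded bimodules\<close>

text \<open>
  The index \<open>(d, b)\<close> of a homogeneous component consists of the integer degree \<open>d\<close> and the
  parity \<open>b\<close> (\<open>0\<close> even, \<open>1\<close> odd). For a graded abelian group only the additive part of the
  record matters.
\<close>

record 'a graded = "'a ring" +
  hpart :: "int \<times> bit \<Rightarrow> 'a set"

definition graded_group :: "('a, 'm) graded_scheme \<Rightarrow> bool" where
  "graded_group M \<longleftrightarrow>
     abelian_group M \<and>
     (\<forall>d. subgroup (hpart M d) (add_monoid M)) \<and>
     (\<forall>x \<in> carrier M. \<exists>!f. (\<forall>d. f d \<in> hpart M d) \<and> finite {d. f d \<noteq> \<zero>\<^bsub>M\<^esub>} \<and>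
        x = (\<Oplus>\<^bsub>M\<^esub>d \<in> {d. f d \<noteq> \<zero>\<^bsub>M\<^esub>}. f d))"

definition super_ring :: "('a, 'm) graded_scheme \<Rightarrow> bool" where
  "super_ring R \<longleftrightarrow>
     ring R \<and> graded_group R \<and> \<one>\<^bsub>R\<^esub> \<in> hpart R 0 \<and>
     (\<forall>d e. \<forall>x \<in> hpart R d. \<forall>y \<in> hpart R e. x \<otimes>\<^bsub>R\<^esub> y \<in> hpart R (d + e))"

definition graded_bimodule ::
  "('a, 'k) graded_scheme \<Rightarrow> ('b, 'l) graded_scheme \<Rightarrow> ('m, 'n) graded_scheme \<Rightarrow>
   ('a \<Rightarrow> 'm \<Rightarrow> 'm) \<Rightarrow> ('m \<Rightarrow> 'b \<Rightarrow> 'm) \<Rightarrow> bool" where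
  "graded_bimodule R S M l r \<longleftrightarrow>
     super_ring R \<and> super_ring S \<and> graded_group M \<and>
     (\<forall>a \<in> carrier R. \<forall>x \<in> carrier M. l a x \<in> carrier M) \<and>
     (\<forall>x \<in> carrier M. \<forall>b \<in> carrier S. r x b \<in> carrier M) \<and>
     (\<forall>a \<in> carrier R. \<forall>x \<in> carrier M. \<forall>y \<in> carrier M.
        l a (x \<oplus>\<^bsub>M\<^esub> y) = l a x \<oplus>\<^bsub>M\<^esub> l a y) \<and>
     (\<forall>a \<in> carrier R. \<forall>a' \<in> carrier R. \<forall>x \<in> carrier M.
        l (a \<oplus>\<^bsub>R\<^esub> a') x = l a x \<oplus>\<^bsub>M\<^esub> l a' x \<and> l (a \<otimes>\<^bsub>R\<^esub> a') x = l a (l a' x)) \<and>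
     (\<forall>x \<in> carrier M. l \<one>\<^bsub>R\<^esub> x = x) \<and>
     (\<forall>b \<in> carrier S. \<forall>x \<in> carrier M. \<forall>y \<in> carrier M.
        r (x \<oplus>\<^bsub>M\<^esub> y) b = r x b \<oplus>\<^bsub>M\<^esub> r y b) \<and>
     (\<forall>b \<in> carrier S. \<forall>b' \<in> carrier S. \<forall>x \<in> carrier M.
        r x (b \<oplus>\<^bsub>S\<^esub> b') = r x b \<oplus>\<^bsub>M\<^esub> r x b' \<and> r x (b \<otimes>\<^bsub>S\<^esub> b') = r (r x b) b') \<and>
     (\<forall>x \<in> carrier M. r x \<one>\<^bsub>S\<^esub> = x) \<and>
     (\<forall>a \<in> carrier R. \<forall>b \<in> carrier S. \<forall>x \<in> carrier M. r (l a x) b = l a (r x b)) \<and>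
     (\<forall>d e. \<forall>a \<in> hpart R d. \<forall>x \<in> hpart M e. l a x \<in> hpart M (d + e)) \<and>
     (\<forall>d e. \<forall>x \<in> hpart M d. \<forall>b \<in> hpart S e. r x b \<in> hpart M (d + e))"

definition graded_bimodule_iso ::
  "('a, 'k) graded_scheme \<Rightarrow> ('b, 'l) graded_scheme \<Rightarrow>
   ('m, 'o) graded_scheme \<Rightarrow> ('a \<Rightarrow> 'm \<Rightarrow> 'm) \<Rightarrow> ('m \<Rightarrow> 'b \<Rightarrow> 'm) \<Rightarrow>
   ('n, 'q) graded_scheme \<Rightarrow> ('a \<Rightarrow> 'n \<Rightarrow> 'n) \<Rightarrow> ('n \<Rightarrow> 'b \<Rightarrow> 'n) \<Rightarrow>
   ('m \<Rightarrow> 'n) \<Rightarrow> bool" where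
  "graded_bimodule_iso R S M l r N l' r' f \<longleftrightarrow>
     graded_bimodule R S M l r \<and> graded_bimodule R S N l' r' \<and>
     f \<in> iso (add_monoid M) (add_monoid N) \<and>
     (\<forall>d. f ` hpart M d = hpart N d) \<and>
     (\<forall>a \<in> carrier R. \<forall>x \<in> carrier M. f (l a x) = l' a (f x)) \<and>
     (\<forall>x \<in> carrier M. \<forall>b \<in> carrier S. f (r x b) = r' (f x) b)"


section \<open>Rings given by generators and relations\<close>

definition free_ring :: "'x set \<Rightarrow> ('x list \<Rightarrow>\<^sub>0 int) ring" where
  "free_ring A =
     \<lparr>carrier = {c. Poly_Mapping.keys c \<subseteq> lists A},
      monoid.mult = (\<lambda>c d. frag_extend (\<lambda>u. frag_extend (\<lambda>v. frag_of (u @ v)) d) c),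
      one = frag_of [], zero = 0, add = (+)\<rparr>"

definition word_class ::
  "'x set \<Rightarrow> ('x list \<Rightarrow>\<^sub>0 int) set \<Rightarrow> 'x list \<Rightarrow> ('x list \<Rightarrow>\<^sub>0 int) set" where
  "word_class A rels w = (Idl\<^bsub>free_ring A\<^esub> rels) +>\<^bsub>free_ring A\<^esub> frag_of w"

definition presented_ring ::
  "'x set \<Rightarrow> ('x list \<Rightarrow>\<^sub>0 int) set \<Rightarrow> ('x \<Rightarrow> int \<times> bit) \<Rightarrow> ('x list \<Rightarrow>\<^sub>0 int) set graded" where
  "presented_ring A rels wt =
     (let R = free_ring A; I = Idl\<^bsub>R\<^esub> rels; Q = R Quot I in
      \<lparr>carrier = carrier Q, monoid.mult = monoid.mult Q, one = monoid.one Q,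
       zero = zero Q, add = add Q,
       hpart = (\<lambda>d. {I +>\<^bsub>R\<^esub> c | c. c \<in> carrier R \<and>
                       (\<forall>w \<in> Poly_Mapping.keys c. sum_list (map wt w) = d)})\<rparr>)"

text \<open>
  Additive extension to a quotient of a free abelian group of a map \<open>f\<close> given on free generators:
  elements \<open>A\<close> of the quotient are cosets, and the value at \<open>A\<close> is the value of the additive
  extension of \<open>f\<close> at any element of \<open>A\<close>. It is meaningful only when this does not depend on
  that element.
\<close>

definition coset_ext :: "('m, 'k) ring_scheme \<Rightarrow> ('w \<Rightarrow> 'm) \<Rightarrow> ('w \<Rightarrow>\<^sub>0 int) set \<Rightarrow> 'm" where
  "coset_ext M f A =
     the_elem ((\<lambda>c. \<Oplus>\<^bsub>M\<^esub>w \<in> Poly_Mapping.keys c. [Poly_Mapping.lookup c w] \<cdot>\<^bsub>M\<^esub> f w) ` A)"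


section \<open>The exterior algebra of an abelian group\<close>

definition exterior_rels :: "'g monoid \<Rightarrow> ('g list \<Rightarrow>\<^sub>0 int) set" where
  "exterior_rels G =
     {frag_of [x \<otimes>\<^bsub>G\<^esub> y] - frag_of [x] - frag_of [y] | x y. x \<in> carrier G \<and> y \<in> carrier G} \<union>
     {frag_of [x, x] | x. x \<in> carrier G}"

definition exterior :: "'g monoid \<Rightarrow> ('g list \<Rightarrow>\<^sub>0 int) set graded" where
  "exterior G = presented_ring (carrier G) (exterior_rels G) (\<lambda>_. (1, 1))"

definition wedge :: "'g monoid \<Rightarrow> 'g list \<Rightarrow> ('g list \<Rightarrow>\<^sub>0 int) set" where
  "wedge G xs = word_class (carrier G) (exterior_rels G) xs"


section \<open>Tensor powers of super rings\<close>

text \<open>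
  Since a graded ring is the direct sum of its components, its tensor power is generated by tensors
  of homogeneous elements subject to additivity within each component; this makes the Koszul sign
  in the product available on generators. (The zero element lies in components of both parities,
  but tensors with a zero entry vanish, so the sign attached to them is irrelevant.)
\<close>

definition tensor_gens :: "('a, 'k) graded_scheme \<Rightarrow> nat \<Rightarrow> 'a list set" where
  "tensor_gens R p = {xs. length xs = p \<and> set xs \<subseteq> (\<Union>d. hpart R d)}"

definition tensor_rels :: "('a, 'k) graded_scheme \<Rightarrow> nat \<Rightarrow> ('a list \<Rightarrow>\<^sub>0 int) set" where
  "tensor_rels R p =
     {frag_of (us @ (x \<oplus>\<^bsub>R\<^esub> y) # vs) - frag_of (us @ x # vs) - frag_of (us @ y # vs) | us vs x y d.
        us @ x # vs \<in> tensor_gens R p \<and> x \<in> hpart R d \<and> y \<in> hpart R d}"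

definition tensor_class ::
  "('a, 'k) graded_scheme \<Rightarrow> nat \<Rightarrow> ('a list \<Rightarrow>\<^sub>0 int) \<Rightarrow> ('a list \<Rightarrow>\<^sub>0 int) set" where
  "tensor_class R p c =
     (let G = free_Abelian_group (tensor_gens R p) in generate G (tensor_rels R p) #>\<^bsub>G\<^esub> c)"

definition koszul_sign :: "('a, 'k) graded_scheme \<Rightarrow> 'a list \<Rightarrow> 'a list \<Rightarrow> int" where
  "koszul_sign R xs ys =
     (-1) ^ card {(i, j). i < length xs \<and> j < i \<and>
                          (\<exists>d. xs ! i \<in> hpart R (d, 1)) \<and> (\<exists>d. ys ! j \<in> hpart R (d, 1))}"

definition tensor_power ::
  "('a, 'k) graded_scheme \<Rightarrow> nat \<Rightarrow> ('a list \<Rightarrow>\<^sub>0 int) set graded" where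
  "tensor_power R p =
     (let G = free_Abelian_group (tensor_gens R p); Q = G Mod generate G (tensor_rels R p) in
      \<lparr>carrier = carrier Q,
       monoid.mult = (\<lambda>A B. the_elem
         {tensor_class R p
            (frag_extend (\<lambda>xs. frag_extend (\<lambda>ys.
               frag_cmul (koszul_sign R xs ys) (frag_of (map2 (monoid.mult R) xs ys))) d) c)
          | c d. c \<in> A \<and> d \<in> B}),
       one = tensor_class R p (frag_of (replicate p \<one>\<^bsub>R\<^esub>)),
       zero = monoid.one Q, add = monoid.mult Q,
       hpart = (\<lambda>d. {tensor_class R p c | c. Poly_Mapping.keys c \<subseteq>
         {xs \<in> tensor_gens R p. \<exists>ds. list_all2 (\<lambda>x e. x \<in> hpart R e) xs ds \<and> sum_list ds = d}})\<rparr>)"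

abbreviation pure_tensor :: "('a, 'k) graded_scheme \<Rightarrow> 'a list \<Rightarrow> ('a list \<Rightarrow>\<^sub>0 int) set" where
  "pure_tensor R xs \<equiv> tensor_class R (length xs) (frag_of xs)"


section \<open>The algebra $U$ and its coproduct\<close>

datatype gen = GenE | GenF

type_synonym U = "(gen list \<Rightarrow>\<^sub>0 int) set"

definition U_rels :: "(gen list \<Rightarrow>\<^sub>0 int) set" where
  "U_rels = {frag_of [GenE, GenE], frag_of [GenF, GenF],
             frag_of [GenE, GenF] + frag_of [GenF, GenE]}"

definition U_ring :: "U graded" where
  "U_ring = presented_ring UNIV U_rels (case_gen (-1, 1) (1, 1))"

definition U_gen :: "gen \<Rightarrow> U" where
  "U_gen g = word_class UNIV U_rels [g]"

definition U_hom :: "('t, 'k) ring_scheme \<Rightarrow> (gen \<Rightarrow> 't) \<Rightarrow> U \<Rightarrow> 't" where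
  "U_hom T a u = coset_ext T (\<lambda>w. foldr (\<lambda>g t. a g \<otimes>\<^bsub>T\<^esub> t) w \<one>\<^bsub>T\<^esub>) u"

definition coproduct :: "U \<Rightarrow> (U list \<Rightarrow>\<^sub>0 int) set" where
  "coproduct = U_hom (tensor_power U_ring 2)
     (\<lambda>g. pure_tensor U_ring [U_gen g, \<one>\<^bsub>U_ring\<^esub>] \<oplus>\<^bsub>tensor_power U_ring 2\<^esub>
          pure_tensor U_ring [\<one>\<^bsub>U_ring\<^esub>, U_gen g])"

text \<open>
  \<open>iter_coproduct n\<close> takes values in the \<open>(n + 1)\<close>-fold tensor power: it is the canonical map for
  \<open>n = 0\<close>, and each further step applies the coproduct to the first tensor factor.
\<close>

primrec iter_coproduct :: "nat \<Rightarrow> U \<Rightarrow> (U list \<Rightarrow>\<^sub>0 int) set" where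
  "iter_coproduct 0 u = U_hom (tensor_power U_ring 1) (\<lambda>g. pure_tensor U_ring [U_gen g]) u"
| "iter_coproduct (Suc n) u =
     (let T = tensor_power U_ring (Suc (Suc n)) in
      coset_ext T (\<lambda>as. coset_ext T (\<lambda>bs. pure_tensor U_ring (bs @ tl as)) (coproduct (hd as)))
        (iter_coproduct n u))"


section \<open>The closed tuple of pants\<close>

text \<open>
  \<open>closed_pants p X C\<close>: \<open>X\<close> is (homeomorphic to) a closed disc with \<open>p\<close> disjoint open discs removed
  from its interior, oriented as a subset of the plane, and \<open>C i\<close> on \<open>{0..1}\<close> is a parametrisation
  of the \<open>i\<close>-th boundary circle in the direction of the boundary orientation (counterclockwise for
  the outer circle \<open>C 0\<close>, clockwise for the inner ones).
\<close>

definition closed_pants :: "nat \<Rightarrow> 'a topology \<Rightarrow> (nat \<Rightarrow> real \<Rightarrow> 'a) \<Rightarrow> bool" where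
  "closed_pants p X C \<longleftrightarrow>
     (\<exists>(z :: nat \<Rightarrow> complex) (r :: nat \<Rightarrow> real) h.
        (\<forall>i \<in> {1..p}. 0 < r i \<and> cball (z i) (r i) \<subseteq> ball (z 0) (r 0)) \<and>
        (\<forall>i \<in> {1..p}. \<forall>j \<in> {1..p}. i \<noteq> j \<longrightarrow> cball (z i) (r i) \<inter> cball (z j) (r j) = {}) \<and>
        homeomorphic_map
          (top_of_set (cball (z 0) (r 0) - (\<Union>i \<in> {1..p}. ball (z i) (r i)))) X h \<and>
        (\<forall>t \<in> {0..1}. C 0 t = h (z 0 + of_real (r 0) * cis (2 * pi * t))) \<and>
        (\<forall>i \<in> {1..p}. \<forall>t \<in> {0..1}. C i t = h (z i + of_real (r i) * cis (- 2 * pi * t))))"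

definition path_class ::
  "'a topology \<Rightarrow> 'a set \<Rightarrow> (real \<Rightarrow> 'a) \<Rightarrow> (((nat \<Rightarrow> real) \<Rightarrow> 'a) \<Rightarrow>\<^sub>0 int) set" where
  "path_class X S g =
     homologous_rel_set 1 X S (frag_of (restrict (\<lambda>x. g (x 1)) (standard_simplex 1)))"

text \<open>
  For a finite set \<open>S\<close> of points with the discrete topology, a class in degree-zero homology contains a
  single cycle; its coefficient at \<open>q\<close> is the one of the constant simplex at \<open>q\<close>.
\<close>

definition boundary_coeff ::
  "'a topology \<Rightarrow> 'a set \<Rightarrow> 'a \<Rightarrow> (((nat \<Rightarrow> real) \<Rightarrow> 'a) \<Rightarrow>\<^sub>0 int) set \<Rightarrow> int" where
  "boundary_coeff X S q x =
     Poly_Mapping.lookup (the_elem (hom_boundary 1 X S x)) (restrict (\<lambda>_. q) (standard_simplex 0))"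

type_synonym 'a H1_class = "(((nat \<Rightarrow> real) \<Rightarrow> 'a) \<Rightarrow>\<^sub>0 int) set"
type_synonym 'a state = "('a H1_class list \<Rightarrow>\<^sub>0 int) set"

text \<open>
  In the following, \<open>X\<close>, \<open>C\<close> and \<open>p\<close> are as in \<open>closed_pants\<close> and \<open>q i\<close> is the marked point on
  the \<open>i\<close>-th boundary circle.
\<close>

definition pants_H1 :: "nat \<Rightarrow> 'a topology \<Rightarrow> (nat \<Rightarrow> 'a) \<Rightarrow> 'a H1_class monoid" where
  "pants_H1 p X q = relative_homology_group 1 X (q ` {0..p})"

definition boundary_class ::
  "nat \<Rightarrow> 'a topology \<Rightarrow> (nat \<Rightarrow> real \<Rightarrow> 'a) \<Rightarrow> (nat \<Rightarrow> 'a) \<Rightarrow> nat \<Rightarrow> 'a H1_class" where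
  "boundary_class p X C q i = path_class X (q ` {0..p}) (C i)"

definition sigma_class ::
  "nat \<Rightarrow> 'a topology \<Rightarrow> (nat \<Rightarrow> real \<Rightarrow> 'a) \<Rightarrow> (nat \<Rightarrow> 'a) \<Rightarrow> nat \<Rightarrow> 'a H1_class" where
  "sigma_class p X C q i =
     (if even (p - i) then inv\<^bsub>pants_H1 p X q\<^esub> (boundary_class p X C q i)
      else boundary_class p X C q i)"

definition pants_phi ::
  "nat \<Rightarrow> 'a topology \<Rightarrow> (nat \<Rightarrow> 'a) \<Rightarrow> nat \<Rightarrow> 'a H1_class \<Rightarrow> int" where
  "pants_phi p X q i = boundary_coeff X (q ` {0..p}) (q i)"

text \<open>
  The group underlying the \<open>\<pi>\<close>-fold tensor power of the odd copy of the integers is free of rank one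
  on \<open>\<epsilon>\<close>, and \<open>\<epsilon> \<otimes> \<omega>\<close> is encoded by \<open>\<omega>\<close>; that factor shifts the parity by \<open>\<pi> = p mod 2\<close> here
  and contributes the sign \<open>(-1)^\<pi>\<close> to the left action below. The product of the exterior algebra
  is not part of the structure of the state space.
\<close>

definition pants_state :: "nat \<Rightarrow> 'a topology \<Rightarrow> (nat \<Rightarrow> 'a) \<Rightarrow> 'a state graded" where
  "pants_state p X q = (exterior (pants_H1 p X q))
     \<lparr>hpart := \<lambda>(d, b). hpart (exterior (pants_H1 p X q)) (d + int p, b + of_nat (p mod 2))\<rparr>"

primrec left_gen ::
  "nat \<Rightarrow> 'a topology \<Rightarrow> (nat \<Rightarrow> real \<Rightarrow> 'a) \<Rightarrow> (nat \<Rightarrow> 'a) \<Rightarrow> gen \<Rightarrow> 'a state \<Rightarrow> 'a state" where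
  "left_gen p X C q GenE A =
     (let H = pants_H1 p X q; M = exterior H in
      [((-1 :: int) ^ (p mod 2))] \<cdot>\<^bsub>M\<^esub> coset_ext M (\<lambda>xs. \<Oplus>\<^bsub>M\<^esub>m \<in> {..<length xs}.
        [((-1) ^ m * pants_phi p X q 0 (xs ! m))] \<cdot>\<^bsub>M\<^esub> wedge H (take m xs @ drop (Suc m) xs)) A)"
| "left_gen p X C q GenF A =
     (let H = pants_H1 p X q; M = exterior H in
      [((-1 :: int) ^ (p mod 2))] \<cdot>\<^bsub>M\<^esub> (wedge H [boundary_class p X C q 0] \<otimes>\<^bsub>M\<^esub> A))"

primrec right_gen ::
  "nat \<Rightarrow> 'a topology \<Rightarrow> (nat \<Rightarrow> real \<Rightarrow> 'a) \<Rightarrow> (nat \<Rightarrow> 'a) \<Rightarrow> nat \<Rightarrow> gen \<Rightarrow> 'a state \<Rightarrow> 'a state"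
where
  "right_gen p X C q i GenE A =
     (let H = pants_H1 p X q; M = exterior H in
      coset_ext M (\<lambda>xs. \<Oplus>\<^bsub>M\<^esub>m \<in> {..<length xs}.
        [((-1) ^ (length xs - Suc m) * pants_phi p X q i (xs ! m))] \<cdot>\<^bsub>M\<^esub>
          wedge H (take m xs @ drop (Suc m) xs)) A)"
| "right_gen p X C q i GenF A =
     (let H = pants_H1 p X q; M = exterior H in
      A \<otimes>\<^bsub>M\<^esub> wedge H [inv\<^bsub>H\<^esub> (boundary_class p X C q i)])"

definition pants_left ::
  "nat \<Rightarrow> 'a topology \<Rightarrow> (nat \<Rightarrow> real \<Rightarrow> 'a) \<Rightarrow> (nat \<Rightarrow> 'a) \<Rightarrow> U \<Rightarrow> 'a state \<Rightarrow> 'a state" where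
  "pants_left p X C q u A =
     coset_ext (pants_state p X q) (\<lambda>w. foldr (left_gen p X C q) w A) u"

definition pants_right_factor ::
  "nat \<Rightarrow> 'a topology \<Rightarrow> (nat \<Rightarrow> real \<Rightarrow> 'a) \<Rightarrow> (nat \<Rightarrow> 'a) \<Rightarrow> nat \<Rightarrow> 'a state \<Rightarrow> U \<Rightarrow> 'a state"
where
  "pants_right_factor p X C q i A u =
     coset_ext (pants_state p X q) (\<lambda>w. foldl (\<lambda>B g. right_gen p X C q i g B) A w) u"

text \<open>
  A tensor \<open>a_1 \<otimes> \<dots> \<otimes> a_p\<close> is the product, in this order and without sign, of the elements
  having \<open>a_i\<close> in the \<open>i\<close>-th factor and \<open>1\<close> elsewhere, so on the right \<open>a_1\<close> acts first.
\<close>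

definition pants_right ::
  "nat \<Rightarrow> 'a topology \<Rightarrow> (nat \<Rightarrow> real \<Rightarrow> 'a) \<Rightarrow> (nat \<Rightarrow> 'a) \<Rightarrow>
   'a state \<Rightarrow> (U list \<Rightarrow>\<^sub>0 int) set \<Rightarrow> 'a state" where
  "pants_right p X C q A t =
     coset_ext (pants_state p X q)
       (\<lambda>as. foldl (\<lambda>B (i, a). pants_right_factor p X C q i B a) A (zip [1..<Suc p] as)) t"


section \<open>The map\<close>

definition basis_wedge ::
  "nat \<Rightarrow> 'a topology \<Rightarrow> (nat \<Rightarrow> real \<Rightarrow> 'a) \<Rightarrow> (nat \<Rightarrow> 'a) \<Rightarrow> (nat \<Rightarrow> real \<Rightarrow> 'a) \<Rightarrow>
   (nat \<Rightarrow> nat) \<Rightarrow> (nat \<Rightarrow> nat) \<Rightarrow> 'a state" where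
  "basis_wedge p X C q e \<delta> \<delta>' =
     wedge (pants_H1 p X q)
       (concat (map (\<lambda>i. replicate (\<delta> i) (path_class X (q ` {0..p}) (e i)) @
                         replicate (\<delta>' i) (sigma_class p X C q i)) [1..<Suc p]))"

definition basis_tensor ::
  "nat \<Rightarrow> (nat \<Rightarrow> nat) \<Rightarrow> (nat \<Rightarrow> nat) \<Rightarrow> (U list \<Rightarrow>\<^sub>0 int) set" where
  "basis_tensor p \<delta> \<delta>' =
     pure_tensor U_ring
       (map (\<lambda>i. (U_gen GenE [^]\<^bsub>U_ring\<^esub> (1 - \<delta> i)) \<otimes>\<^bsub>U_ring\<^esub> (U_gen GenF [^]\<^bsub>U_ring\<^esub> \<delta>' i))
          [1..<Suc p])"

definition is_pants_map ::
  "nat \<Rightarrow> 'a topology \<Rightarrow> (nat \<Rightarrow> real \<Rightarrow> 'a) \<Rightarrow> (nat \<Rightarrow> 'a) \<Rightarrow> (nat \<Rightarrow> real \<Rightarrow> 'a) \<Rightarrow>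
   ('a state \<Rightarrow> (U list \<Rightarrow>\<^sub>0 int) set) \<Rightarrow> bool" where
  "is_pants_map p X C q e \<Phi> \<longleftrightarrow>
     \<Phi> \<in> hom (add_monoid (pants_state p X q)) (add_monoid (tensor_power U_ring p)) \<and>
     (\<forall>\<delta> \<delta>'. (\<forall>i \<in> {1..p}. \<delta> i \<in> {0, 1} \<and> \<delta>' i \<in> {0, 1}) \<longrightarrow>
        \<Phi> (basis_wedge p X C q e \<delta> \<delta>') = basis_tensor p \<delta> \<delta>')"

end

theory Submission
  imports Defs "HOL-Complex_Analysis.Complex_Analysis"
begin

text \<open>
  The ring \<open>U\<close>, its tensor powers and the exterior algebra of \<open>H_1\<close> are all identified, as graded
  groups with the relevant products, with spaces of integer combinations of monomials in anticommuting
  square-zero generators, where every identity can be checked on monomials. Under these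
  identifications \<open>U\<close> acts on the state space by contractions along the \<open>e_i\<close> and
  multiplications by the \<open>\<sigma>_i\<close>. Exchanging the monomials that contain \<open>e_i\<close> with those that do not,
  for all \<open>i\<close> at once, turns contractions into multiplications. The signs this creates are
  powers of \<open>-1\<close> that depend on \<open>i\<close> only; they cancel against the alternating orientations of the basis
  and the sign \<open>(-1)^\<pi>\<close>, which leaves exactly the coproduct on the left and
  multiplication on the right.

  That the \<open>e_i\<close> and \<open>\<sigma>_i\<close> form a basis of \<open>H_1\<close> rests on two facts: the boundary circles generate
  the absolute homology of a disc with holes, and winding numbers of loops around the holes, together with
  boundary coefficients, provide dual coordinates.
\<close>

section \<open>Linear extension from free abelian groups\<close>

text \<open>The objects are quotients, and \<open>coset_ext\<close> and \<open>the_elem\<close> mean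
  nothing until their values are known not to depend on representatives. An evaluation map from the
  free object into one fixed ring \<open>ext\<close> settles this each time: it kills the relations,
  while modulo the relations every representative can be rewritten into sorted monomials, so two
  representatives are equivalent exactly when their values agree. Well-definedness, axioms and
  gradings are then pulled back from \<open>ext\<close> along an injection.

  The numbering \<open>2 * i\<close> for \<open>e_i\<close> and \<open>E_i\<close>,
  \<open>2 * i + 1\<close> for \<open>\<sigma>_i\<close> and \<open>F_i\<close> follows the order of
  the wedge and of the tensor factors at once, so basis wedges and basis tensors are sorted
  monomials without sign. The flip carries no sign either. Multiplication by a generator, or
  contraction along it, has at the monomial of S a sign counting the members of S on one side of
  that generator. Such signs are multiplicative for symmetric differences, so the flip changes them
  by a factor in which S does not occur; that is why the leftover signs depend on i only.\<close>

definition lin :: "('w \<Rightarrow> 'r::ring_1) \<Rightarrow> ('w \<Rightarrow>\<^sub>0 int) \<Rightarrow> 'r" where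
  "lin f c = (\<Sum>w\<in>Poly_Mapping.keys c. of_int (Poly_Mapping.lookup c w) * f w)"

lemma lin_superset:
  assumes "finite S" "Poly_Mapping.keys c \<subseteq> S"
  shows "lin f c = (\<Sum>w\<in>S. of_int (Poly_Mapping.lookup c w) * f w)"
  unfolding lin_def using assms by (intro sum.mono_neutral_left) (auto simp: in_keys_iff)

lemma lin_0 [simp]: "lin f 0 = 0"
  by (simp add: lin_def)

lemma lin_frag_of [simp]: "lin f (frag_of w) = f w"
  by (simp add: lin_def)

lemma lin_add: "lin f (c + d) = lin f c + lin f d"
proof -
  let ?S = "Poly_Mapping.keys c \<union> Poly_Mapping.keys d"
  have "lin f (c + d) = (\<Sum>w\<in>?S. of_int (Poly_Mapping.lookup (c + d) w) * f w)"
    by (intro lin_superset) (auto simp: keys_add)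
  also have "\<dots> = (\<Sum>w\<in>?S. of_int (Poly_Mapping.lookup c w) * f w) + (\<Sum>w\<in>?S. of_int (Poly_Mapping.lookup d w) * f w)"
    by (simp add: lookup_add distrib_right sum.distrib)
  also have "\<dots> = lin f c + lin f d"
    by (simp add: lin_superset[where S = ?S])
  finally show ?thesis .
qed

lemma lin_minus: "lin f (- c) = - lin f c"
  by (metis add.left_inverse eq_neg_iff_add_eq_0 lin_0 lin_add)

lemma lin_diff: "lin f (c - d) = lin f c - lin f d"
  by (metis diff_conv_add_uminus lin_add lin_minus)

lemma lin_cmul: "lin f (frag_cmul k c) = of_int k * lin f c"
  by (subst lin_superset[where S = "Poly_Mapping.keys c"])
     (auto simp: keys_cmul lin_def sum_distrib_left mult.assoc)

lemma lin_cong: "(\<And>w. w \<in> Poly_Mapping.keys c \<Longrightarrow> f w = g w) \<Longrightarrow> lin f c = lin g c"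
  by (simp add: lin_def)

lemma lin_sum: "lin f (\<Sum>i\<in>I. c i) = (\<Sum>i\<in>I. lin f (c i))"
  by (induction I rule: infinite_finite_induct) (auto simp: lin_add)

lemma lin_frag_extend: "lin f (frag_extend g c) = lin (\<lambda>w. lin f (g w)) c"
  unfolding frag_extend_def lin_sum lin_cmul by (simp add: lin_def)

lemma mult_of_int_left: "v * (of_int k * w) = of_int k * (v * w :: 'r::ring_1)"
  by (metis mult.assoc mult_of_int_commute)

lemma lin_mult_left: "lin (\<lambda>w. a * f w) c = a * lin f c"
  by (simp add: lin_def sum_distrib_left mult_of_int_left)

lemma lin_mult_right: "lin (\<lambda>w. f w * a) c = lin f c * a"
  by (simp add: lin_def sum_distrib_right mult.assoc)

text \<open>Compatibility with differences is the natural hypothesis because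
  \<open>frag_induction\<close> builds chains from generators by subtraction; it also yields
  \<open>F 0 = 0\<close>.\<close>

lemma lin_compose_additive:
  assumes "\<And>x y. F (x - y) = F x - F y"
  shows "F (lin f c) = lin (\<lambda>w. F (f w)) c"
proof -
  have "F 0 = 0" using assms[of 0 0] by simp
  then show ?thesis
    by (rule_tac frag_induction[OF subset_UNIV]) (auto simp: lin_diff assms)
qed

lemma frag_extend_zero_fun [simp]: "frag_extend (\<lambda>_. 0) c = 0"
  by (simp add: frag_extend_def)

lemma frag_extend_add_fun: "frag_extend (\<lambda>x. f x + g x) c = frag_extend f c + frag_extend g c"
  by (simp add: frag_extend_def frag_cmul_distrib2 sum.distrib)

lemma frag_extend_diff_fun: "frag_extend (\<lambda>x. f x - g x) c = frag_extend f c - frag_extend g c"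
  using frag_extend_add_fun[of "\<lambda>x. f x - g x" g c] by simp


section \<open>The exterior algebra on countably many ordered generators\<close>

text \<open>
  The monomial of a finite set \<open>S\<close> is the product of the generators with index in \<open>S\<close> in
  increasing order; \<open>xsg S T\<close> is the sign of the permutation sorting the concatenation of the
  monomials of \<open>S\<close> and \<open>T\<close>.
\<close>

definition xsg :: "nat set \<Rightarrow> nat set \<Rightarrow> int" where
  "xsg S T = (if S \<inter> T = {} then (- 1) ^ card {(i, j). i \<in> S \<and> j \<in> T \<and> j < i} else 0)"

lemma finite_inversions: "finite S \<Longrightarrow> finite T \<Longrightarrow> finite {(i, j). i \<in> S \<and> j \<in> T \<and> j < (i::nat)}"
  by (rule finite_subset[of _ "S \<times> T"]) auto

lemma xsg_Un_left:
  assumes "finite S" "finite T" "finite R" "S \<inter> T = {}"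
  shows "xsg (S \<union> T) R = xsg S R * xsg T R"
proof -
  have "{(i, j). i \<in> S \<union> T \<and> j \<in> R \<and> j < i} =
      {(i, j). i \<in> S \<and> j \<in> R \<and> j < i} \<union> {(i, j). i \<in> T \<and> j \<in> R \<and> j < i}" by auto
  moreover have "card \<dots> = card {(i, j). i \<in> S \<and> j \<in> R \<and> j < i} + card {(i, j). i \<in> T \<and> j \<in> R \<and> j < i}"
    using assms by (intro card_Un_disjoint finite_inversions) auto
  ultimately show ?thesis by (auto simp: xsg_def power_add Int_Un_distrib2)
qed

lemma xsg_Un_right:
  assumes "finite S" "finite T" "finite R" "S \<inter> T = {}"
  shows "xsg R (S \<union> T) = xsg R S * xsg R T"
proof -
  have "{(i, j). i \<in> R \<and> j \<in> S \<union> T \<and> j < i} =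
      {(i, j). i \<in> R \<and> j \<in> S \<and> j < i} \<union> {(i, j). i \<in> R \<and> j \<in> T \<and> j < i}" by auto
  moreover have "card \<dots> = card {(i, j). i \<in> R \<and> j \<in> S \<and> j < i} + card {(i, j). i \<in> R \<and> j \<in> T \<and> j < i}"
    using assms by (intro card_Un_disjoint finite_inversions) auto
  ultimately show ?thesis by (auto simp: xsg_def power_add Int_Un_distrib)
qed

text \<open>This cocycle identity is associativity on monomials. If only S and R overlap, both sides
  still vanish, through the common factor \<open>xsg S R\<close>.\<close>

lemma xsg_assoc:
  assumes "finite S" "finite T" "finite R"
  shows "xsg S T * xsg (S \<union> T) R = xsg T R * xsg S (T \<union> R)"
proof (cases "S \<inter> T = {} \<and> T \<inter> R = {}")
  case True
  then show ?thesis using assms by (simp add: xsg_Un_left xsg_Un_right)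
next
  case False
  then show ?thesis by (auto simp: xsg_def)
qed

text \<open>A single type in class \<open>ring_1\<close> hosts all algebras of the proof, each cut
  out by a set of allowed indices, so ring identities need no carrier conditions. Infinite index
  sets are excluded because inversions are counted by \<open>card\<close>, which is 0 on infinite
  sets and would break the sign rules.\<close>

typedef ext = "{f :: nat set \<Rightarrow>\<^sub>0 int. Poly_Mapping.keys f \<subseteq> Collect finite}"
  morphisms coefs Abs_ext by (rule exI[of _ 0]) simp

setup_lifting type_definition_ext

instantiation ext :: ring_1
begin

lift_definition zero_ext :: ext is 0 by simp
lift_definition one_ext :: ext is "frag_of {}" by simp
lift_definition plus_ext :: "ext \<Rightarrow> ext \<Rightarrow> ext" is "(+)" by (metis Un_least keys_add order_trans)
lift_definition minus_ext :: "ext \<Rightarrow> ext \<Rightarrow> ext" is "(-)" by (metis Un_least keys_diff order_trans)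
lift_definition uminus_ext :: "ext \<Rightarrow> ext" is uminus by simp
lift_definition times_ext :: "ext \<Rightarrow> ext \<Rightarrow> ext" is
  "\<lambda>f g. frag_extend (\<lambda>S. frag_extend (\<lambda>T. frag_cmul (xsg S T) (frag_of (S \<union> T))) g) f"
proof -
  fix f g :: "nat set \<Rightarrow>\<^sub>0 int"
  assume f: "Poly_Mapping.keys f \<subseteq> Collect finite" and g: "Poly_Mapping.keys g \<subseteq> Collect finite"
  show "Poly_Mapping.keys (frag_extend (\<lambda>S. frag_extend (\<lambda>T. frag_cmul (xsg S T) (frag_of (S \<union> T))) g) f)
      \<subseteq> Collect finite" (is "Poly_Mapping.keys (frag_extend ?h f) \<subseteq> _")
  proof (rule order_trans[OF keys_frag_extend], intro UN_least)
    fix S assume "S \<in> Poly_Mapping.keys f"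
    then have "finite S" using f by auto
    then show "Poly_Mapping.keys (?h S) \<subseteq> Collect finite"
      using g by (intro order_trans[OF keys_frag_extend] UN_least order_trans[OF keys_cmul]) auto
  qed
qed

instance
proof
  fix a b c :: ext
  show "a * b * c = a * (b * c)"
  proof (transfer)
    fix a b c :: "nat set \<Rightarrow>\<^sub>0 int"
    let ?m = "\<lambda>f g. frag_extend (\<lambda>S. frag_extend (\<lambda>T. frag_cmul (xsg S T) (frag_of (S \<union> T))) g) f"
    assume "Poly_Mapping.keys a \<subseteq> Collect finite" and b: "Poly_Mapping.keys b \<subseteq> Collect finite"
      and c: "Poly_Mapping.keys c \<subseteq> Collect finite"
    then show "?m (?m a b) c = ?m a (?m b c)"
    proof (induction a rule: frag_induction)
      case (one S)
      show ?case using b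
      proof (induction b rule: frag_induction)
        case (one T)
        show ?case using c
        proof (induction c rule: frag_induction)
          case (one R)
          then show ?case using \<open>S \<in> _\<close> \<open>T \<in> _\<close>
            by (simp add: frag_extend_cmul xsg_assoc Un_assoc)
        qed (auto simp: frag_extend_diff frag_extend_diff_fun frag_cmul_diff_distrib)
      qed (auto simp: frag_extend_diff frag_extend_diff_fun)
    qed (auto simp: frag_extend_diff)
  qed
  show "1 * a = a"
    by transfer (simp add: xsg_def flip: frag_expansion)
  show "a * 1 = a"
    by transfer (simp add: xsg_def flip: frag_expansion)
qed (transfer; simp add: frag_extend_add frag_extend_add_fun)+

end

section \<open>Monomials and their sign rules\<close>

lift_definition bas :: "nat set \<Rightarrow> ext" is "\<lambda>S. if finite S then frag_of S else 0" by simp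

definition gen :: "nat \<Rightarrow> ext" where "gen i = bas {i}"

definition supp_in :: "nat set set \<Rightarrow> ext set" where
  "supp_in A = {v. Poly_Mapping.keys (coefs v) \<subseteq> A}"

lemmas coefs_simps [simp] = zero_ext.rep_eq plus_ext.rep_eq minus_ext.rep_eq uminus_ext.rep_eq one_ext.rep_eq

lemma coefs_bas: "finite S \<Longrightarrow> coefs (bas S) = frag_of S"
  by (simp add: bas.rep_eq)

lemma bas_infinite: "infinite S \<Longrightarrow> bas S = 0"
  by transfer simp

lemma bas_empty: "bas {} = 1"
  by transfer simp

lemma finite_keys_coefs: "S \<in> Poly_Mapping.keys (coefs v) \<Longrightarrow> finite S"
  using coefs by blast

lemma ext_supp_induct [consumes 1, case_names zero bas diff]:
  assumes "v \<in> supp_in A" "P 0" "\<And>S. finite S \<Longrightarrow> S \<in> A \<Longrightarrow> P (bas S)" "\<And>v w. P v \<Longrightarrow> P w \<Longrightarrow> P (v - w)"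
  shows "P v"
proof -
  have "Poly_Mapping.keys c \<subseteq> Collect finite \<and> P (Abs_ext c)"
    if "Poly_Mapping.keys c \<subseteq> A \<inter> Collect finite" for c
    using that
  proof (induction c rule: frag_induction)
    case zero
    then show ?case using assms(2) by (simp add: zero_ext_def)
  next
    case (one S)
    then show ?case using assms(3)[of S] by (simp add: bas_def)
  next
    case (diff a b)
    then have "Abs_ext (a - b) = Abs_ext a - Abs_ext b"
      by (simp add: minus_ext.abs_eq eq_onp_def)
    with diff show ?case
      using assms(4) keys_diff[of a b] by auto
  qed
  from this[of "coefs v"] show ?thesis
    using assms(1) coefs[of v] by (auto simp: supp_in_def coefs_inverse)
qed

lemma ext_induct [case_names zero bas diff]:
  assumes "P 0" "\<And>S. finite S \<Longrightarrow> P (bas S)" "\<And>v w. P v \<Longrightarrow> P w \<Longrightarrow> P (v - w)"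
  shows "P v"
  using ext_supp_induct[of v UNIV P] assms by (simp add: supp_in_def)

lemma coefs_of_int_mult [simp]: "coefs (of_int k * v) = frag_cmul k (coefs v)"
proof (induction k rule: int_induct[where k = 0])
  case (step1 i)
  then show ?case by (simp add: distrib_right frag_cmul_distrib)
next
  case (step2 i)
  then show ?case by (simp add: left_diff_distrib frag_cmul_diff_distrib)
qed simp

lemma bas_mult: "bas S * bas T = of_int (xsg S T) * bas (S \<union> T)"
proof (cases "finite S \<and> finite T")
  case True
  then have "coefs (bas S * bas T) = frag_cmul (xsg S T) (frag_of (S \<union> T))"
    by (simp add: times_ext.rep_eq coefs_bas)
  also have "\<dots> = coefs (of_int (xsg S T) * bas (S \<union> T))"
    using True by (simp add: coefs_bas)
  finally show ?thesis by (rule coefs_inject[THEN iffD1])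
qed (auto simp: bas_infinite)

text \<open>The side on which elements are counted is a parameter, so left and right multiplication
  share the rules for inserting, removing and toggling elements.\<close>

definition parity_sign :: "('i \<Rightarrow> bool) \<Rightarrow> 'i set \<Rightarrow> int" where
  "parity_sign R S = (- 1) ^ card {j \<in> S. R j}"

abbreviation below :: "nat \<Rightarrow> nat set \<Rightarrow> int" where "below i S \<equiv> parity_sign (\<lambda>j. j < i) S"
abbreviation above :: "nat \<Rightarrow> nat set \<Rightarrow> int" where "above i S \<equiv> parity_sign (\<lambda>j. i < j) S"

lemma gen_mult_bas: "gen i * bas S = (if i \<in> S then 0 else of_int (below i S) * bas (insert i S))"
proof -
  have "{(i', j). i' \<in> {i} \<and> j \<in> S \<and> j < i'} = Pair i ` {j \<in> S. j < i}" by auto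
  then have "card {(i', j). i' \<in> {i} \<and> j \<in> S \<and> j < i'} = card {j \<in> S. j < i}"
    by (simp only:) (intro card_image inj_onI, simp)
  then show ?thesis by (simp add: gen_def bas_mult xsg_def parity_sign_def)
qed

lemma bas_mult_gen: "bas S * gen i = (if i \<in> S then 0 else of_int (above i S) * bas (insert i S))"
proof -
  have "{(j, i'). j \<in> S \<and> i' \<in> {i} \<and> i' < j} = (\<lambda>j. (j, i)) ` {j \<in> S. i < j}" by auto
  then have "card {(j, i'). j \<in> S \<and> i' \<in> {i} \<and> i' < j} = card {j \<in> S. i < j}"
    by (simp only:) (intro card_image inj_onI, simp)
  then show ?thesis by (simp add: gen_def bas_mult xsg_def parity_sign_def)
qed

lemma parity_sign_simps:
  assumes "finite S"
  shows "j \<notin> S \<Longrightarrow> parity_sign R (insert j S) = (if R j then - parity_sign R S else parity_sign R S)"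
    and "j \<in> S \<Longrightarrow> parity_sign R (S - {j}) = (if R j then - parity_sign R S else parity_sign R S)"
proof -
  have *: "parity_sign R (insert j T) = (if R j then - parity_sign R T else parity_sign R T)" if "finite T" "j \<notin> T" for T
  proof -
    have "{k \<in> insert j T. R k} = (if R j then insert j {k \<in> T. R k} else {k \<in> T. R k})" by auto
    then show ?thesis using that by (simp add: parity_sign_def)
  qed
  show "j \<notin> S \<Longrightarrow> parity_sign R (insert j S) = (if R j then - parity_sign R S else parity_sign R S)"
    using * assms by simp
  assume "j \<in> S"
  then show "parity_sign R (S - {j}) = (if R j then - parity_sign R S else parity_sign R S)"
    using *[of "S - {j}"] assms by (simp add: insert_absorb split: if_splits)
qed

lemma parity_sign_sq [simp]: "parity_sign R S * parity_sign R S = 1" "parity_sign R S * (parity_sign R S * k) = k"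
  by (simp_all add: parity_sign_def flip: power_add mult_2 mult.assoc)

lemma gen_square [simp]: "gen i * gen i = 0"
  using gen_mult_bas[of i "{i}"] by (simp add: gen_def)

lemma below_singleton: "below i {j} = (if j < i then - 1 else 1)"
proof -
  have "{k \<in> {j}. k < i} = (if j < i then {j} else {})" by auto
  then show ?thesis by (simp only: parity_sign_def) simp
qed

lemma gen_anticomm: "gen i * gen j = - (gen j * gen i)"
  using gen_mult_bas[of i "{j}"] gen_mult_bas[of j "{i}"]
  by (cases "i = j") (auto simp: below_singleton insert_commute simp flip: gen_def)

lemma bas_insert_less: "\<forall>j\<in>S. i < j \<Longrightarrow> bas (insert i S) = gen i * bas S"
proof -
  assume *: "\<forall>j\<in>S. i < j"
  then have "{j \<in> S. j < i} = {}" by auto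
  then have "below i S = 1" by (simp only: parity_sign_def) simp
  with * show ?thesis by (auto simp: gen_mult_bas)
qed

text \<open>For disjoint sets each pair in \<open>S \<times> T\<close> is an inversion in exactly
  one of the two orders, so the two inversion counts add up to the product of the
  cardinalities.\<close>

lemma bas_commute:
  assumes "finite S" "finite T"
  shows "bas S * bas T = (- 1) ^ (card S * card T) * (bas T * bas S)"
proof (cases "S \<inter> T = {}")
  case True
  let ?A = "{(i, j). i \<in> S \<and> j \<in> T \<and> j < i}" and ?B = "{(i, j). i \<in> T \<and> j \<in> S \<and> j < i}"
  have "S \<times> T = ?A \<union> prod.swap ` ?B" 
  proof (intro subset_antisym subsetI)
    fix x assume "x \<in> S \<times> T"
    then obtain i j where x: "x = (i, j)" "i \<in> S" "j \<in> T" by auto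
    moreover have "i \<noteq> j" using x True by auto
    ultimately show "x \<in> ?A \<union> prod.swap ` ?B"
      by (cases "j < i") (auto intro!: image_eqI[where x = "(j, i)"])
  qed auto
  moreover have "?A \<inter> prod.swap ` ?B = {}" by auto
  ultimately have "card S * card T = card ?A + card (prod.swap ` ?B)"
    using assms by (subst card_cartesian_product[symmetric]) (simp add: card_Un_disjoint finite_inversions)
  also have "card (prod.swap ` ?B) = card ?B" by (intro card_image) simp
  finally have "(- 1 :: int) ^ card ?A = (- 1) ^ (card S * card T) * (- 1) ^ card ?B"
    by (simp add: power_add mult.assoc flip: power_mult_distrib)
  then have "xsg S T = (- 1) ^ (card S * card T) * xsg T S"
    using True by (auto simp: xsg_def)
  then show ?thesis by (simp add: bas_mult Un_commute mult.assoc)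
next
  case False
  then show ?thesis by (simp add: bas_mult xsg_def Int_commute)
qed

subsection \<open>Supports\<close>

lemma supp_in_0 [simp]: "0 \<in> supp_in A"
  and supp_in_add: "v \<in> supp_in A \<Longrightarrow> w \<in> supp_in A \<Longrightarrow> v + w \<in> supp_in A"
  and supp_in_minus: "v \<in> supp_in A \<Longrightarrow> - v \<in> supp_in A"
  and supp_in_diff: "v \<in> supp_in A \<Longrightarrow> w \<in> supp_in A \<Longrightarrow> v - w \<in> supp_in A"
  and supp_in_of_int: "v \<in> supp_in A \<Longrightarrow> of_int k * v \<in> supp_in A"
  and supp_in_bas: "S \<in> A \<Longrightarrow> bas S \<in> supp_in A"
  and supp_in_mono: "A \<subseteq> B \<Longrightarrow> v \<in> supp_in A \<Longrightarrow> v \<in> supp_in B"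
  using keys_add[of "coefs v" "coefs w"] keys_diff[of "coefs v" "coefs w"] keys_cmul[of k "coefs v"]
  by (auto simp: supp_in_def bas.rep_eq)

lemma supp_in_sum: "(\<And>i. i \<in> I \<Longrightarrow> f i \<in> supp_in A) \<Longrightarrow> (\<Sum>i\<in>I. f i) \<in> supp_in A"
  by (induction I rule: infinite_finite_induct) (auto simp: supp_in_add)

lemma supp_in_lin: "(\<And>w. w \<in> Poly_Mapping.keys c \<Longrightarrow> f w \<in> supp_in A) \<Longrightarrow> lin f c \<in> supp_in A"
  by (auto simp: lin_def intro!: supp_in_sum supp_in_of_int)

lemma supp_in_mult:
  assumes "v \<in> supp_in A" "w \<in> supp_in B"
    and "\<And>S T. S \<in> A \<Longrightarrow> T \<in> B \<Longrightarrow> finite S \<Longrightarrow> finite T \<Longrightarrow> S \<inter> T = {} \<Longrightarrow> S \<union> T \<in> C"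
  shows "v * w \<in> supp_in C"
  using assms(1)
proof (induction v rule: ext_supp_induct)
  case (bas S)
  show ?case using assms(2)
  proof (induction w rule: ext_supp_induct)
    case (bas T)
    then show ?case using assms(3)[of S T] \<open>finite S\<close> \<open>S \<in> A\<close>
      by (cases "S \<inter> T = {}") (auto simp: bas_mult xsg_def simp del: of_int_power intro!: supp_in_of_int supp_in_bas)
  qed (auto simp: right_diff_distrib supp_in_diff)
qed (auto simp: left_diff_distrib supp_in_diff)


subsection \<open>The universal property\<close>

text \<open>The congruence modulo \<open>K\<close> is what makes this lemma apply to presented rings.\<close>

lemma gen_step_mod:
  fixes F :: "ext \<Rightarrow> 'g::ab_group_add"
  assumes F: "\<And>v w. F (v - w) = F v - F w"
    and bas: "\<And>i S. i \<in> A \<Longrightarrow> finite S \<Longrightarrow> S \<subseteq> A \<Longrightarrow> \<forall>j\<in>S. i < j \<Longrightarrow> F (bas (insert i S)) = op i (F (bas S))"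
    and op: "\<And>i x y. op i (x - y) = op i x - op i y"
    and K0: "0 \<in> K" and K: "\<And>x y. x \<in> K \<Longrightarrow> y \<in> K \<Longrightarrow> x - y \<in> K" and opK: "\<And>i x. i \<in> A \<Longrightarrow> x \<in> K \<Longrightarrow> op i x \<in> K"
    and sq: "\<And>i S. i \<in> A \<Longrightarrow> finite S \<Longrightarrow> S \<subseteq> A \<Longrightarrow> op i (op i (F (bas S))) \<in> K"
    and anti: "\<And>i j S. i \<in> A \<Longrightarrow> j \<in> A \<Longrightarrow> finite S \<Longrightarrow> S \<subseteq> A \<Longrightarrow>
      op i (op j (F (bas S))) + op j (op i (F (bas S))) \<in> K"
    and "i \<in> A" "v \<in> supp_in (Pow A)"
  shows "F (gen i * v) - op i (F v) \<in> K"
proof -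
  have F0: "F 0 = 0" using F[of 0 0] by simp
  have Fm: "F (- x) = - F x" for x using F[of 0 x] F0 by simp
  have op0: "op i 0 = 0" for i using op[of i 0 0] by simp
  have Kadd: "x + y \<in> K" if "x \<in> K" "y \<in> K" for x y
    using K[OF that(1) K[OF K0 that(2)]] by simp
  have Kneg: "- x \<in> K" if "x \<in> K" for x using K[OF K0 that] by simp
  \<comment> \<open>If m precedes every index in the support, multiplication by \<open>gen m\<close>
    only prepends it to sorted monomials, and the rule holds without error term.\<close>
  have *: "F (gen m * w) = op m (F w)" if "m \<in> A" "w \<in> supp_in {S. S \<subseteq> A \<and> (\<forall>j\<in>S. m < j)}" for m w
    using that(2)
  proof (induction w rule: ext_supp_induct)
    case (bas S)
    then show ?case using assms(2)[of m S] that(1) by (simp add: bas_insert_less)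
  qed (auto simp: F0 op0 right_diff_distrib F op)
  have main: "\<forall>i\<in>A. S \<subseteq> A \<longrightarrow> F (gen i * bas S) - op i (F (bas S)) \<in> K" if "finite S" for S
    using that
  proof (induction S rule: finite_linorder_min_induct)
    case empty
    then show ?case using * K0 by (simp add: supp_in_bas)
  next
    case (insert m S)
    show ?case
    proof (intro ballI impI)
      fix i assume i: "i \<in> A" and S: "insert m S \<subseteq> A"
      then have m: "m \<in> A" "S \<subseteq> A" by auto
      have FS: "F (bas (Set.insert m S)) = op m (F (bas S))" using bas m insert by auto
      consider "i < m" | "i = m" | "m < i" by linarith
      then show "F (gen i * bas (Set.insert m S)) - op i (F (bas (Set.insert m S))) \<in> K"
      proof cases
        case 1
        then have "bas (Set.insert m S) \<in> supp_in {S. S \<subseteq> A \<and> (\<forall>j\<in>S. i < j)}"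
          using insert S by (intro supp_in_bas) auto
        then show ?thesis using * i K0 by simp
      next
        case 2
        then have "gen i * bas (Set.insert m S) = 0" by (simp add: gen_mult_bas)
        then show ?thesis using sq[of m S] m insert Kneg 2 by (simp add: F0 FS)
      next
        \<comment> \<open>Swap \<open>gen i\<close> past the leading \<open>gen m\<close>. The
          product \<open>gen i * bas S\<close> lies above m, where the exact rule applies; the
          induction hypothesis for S leaves an error in K, which \<open>op m\<close>
          preserves.\<close>
        case 3
        have "gen i * bas (Set.insert m S) = - (gen m * (gen i * bas S))"
          using insert gen_anticomm[of i m] by (simp add: bas_insert_less flip: mult.assoc)
        moreover have "gen i * bas S \<in> supp_in {S. S \<subseteq> A \<and> (\<forall>j\<in>S. m < j)}"
          using insert 3 i m by (auto simp: gen_mult_bas intro!: supp_in_of_int supp_in_bas)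
        ultimately have e: "F (gen i * bas (Set.insert m S)) = - op m (F (gen i * bas S))"
          using * m by (simp add: Fm)
        have "op m (F (gen i * bas S) - op i (F (bas S))) \<in> K"
          using insert i m opK by auto
        then have "op m (F (gen i * bas S)) - op m (op i (F (bas S))) \<in> K" by (simp add: op)
        from Kneg[OF Kadd[OF this anti[of i m S]]] i m insert
        show ?thesis by (simp add: e FS add.commute[of "- op i (op m (F (bas S)))"])
      qed
    qed
  qed
  show ?thesis using \<open>v \<in> _\<close>
  proof (induction v rule: ext_supp_induct)
    case zero
    then show ?case by (simp add: F0 op0 K0)
  next
    case (bas S)
    then show ?case using main \<open>i \<in> A\<close> by auto
  next
    case (diff v w)
    then show ?case using K[of "F (gen i * v) - op i (F v)" "F (gen i * w) - op i (F w)"]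
      by (simp add: right_diff_distrib F op algebra_simps)
  qed
qed

lemma sorted_list_of_set_insert_less:
  "finite S \<Longrightarrow> \<forall>j\<in>S. i < j \<Longrightarrow> sorted_list_of_set (insert i S) = i # sorted_list_of_set S"
  for i :: nat
  by (subst sorted_list_of_set_insert) (auto intro!: insort_is_Cons less_imp_le)

text \<open>The candidate for the algebra homomorphism with value \<open>\<delta> i\<close> at
  \<open>gen i\<close>. It is always additive, and it is multiplicative once the values anticommute
  and square to zero.\<close>

definition extmap :: "(nat \<Rightarrow> 'r::ring_1) \<Rightarrow> ext \<Rightarrow> 'r" where
  "extmap \<delta> v = lin (\<lambda>S. prod_list (map \<delta> (sorted_list_of_set S))) (coefs v)"

lemma extmap_additive: "extmap \<delta> (v + w) = extmap \<delta> v + extmap \<delta> w" "extmap \<delta> (v - w) = extmap \<delta> v - extmap \<delta> w"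
   "extmap \<delta> 0 = 0" "extmap \<delta> (- v) = - extmap \<delta> v" "extmap \<delta> (of_int k * v) = of_int k * extmap \<delta> v"
  by (simp_all add: extmap_def lin_add lin_diff lin_minus lin_cmul)

lemma extmap_sum: "extmap \<delta> (\<Sum>i\<in>I. f i) = (\<Sum>i\<in>I. extmap \<delta> (f i))"
  by (induction I rule: infinite_finite_induct) (auto simp: extmap_additive)

lemma extmap_bas: "finite S \<Longrightarrow> extmap \<delta> (bas S) = prod_list (map \<delta> (sorted_list_of_set S))"
  by (simp add: extmap_def coefs_bas)

lemma extmap_1 [simp]: "extmap \<delta> 1 = 1"
  using extmap_bas[of "{}" \<delta>] by (simp add: bas_empty)

lemma extmap_gen [simp]: "extmap \<delta> (gen i) = \<delta> i"
  by (simp add: gen_def extmap_bas)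

text \<open>Sorting is needed only for left multiplication by one generator; products of monomials
  then follow by peeling off least generators. The error group is zero here.\<close>

lemma extmap_gen_mult:
  assumes "\<And>i j. \<delta> i * \<delta> j = - (\<delta> j * \<delta> i)" "\<And>i. \<delta> i * \<delta> i = 0"
  shows "extmap \<delta> (gen i * v) = \<delta> i * extmap \<delta> v"
proof -
  have "extmap \<delta> (gen i * v) - \<delta> i * extmap \<delta> v \<in> {0}"
  proof (rule gen_step_mod[where A = UNIV])
    fix i j S
    show "\<delta> i * (\<delta> j * extmap \<delta> (bas S)) + \<delta> j * (\<delta> i * extmap \<delta> (bas S)) \<in> {0}"
      using assms(1)[of i j] by (simp flip: mult.assoc)
    show "\<delta> i * (\<delta> i * extmap \<delta> (bas S)) \<in> {0}"
      using assms(2)[of i] by (simp flip: mult.assoc)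
  qed (auto simp: extmap_additive extmap_bas sorted_list_of_set_insert_less right_diff_distrib supp_in_def
      simp del: sorted_list_of_set_insert sorted_list_of_set_insert_remove)
  then show ?thesis by simp
qed

lemma extmap_mult:
  assumes "\<And>i j. \<delta> i * \<delta> j = - (\<delta> j * \<delta> i)" "\<And>i. \<delta> i * \<delta> i = 0"
  shows "extmap \<delta> (v * w) = extmap \<delta> v * extmap \<delta> w"
proof (induction v rule: ext_induct)
  case (bas S)
  then show ?case
  proof (induction S rule: finite_linorder_min_induct)
    case (insert m S)
    then show ?case by (simp add: bas_insert_less mult.assoc extmap_gen_mult[OF assms])
  qed (simp add: bas_empty)
qed (simp_all add: extmap_additive left_diff_distrib)

lemma extmap_prod_list:
  assumes "\<And>i j. \<delta> i * \<delta> j = - (\<delta> j * \<delta> i)" "\<And>i. \<delta> i * \<delta> i = 0"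
  shows "extmap \<delta> (prod_list xs) = prod_list (map (extmap \<delta>) xs)"
  by (induction xs) (auto simp: extmap_mult[OF assms])

lemma bas_prod_list: "finite S \<Longrightarrow> bas S = prod_list (map gen (sorted_list_of_set S))"
proof (induction S rule: finite_linorder_min_induct)
  case (insert m S)
  then show ?case by (simp add: bas_insert_less sorted_list_of_set_insert_less del: sorted_list_of_set_insert sorted_list_of_set_insert_remove)
qed (simp add: bas_empty)

subsection \<open>Contractions and the flip\<close>

text \<open>Contraction with the functional dual to \<open>gen i\<close>: the sign moves
  \<open>gen i\<close> to the front of the monomial before it is removed. In \<open>rcon\<close> it
  is moved to the end instead.\<close>

definition lcon :: "nat \<Rightarrow> ext \<Rightarrow> ext" where
  "lcon i v = lin (\<lambda>S. if i \<in> S then of_int (below i S) * bas (S - {i}) else 0) (coefs v)"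
definition rcon :: "nat \<Rightarrow> ext \<Rightarrow> ext" where
  "rcon i v = lin (\<lambda>S. if i \<in> S then of_int (above i S) * bas (S - {i}) else 0) (coefs v)"
text \<open>A Hodge star on the generators in E, taken without signs; the corrections appear when
  operators are moved past it.\<close>

definition flip :: "nat set \<Rightarrow> ext \<Rightarrow> ext" where
  "flip E v = lin (\<lambda>S. bas (sym_diff S E)) (coefs v)"

lemma lcon_additive: "lcon i (v + w) = lcon i v + lcon i w" "lcon i (v - w) = lcon i v - lcon i w"
   "lcon i 0 = 0" "lcon i (- v) = - lcon i v" "lcon i (of_int k * v) = of_int k * lcon i v"
  by (simp_all add: lcon_def lin_add lin_diff lin_minus lin_cmul)
lemma rcon_additive: "rcon i (v + w) = rcon i v + rcon i w" "rcon i (v - w) = rcon i v - rcon i w"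
   "rcon i 0 = 0" "rcon i (- v) = - rcon i v" "rcon i (of_int k * v) = of_int k * rcon i v"
  by (simp_all add: rcon_def lin_add lin_diff lin_minus lin_cmul)
lemma flip_additive: "flip E (v + w) = flip E v + flip E w" "flip E (v - w) = flip E v - flip E w"
   "flip E 0 = 0" "flip E (- v) = - flip E v" "flip E (of_int k * v) = of_int k * flip E v"
  by (simp_all add: flip_def lin_add lin_diff lin_minus lin_cmul)

lemma flip_sum: "flip E (\<Sum>i\<in>I. f i) = (\<Sum>i\<in>I. flip E (f i))"
  by (induction I rule: infinite_finite_induct) (auto simp: flip_additive)

lemma lcon_bas: "finite S \<Longrightarrow> lcon i (bas S) = (if i \<in> S then of_int (below i S) * bas (S - {i}) else 0)"
  and rcon_bas: "finite S \<Longrightarrow> rcon i (bas S) = (if i \<in> S then of_int (above i S) * bas (S - {i}) else 0)"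
  and flip_bas: "finite S \<Longrightarrow> flip E (bas S) = bas (sym_diff S E)"
  by (simp_all add: lcon_def rcon_def flip_def coefs_bas)

lemma of_int_sq_mult:
  "k * k = 1 \<Longrightarrow> of_int k * (of_int k * v) = (v :: 'r::ring_1)"
  by (metis mult.assoc mult_1 of_int_1 of_int_mult)

lemma of_int_of_int_mult: "of_int k * (of_int l * v) = of_int (k * l) * (v :: 'r::ring_1)"
  by (simp add: mult.assoc)

text \<open>The antiderivation rule. For \<open>i \<noteq> j\<close>, removing i and inserting j
  commute as set operations, and exactly one of the two sign counts notices the other operation,
  whence the minus sign.\<close>

lemma lcon_gen_mult: "lcon i (gen j * v) = (if i = j then v else 0) - gen j * lcon i v"
proof (induction v rule: ext_induct)
  case (bas S)
  have 1: "insert j S - {i} = insert j (S - {i})" if "i \<noteq> j" using that by auto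
  have 2: "below i (insert i S) = below i S" "below i (S - {i}) = below i S"
    by (cases "i \<in> S"; use bas parity_sign_simps[of S i] in \<open>simp add: insert_absorb\<close>)+
  show ?case using bas 1 2
    by (cases "i = j"; cases "i \<in> S"; cases "j \<in> S"; cases "i < j")
       (simp_all add: gen_mult_bas lcon_bas lcon_additive parity_sign_simps insert_absorb of_int_sq_mult
        mult_of_int_left[of "gen _"] of_int_of_int_mult mult.commute[where 'a = int] mult.left_commute[where 'a = int] del: of_int_mult)
qed (auto simp: lcon_additive algebra_simps)

lemma rcon_mult_gen: "rcon i (v * gen j) = (if i = j then v else 0) - rcon i v * gen j"
proof (induction v rule: ext_induct)
  case (bas S)
  have 1: "insert j S - {i} = insert j (S - {i})" if "i \<noteq> j" using that by auto
  have 2: "above i (insert i S) = above i S" "above i (S - {i}) = above i S"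
    by (cases "i \<in> S"; use bas parity_sign_simps[of S i] in \<open>simp add: insert_absorb\<close>)+
  show ?case using bas 1 2
    by (cases "i = j"; cases "i \<in> S"; cases "j \<in> S"; cases "i < j")
       (simp_all add: bas_mult_gen rcon_bas rcon_additive parity_sign_simps insert_absorb of_int_sq_mult
        mult.assoc of_int_of_int_mult mult.commute[where 'a = int] mult.left_commute[where 'a = int] del: of_int_mult)
qed (auto simp: rcon_additive algebra_simps)

text \<open>Elements common to both sets are counted twice on the right and so drop out of the
  sign.\<close>

lemma parity_sign_sym_diff:
  assumes "finite S" "finite E" shows "parity_sign R (sym_diff S E) = parity_sign R S * parity_sign R E"
  using assms(1)
proof (induction S rule: finite_induct)
  case empty
  then show ?case by (simp add: parity_sign_def)
next
  case (insert j S)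
  show ?case
  proof (cases "j \<in> E")
    case True
    then have "sym_diff (Set.insert j S) E = sym_diff S E - {j}" "j \<in> sym_diff S E" using insert by auto
    then show ?thesis using insert assms by (simp add: parity_sign_simps)
  next
    case False
    then have "sym_diff (Set.insert j S) E = Set.insert j (sym_diff S E)" "j \<notin> sym_diff S E" using insert by auto
    then show ?thesis using insert assms by (simp add: parity_sign_simps)
  qed
qed

text \<open>Multiplication by a generator and the contraction along it both toggle the generator; they
  apply to complementary sets of monomials, and flipping a set containing the generator
  exchanges them.\<close>

lemma flip_toggle:
  assumes E: "finite E"
    and A: "\<And>v w. A (v - w) = A v - A w"
      "\<And>S. finite S \<Longrightarrow> A (bas S) = (if (i \<in> S) = a then of_int (parity_sign R S) * bas (sym_diff S {i}) else 0)"
    and B: "\<And>v w. B (v - w) = B v - B w"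
      "\<And>S. finite S \<Longrightarrow> B (bas S) = (if (i \<in> S) = (a = (i \<notin> E)) then of_int (parity_sign R S) * bas (sym_diff S {i}) else 0)"
  shows "flip E (A v) = of_int (parity_sign R E) * B (flip E v)"
proof -
  have zero: "A 0 = 0" "B 0 = 0" using A(1)[of 0 0] B(1)[of 0 0] by simp_all
  show ?thesis
  proof (induction v rule: ext_induct)
    case (bas S)
    let ?T = "sym_diff S E"
    have "sym_diff (sym_diff S {i}) E = sym_diff ?T {i}" by blast
    then have f: "flip E (bas (sym_diff S {i})) = bas (sym_diff ?T {i})" using bas by (simp add: flip_bas)
    \<comment> \<open>\<open>B\<close> acts at the flipped monomial exactly when \<open>A\<close>
      acts at the original one, and the two signs differ by that of E.\<close>
    have T: "finite ?T" "(i \<in> ?T) = (a = (i \<notin> E)) \<longleftrightarrow> (i \<in> S) = a" using bas E by auto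
    show ?case
      unfolding flip_bas[OF bas] A(2)[OF bas] B(2)[OF T(1)] T(2) parity_sign_sym_diff[OF bas E]
      by (simp add: flip_additive f mult.commute[of "parity_sign R S"] of_int_sq_mult mult.assoc)
  qed (simp_all add: zero A(1) B(1) flip_additive algebra_simps)
qed

lemma
  assumes "finite E" "i \<in> E"
  shows flip_lcon: "flip E (lcon i v) = of_int (below i E) * (gen i * flip E v)"
    and flip_rcon: "flip E (rcon i v) = of_int (above i E) * (flip E v * gen i)"
  using assms
  by (intro flip_toggle[where a = True and i = i];
      simp add: lcon_bas rcon_bas gen_mult_bas bas_mult_gen lcon_additive rcon_additive algebra_simps)+

lemma
  assumes "finite E" "i \<notin> E"
  shows flip_gen_mult: "flip E (gen i * v) = of_int (below i E) * (gen i * flip E v)"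
    and flip_mult_gen: "flip E (v * gen i) = of_int (above i E) * (flip E v * gen i)"
  using assms
  by (intro flip_toggle[where a = False and i = i];
      simp add: gen_mult_bas bas_mult_gen algebra_simps)+

lemma flip_flip: "finite E \<Longrightarrow> flip E (flip E v) = v"
proof (induction v rule: ext_induct)
  case (bas S)
  then have "sym_diff (sym_diff S E) E = S" by auto
  with bas show ?case by (simp add: flip_bas)
qed (auto simp: flip_additive)

lemma flip_supp:
  assumes "v \<in> supp_in A" "\<And>S. S \<in> A \<Longrightarrow> sym_diff S E \<in> B"
  shows "flip E v \<in> supp_in B"
  using assms(1)
  by (induction v rule: ext_supp_induct) (auto simp: flip_additive flip_bas assms(2) supp_in_bas supp_in_diff)

section \<open>Graded groups modelled on the exterior algebra\<close>

definition dproj :: "(nat set \<Rightarrow> 'd) \<Rightarrow> 'd \<Rightarrow> ext \<Rightarrow> ext" where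
  "dproj dg d v = lin (\<lambda>S. if dg S = d then bas S else 0) (coefs v)"

lemma dproj_additive: "dproj dg d (v + w) = dproj dg d v + dproj dg d w" "dproj dg d (v - w) = dproj dg d v - dproj dg d w"
   "dproj dg d 0 = 0"
  by (simp_all add: dproj_def lin_add lin_diff)

lemma dproj_sum: "dproj dg d (\<Sum>i\<in>I. f i) = (\<Sum>i\<in>I. dproj dg d (f i))"
  by (induction I rule: infinite_finite_induct) (auto simp: dproj_additive)

lemma dproj_bas: "finite S \<Longrightarrow> dproj dg d (bas S) = (if dg S = d then bas S else 0)"
  by (simp add: dproj_def coefs_bas)

lemma dproj_supp: "v \<in> supp_in A \<Longrightarrow> dproj dg d v \<in> supp_in {S \<in> A. dg S = d}"
  by (induction v rule: ext_supp_induct) (auto simp: dproj_additive dproj_bas supp_in_bas supp_in_diff)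

lemma dproj_homogeneous: "v \<in> supp_in {S \<in> A. dg S = e} \<Longrightarrow> dproj dg d v = (if e = d then v else 0)"
  by (induction v rule: ext_supp_induct) (auto simp: dproj_additive dproj_bas)

lemma dproj_total: "finite D \<Longrightarrow> v \<in> supp_in {S. dg S \<in> D} \<Longrightarrow> (\<Sum>d\<in>D. dproj dg d v) = v"
proof (rotate_tac 1, induction v rule: ext_supp_induct)
  case (bas S)
  then show ?case by (simp add: dproj_bas)
qed (simp_all add: dproj_additive sum_subtractf)

text \<open>Only closure and compatibility with the injection \<open>\<psi>\<close> are assumed. The
  group axioms and the unique decomposition into homogeneous parts are transported from
  \<open>ext\<close>, which spares checking them in each quotient.\<close>

locale ext_model =
  fixes M :: "('m, 'n) graded_scheme" and \<psi> :: "'m \<Rightarrow> ext" and J :: "nat set" and dg :: "nat set \<Rightarrow> int \<times> bit"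
  assumes finite_J: "finite J"
    and bij: "bij_betw \<psi> (carrier M) (supp_in (Pow J))"
    and zero_mem [simp]: "\<zero>\<^bsub>M\<^esub> \<in> carrier M" and psi_zero [simp]: "\<psi> \<zero>\<^bsub>M\<^esub> = 0"
    and add_mem: "x \<in> carrier M \<Longrightarrow> y \<in> carrier M \<Longrightarrow> x \<oplus>\<^bsub>M\<^esub> y \<in> carrier M"
    and psi_add: "x \<in> carrier M \<Longrightarrow> y \<in> carrier M \<Longrightarrow> \<psi> (x \<oplus>\<^bsub>M\<^esub> y) = \<psi> x + \<psi> y"
    and hpart_closed: "hpart M d \<subseteq> carrier M"
    and psi_hpart: "\<psi> ` hpart M d = supp_in {S \<in> Pow J. dg S = d}"
begin

lemma psi_inj: "x \<in> carrier M \<Longrightarrow> y \<in> carrier M \<Longrightarrow> \<psi> x = \<psi> y \<Longrightarrow> x = y"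
  using bij by (auto simp: bij_betw_def inj_on_def)

lemma psi_supp: "x \<in> carrier M \<Longrightarrow> \<psi> x \<in> supp_in (Pow J)"
  using bij by (auto simp: bij_betw_def)

lemma psi_surj: "v \<in> supp_in (Pow J) \<Longrightarrow> \<exists>x \<in> carrier M. \<psi> x = v"
  using bij unfolding bij_betw_def by (metis imageE)

lemma mem_hpart_iff: "x \<in> hpart M d \<longleftrightarrow> x \<in> carrier M \<and> \<psi> x \<in> supp_in {S \<in> Pow J. dg S = d}"
proof
  assume x: "x \<in> carrier M \<and> \<psi> x \<in> supp_in {S \<in> Pow J. dg S = d}"
  then have "\<psi> x \<in> \<psi> ` hpart M d" unfolding psi_hpart by blast
  then obtain y where y: "\<psi> x = \<psi> y" "y \<in> hpart M d" by (rule imageE)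
  have "y \<in> carrier M" by (rule subsetD[OF hpart_closed y(2)])
  with x y show "x \<in> hpart M d" using psi_inj[of x y] by simp
next
  assume x: "x \<in> hpart M d"
  then have "\<psi> x \<in> supp_in {S \<in> Pow J. dg S = d}" unfolding psi_hpart[symmetric] by (rule imageI)
  then show "x \<in> carrier M \<and> \<psi> x \<in> supp_in {S \<in> Pow J. dg S = d}"
    using subsetD[OF hpart_closed x] by blast
qed

lemma abelian_group_M: "abelian_group M"
proof (intro abelian_groupI)
  fix x assume x: "x \<in> carrier M"
  obtain y where "y \<in> carrier M" "\<psi> y = - \<psi> x"
    using psi_surj[OF supp_in_minus[OF psi_supp[OF x]]] by auto
  with x show "\<exists>y\<in>carrier M. y \<oplus>\<^bsub>M\<^esub> x = \<zero>\<^bsub>M\<^esub>"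
    by (intro bexI[of _ y] psi_inj) (auto simp: add_mem psi_add)
qed (auto intro!: psi_inj simp: add_mem psi_add add.assoc add.commute)

sublocale abelian_group M
  by (rule abelian_group_M)

lemma psi_a_inv: "x \<in> carrier M \<Longrightarrow> \<psi> (\<ominus>\<^bsub>M\<^esub> x) = - \<psi> x"
  by (metis a_inv_closed add_eq_0_iff l_neg psi_add psi_zero add.commute)

lemma psi_nat_pow: "x \<in> carrier M \<Longrightarrow> \<psi> ([k] \<cdot>\<^bsub>M\<^esub> x) = of_nat k * \<psi> x" for k :: nat
  by (induction k) (simp_all add: psi_add distrib_right add.commute[of "_ :: ext"])

lemma psi_int_pow: "x \<in> carrier M \<Longrightarrow> \<psi> ([k] \<cdot>\<^bsub>M\<^esub> x) = of_int k * \<psi> x" for k :: int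
proof (cases "k \<ge> 0")
  case True
  assume "x \<in> carrier M"
  then have "\<psi> ([nat k] \<cdot>\<^bsub>M\<^esub> x) = of_nat (nat k) * \<psi> x" by (rule psi_nat_pow)
  moreover have "[nat k] \<cdot>\<^bsub>M\<^esub> x = [int (nat k)] \<cdot>\<^bsub>M\<^esub> x" by (simp add: add_pow_int_ge)
  moreover have "(of_nat (nat k) :: ext) = of_int k" using True by simp
  ultimately show ?thesis using True by simp
next
  case False
  assume x: "x \<in> carrier M"
  have "[k] \<cdot>\<^bsub>M\<^esub> x = \<ominus>\<^bsub>M\<^esub> ([nat (- k)] \<cdot>\<^bsub>M\<^esub> x)" using False by (simp add: add_pow_int_lt)
  then show ?thesis using False x psi_nat_pow[OF x, of "nat (- k)"]
    by (simp add: psi_a_inv)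
qed

lemma psi_finsum: "f \<in> A \<rightarrow> carrier M \<Longrightarrow> \<psi> (\<Oplus>\<^bsub>M\<^esub>i\<in>A. f i) = (\<Sum>i\<in>A. \<psi> (f i))"
  by (induction A rule: infinite_finite_induct) (auto simp: psi_add finsum_closed)

text \<open>\<open>coset_ext\<close> is a \<open>the_elem\<close>, so the additive extension must
  take one value on all of A. Injectivity of \<open>\<psi>\<close> reduces this to the image in
  \<open>ext\<close>, which is the value of \<open>lin h\<close>.\<close>

lemma coset_ext_model:
  assumes "A \<noteq> {}" "\<And>c w. c \<in> A \<Longrightarrow> w \<in> Poly_Mapping.keys c \<Longrightarrow> f w \<in> carrier M \<and> \<psi> (f w) = h w"
    and "\<And>c. c \<in> A \<Longrightarrow> lin h c = v"
  shows "coset_ext M f A \<in> carrier M" "\<psi> (coset_ext M f A) = v"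
proof -
  let ?s = "\<lambda>c. \<Oplus>\<^bsub>M\<^esub>w \<in> Poly_Mapping.keys c. [Poly_Mapping.lookup c w] \<cdot>\<^bsub>M\<^esub> f w"
  have s: "?s c \<in> carrier M" "\<psi> (?s c) = v" if "c \<in> A" for c
  proof -
    have *: "(\<lambda>w. [Poly_Mapping.lookup c w] \<cdot>\<^bsub>M\<^esub> f w) \<in> Poly_Mapping.keys c \<rightarrow> carrier M"
      using assms(2)[OF that] by auto
    then show "?s c \<in> carrier M" by (rule finsum_closed)
    show "\<psi> (?s c) = v"
      unfolding psi_finsum[OF *] assms(3)[OF that, symmetric] lin_def
      using assms(2)[OF that] by (auto simp: psi_int_pow intro!: sum.cong)
  qed
  obtain c where c: "c \<in> A" using assms(1) by auto
  have "?s ` A = {?s c}"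
  proof (intro subset_antisym subsetI)
    fix x assume "x \<in> ?s ` A"
    then obtain d where d: "x = ?s d" "d \<in> A" by blast
    have "?s d = ?s c" using s[OF c] s[OF d(2)] by (intro psi_inj) simp_all
    with d show "x \<in> {?s c}" by blast
  qed (use c in blast)
  then have "coset_ext M f A = ?s c" by (simp add: coset_ext_def)
  with s[OF c] show "coset_ext M f A \<in> carrier M" "\<psi> (coset_ext M f A) = v" by simp_all
qed

lemma graded_group_M: "graded_group M"
  unfolding graded_group_def
proof (intro conjI allI ballI abelian_group_M)
  fix d
  have "\<zero>\<^bsub>M\<^esub> \<in> hpart M d" by (simp add: mem_hpart_iff)
  then have "hpart M d \<noteq> {}" by blast
  then show "subgroup (hpart M d) (add_monoid M)"
    by (intro add.subgroupI)
       (auto simp: mem_hpart_iff add_mem psi_add supp_in_add supp_in_minus psi_a_inv a_inv_def[symmetric])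
next
  fix x assume x: "x \<in> carrier M"
  let ?v = "\<psi> x" and ?D = "dg ` Pow J"
  have fD: "finite ?D" using finite_J by simp
  have "\<forall>d. \<exists>y. y \<in> hpart M d \<and> \<psi> y = dproj dg d ?v"
  proof
    fix d
    have "dproj dg d ?v \<in> \<psi> ` hpart M d"
      unfolding psi_hpart using dproj_supp[OF psi_supp[OF x], of dg d] by simp
    then obtain y where "dproj dg d ?v = \<psi> y" "y \<in> hpart M d" by (rule imageE)
    then show "\<exists>y. y \<in> hpart M d \<and> \<psi> y = dproj dg d ?v" by metis
  qed
  then obtain f where f: "\<And>d. f d \<in> hpart M d" "\<And>d. \<psi> (f d) = dproj dg d ?v" by metis
  have fc: "f d \<in> carrier M" for d using f(1)[of d] hpart_closed[of d] by blast
  \<comment> \<open>Nonzero components occur only in degrees of subsets of J, of which there are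
    finitely many.\<close>
  have fnz: "f d \<noteq> \<zero>\<^bsub>M\<^esub> \<Longrightarrow> d \<in> ?D" for d
  proof (rule ccontr)
    assume "f d \<noteq> \<zero>\<^bsub>M\<^esub>" "d \<notin> ?D"
    then have e: "{S \<in> Pow J. dg S = d} = {}" by blast
    have "coefs (dproj dg d ?v) = 0"
      using dproj_supp[OF psi_supp[OF x], of dg d] unfolding e by (simp add: supp_in_def)
    then have "dproj dg d ?v = 0" by (simp add: coefs_inject[symmetric])
    then show False using f fc psi_inj[of "f d" "\<zero>\<^bsub>M\<^esub>"] \<open>f d \<noteq> \<zero>\<^bsub>M\<^esub>\<close> by simp
  qed
  show "\<exists>!f. (\<forall>d. f d \<in> hpart M d) \<and> finite {d. f d \<noteq> \<zero>\<^bsub>M\<^esub>} \<and> x = (\<Oplus>\<^bsub>M\<^esub>d \<in> {d. f d \<noteq> \<zero>\<^bsub>M\<^esub>}. f d)"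
  proof (intro ex1I[of _ f] conjI allI f(1))
    show fin: "finite {d. f d \<noteq> \<zero>\<^bsub>M\<^esub>}" using fnz by (intro finite_subset[OF _ fD]) auto
    have "\<psi> (\<Oplus>\<^bsub>M\<^esub>d \<in> {d. f d \<noteq> \<zero>\<^bsub>M\<^esub>}. f d) = (\<Sum>d \<in> {d. f d \<noteq> \<zero>\<^bsub>M\<^esub>}. dproj dg d ?v)"
      using fc by (subst psi_finsum) (auto simp: f)
    also have "\<dots> = (\<Sum>d\<in>?D. dproj dg d ?v)"
      using fnz by (intro sum.mono_neutral_left fD) (auto simp flip: f(2))
    also have "\<dots> = ?v" by (rule dproj_total[OF fD]) (use psi_supp[OF x] in \<open>auto simp: supp_in_def\<close>)
    finally show "x = (\<Oplus>\<^bsub>M\<^esub>d \<in> {d. f d \<noteq> \<zero>\<^bsub>M\<^esub>}. f d)"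
      using fc x by (intro psi_inj finsum_closed) auto
  next
    fix g assume g: "(\<forall>d. g d \<in> hpart M d) \<and> finite {d. g d \<noteq> \<zero>\<^bsub>M\<^esub>} \<and> x = (\<Oplus>\<^bsub>M\<^esub>d \<in> {d. g d \<noteq> \<zero>\<^bsub>M\<^esub>}. g d)"
    then have gc: "g d \<in> carrier M" "\<psi> (g d) \<in> supp_in {S \<in> Pow J. dg S = d}" for d
      using mem_hpart_iff[of "g d" d] by blast+
    have v: "?v = (\<Sum>d\<in>{d. g d \<noteq> \<zero>\<^bsub>M\<^esub>}. \<psi> (g d))"
      using g gc by (subst psi_finsum[symmetric]) auto
    show "g = f"
    proof
      fix d
      \<comment> \<open>Projecting any decomposition to degree d leaves only its summand in that
        degree, which is therefore determined by x.\<close>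
      have "dproj dg d ?v = (\<Sum>e\<in>{d. g d \<noteq> \<zero>\<^bsub>M\<^esub>}. if e = d then \<psi> (g e) else 0)"
        unfolding v dproj_sum by (intro sum.cong refl dproj_homogeneous[where A = "Pow J"] gc)
      also have "\<dots> = \<psi> (g d)" using g by auto
      finally show "g d = f d" using gc fc f(2) by (intro psi_inj) auto
    qed
  qed
qed

end

text \<open>Degrees need to add for disjoint sets only, because products of overlapping monomials
  vanish.\<close>

locale ext_ring_model = ext_model +
  assumes one_mem: "\<one>\<^bsub>M\<^esub> \<in> carrier M" and psi_one: "\<psi> \<one>\<^bsub>M\<^esub> = 1"
    and mult_mem: "x \<in> carrier M \<Longrightarrow> y \<in> carrier M \<Longrightarrow> x \<otimes>\<^bsub>M\<^esub> y \<in> carrier M"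
    and psi_mult: "x \<in> carrier M \<Longrightarrow> y \<in> carrier M \<Longrightarrow> \<psi> (x \<otimes>\<^bsub>M\<^esub> y) = \<psi> x * \<psi> y"
    and dg_empty: "dg {} = 0"
    and dg_Un: "S \<subseteq> J \<Longrightarrow> T \<subseteq> J \<Longrightarrow> S \<inter> T = {} \<Longrightarrow> dg (S \<union> T) = dg S + dg T"
begin

lemma ring_M: "ring M"
  by (intro ringI abelian_group_M monoid.intro)
     (auto intro!: psi_inj simp: mult_mem psi_mult one_mem psi_one psi_add add_mem algebra_simps)

lemma super_ring_M: "super_ring M"
  unfolding super_ring_def
proof (intro conjI ring_M graded_group_M allI ballI)
  show "\<one>\<^bsub>M\<^esub> \<in> hpart M 0"
    using supp_in_bas[of "{}" "{S \<in> Pow J. dg S = 0}"]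
    by (simp add: mem_hpart_iff one_mem psi_one dg_empty bas_empty)
  fix d e x y assume "x \<in> hpart M d" "y \<in> hpart M e"
  then show "x \<otimes>\<^bsub>M\<^esub> y \<in> hpart M (d + e)"
    by (auto simp: mem_hpart_iff mult_mem psi_mult dg_Un intro: supp_in_mult)
qed

end

section \<open>Rings presented by anticommuting generators\<close>

abbreviation fmul :: "('x list \<Rightarrow>\<^sub>0 int) \<Rightarrow> ('x list \<Rightarrow>\<^sub>0 int) \<Rightarrow> ('x list \<Rightarrow>\<^sub>0 int)" where
  "fmul c d \<equiv> frag_extend (\<lambda>u. frag_extend (\<lambda>v. frag_of (u @ v)) d) c"

lemma fmul_additive: "fmul (a + b) c = fmul a c + fmul b c" "fmul c (a + b) = fmul c a + fmul c b"
    "fmul (a - b) c = fmul a c - fmul b c" "fmul c (a - b) = fmul c a - fmul c b"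
    "fmul (- a) c = - fmul a c"
  by (simp_all add: frag_extend_add frag_extend_add_fun frag_extend_diff frag_extend_diff_fun frag_extend_minus)

lemma fmul_assoc: "fmul (fmul a b) c = fmul a (fmul b c)"
proof (rule frag_induction[OF subset_UNIV, of _ a])
  fix u
  show "fmul (fmul (frag_of u) b) c = fmul (frag_of u) (fmul b c)"
  proof (rule frag_induction[OF subset_UNIV, of _ b])
    fix v
    show "fmul (fmul (frag_of u) (frag_of v)) c = fmul (frag_of u) (fmul (frag_of v) c)"
      by (rule frag_induction[OF subset_UNIV, of _ c]) (auto simp: fmul_additive frag_extend_diff)
  qed (auto simp: fmul_additive frag_extend_diff)
qed (auto simp: fmul_additive frag_extend_diff)

lemma free_ring_simps [simp]:
  "carrier (free_ring A) = {c. Poly_Mapping.keys c \<subseteq> lists A}"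
  "c \<otimes>\<^bsub>free_ring A\<^esub> d = fmul c d" "\<one>\<^bsub>free_ring A\<^esub> = frag_of []" "\<zero>\<^bsub>free_ring A\<^esub> = 0" "c \<oplus>\<^bsub>free_ring A\<^esub> d = c + d"
  by (simp_all add: free_ring_def)

lemma keys_fmul: "Poly_Mapping.keys c \<subseteq> lists A \<Longrightarrow> Poly_Mapping.keys d \<subseteq> lists A \<Longrightarrow> Poly_Mapping.keys (fmul c d) \<subseteq> lists A"
  by (intro order_trans[OF keys_frag_extend] UN_least order_trans[OF keys_frag_extend]) auto

lemma keys_add_subset: "Poly_Mapping.keys c \<subseteq> B \<Longrightarrow> Poly_Mapping.keys d \<subseteq> B \<Longrightarrow> Poly_Mapping.keys (c + d) \<subseteq> B"
  by (metis Un_least keys_add order_trans)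

lemma ring_free_ring: "ring (free_ring A)"
proof (intro ringI abelian_groupI monoid.intro)
  fix x assume "x \<in> carrier (free_ring A)"
  then show "\<exists>y\<in>carrier (free_ring A). y \<oplus>\<^bsub>free_ring A\<^esub> x = \<zero>\<^bsub>free_ring A\<^esub>"
    by (intro bexI[of _ "- x"]) auto
  show "x \<oplus>\<^bsub>free_ring A\<^esub> y \<in> carrier (free_ring A)" "x \<otimes>\<^bsub>free_ring A\<^esub> y \<in> carrier (free_ring A)"
    if "x \<in> carrier (free_ring A)" "y \<in> carrier (free_ring A)" for x y
    using that keys_add_subset[of x _ y] keys_fmul[of x A y] by simp_all
qed (simp_all add: fmul_assoc fmul_additive ac_simps flip: frag_expansion)

lemma frag_cmul_diff2: "frag_cmul k (c - d) = frag_cmul k c - frag_cmul k d"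
  by (rule poly_mapping_eqI) (simp add: lookup_minus right_diff_distrib)

text \<open>
  \<open>\<kappa> a j\<close> is the coefficient of the letter \<open>a\<close> at the letter \<open>y j\<close>: the letters \<open>y j\<close> with
  \<open>j \<in> J\<close> generate, and the \<open>j\<close>-th of them becomes the generator with index \<open>j\<close>.
\<close>

locale presentation_data =
  fixes A :: "'x set" and rels :: "('x list \<Rightarrow>\<^sub>0 int) set" and wt :: "'x \<Rightarrow> int \<times> bit"
    and \<kappa> :: "'x \<Rightarrow> nat \<Rightarrow> int" and J :: "nat set" and y :: "nat \<Rightarrow> 'x" and dg1 :: "nat \<Rightarrow> int \<times> bit"
begin

definition I where "I = Idl\<^bsub>free_ring A\<^esub> rels"
definition val :: "'x \<Rightarrow> ext" where "val a = (\<Sum>j\<in>J. of_int (\<kappa> a j) * gen j)"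
definition ev :: "('x list \<Rightarrow>\<^sub>0 int) \<Rightarrow> ext" where "ev = lin (\<lambda>w. prod_list (map val w))"

end

text \<open>Kept apart from \<open>presentation_data\<close> so that the assumptions can mention
  \<open>I\<close> and \<open>ev\<close>. \<open>ev_rels\<close> keeps the sorted monomials
  independent in the quotient, while \<open>expand\<close>, \<open>anti\<close> and
  \<open>sq\<close> make them span it.\<close>

locale ext_presentation = presentation_data A rels wt \<kappa> J y dg1
  for A :: "'x set" and rels wt \<kappa> J y dg1 +
  assumes finite_J: "finite J" and y_closed: "j \<in> J \<Longrightarrow> y j \<in> A"
    and rels_closed: "rels \<subseteq> carrier (free_ring A)"
    and kappa_y: "j \<in> J \<Longrightarrow> k \<in> J \<Longrightarrow> \<kappa> (y j) k = (if j = k then 1 else 0)"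
    and ev_rels: "r \<in> rels \<Longrightarrow> ev r = 0"
    and anti: "i \<in> J \<Longrightarrow> j \<in> J \<Longrightarrow> frag_of [y i, y j] + frag_of [y j, y i] \<in> I"
    and sq: "i \<in> J \<Longrightarrow> frag_of [y i, y i] \<in> I"
    and expand: "a \<in> A \<Longrightarrow> frag_of [a] - (\<Sum>j\<in>J. frag_cmul (\<kappa> a j) (frag_of [y j])) \<in> I"
    and wt: "a \<in> A \<Longrightarrow> j \<in> J \<Longrightarrow> \<kappa> a j \<noteq> 0 \<Longrightarrow> wt a = dg1 j"
begin

definition dgs :: "nat set \<Rightarrow> int \<times> bit" where "dgs S = (\<Sum>j\<in>S. dg1 j)"
text \<open>Sorted words in the letters \<open>y j\<close> are the normal forms; this map is a
  section of \<open>ev\<close> on \<open>supp_in (Pow J)\<close>.\<close>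

definition \<theta> :: "ext \<Rightarrow> ('x list \<Rightarrow>\<^sub>0 int)" where
  "\<theta> v = frag_extend (\<lambda>S. frag_of (map y (sorted_list_of_set S))) (coefs v)"
text \<open>An arbitrary representative serves, because \<open>ev\<close> vanishes on the
  ideal.\<close>

definition psi :: "('x list \<Rightarrow>\<^sub>0 int) set \<Rightarrow> ext" where "psi X = ev (SOME c. c \<in> X)"

sublocale R: ring "free_ring A" by (rule ring_free_ring)

section \<open>Straightening words modulo the relations\<close>

lemma ideal_I: "ideal I (free_ring A)"
  unfolding I_def by (rule R.genideal_ideal[OF rels_closed])

lemmas I_additive_subgroup = ideal.axioms(1)[OF ideal_I]

lemma I_closed: "c \<in> I \<Longrightarrow> Poly_Mapping.keys c \<subseteq> lists A"
  using additive_subgroup.a_subset[OF I_additive_subgroup] by auto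

lemma I_mult: "c \<in> I \<Longrightarrow> Poly_Mapping.keys d \<subseteq> lists A \<Longrightarrow> fmul c d \<in> I"
    "c \<in> I \<Longrightarrow> Poly_Mapping.keys d \<subseteq> lists A \<Longrightarrow> fmul d c \<in> I"
  using ideal.I_l_closed[OF ideal_I, of c d] ideal.I_r_closed[OF ideal_I, of c d] by auto

lemma I_0: "0 \<in> I" and I_add: "c \<in> I \<Longrightarrow> d \<in> I \<Longrightarrow> c + d \<in> I"
  using additive_subgroup.zero_closed[OF I_additive_subgroup] additive_subgroup.a_closed[OF I_additive_subgroup, of c d] by auto

lemma I_minus: "c \<in> I \<Longrightarrow> - c \<in> I"
  using I_mult(2)[of c "- frag_of []"] by (simp add: fmul_additive flip: frag_expansion)

lemma I_diff: "c \<in> I \<Longrightarrow> d \<in> I \<Longrightarrow> c - d \<in> I"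
  using I_add[OF _ I_minus, of c d] by simp

lemma I_cmul: "c \<in> I \<Longrightarrow> frag_cmul k c \<in> I"
  by (rule frag_closure_minus_cmul) (auto simp: I_0 I_diff)

lemma I_sum: "(\<And>j. j \<in> S \<Longrightarrow> f j \<in> I) \<Longrightarrow> sum f S \<in> I"
  by (induction S rule: infinite_finite_induct) (auto simp: I_0 I_add)

lemma ev_additive: "ev (c + d) = ev c + ev d" "ev (c - d) = ev c - ev d" "ev (- c) = - ev c" "ev 0 = 0"
   "ev (frag_cmul k c) = of_int k * ev c"
  by (simp_all add: ev_def lin_add lin_diff lin_minus lin_cmul)

lemma ev_mult: "ev (fmul c d) = ev c * ev d"
  by (simp add: ev_def lin_frag_extend lin_mult_left lin_mult_right)

lemma val_y: "j \<in> J \<Longrightarrow> val (y j) = gen j"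
proof -
  assume j: "j \<in> J"
  then have "val (y j) = (\<Sum>k\<in>J. if j = k then gen k else 0)"
    unfolding val_def by (intro sum.cong) (auto simp: kappa_y)
  then show ?thesis using j finite_J by simp
qed

lemma theta_additive: "\<theta> (v + w) = \<theta> v + \<theta> w" "\<theta> (v - w) = \<theta> v - \<theta> w" "\<theta> 0 = 0" "\<theta> (of_int k * v) = frag_cmul k (\<theta> v)"
  by (simp_all add: \<theta>_def frag_extend_add frag_extend_diff frag_extend_cmul)

lemma theta_sum: "\<theta> (sum f S) = (\<Sum>i\<in>S. \<theta> (f i))"
  by (induction S rule: infinite_finite_induct) (auto simp: theta_additive)

lemma theta_bas: "finite S \<Longrightarrow> \<theta> (bas S) = frag_of (map y (sorted_list_of_set S))"
  by (simp add: \<theta>_def coefs_bas)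

lemma theta_closed: "v \<in> supp_in (Pow J) \<Longrightarrow> Poly_Mapping.keys (\<theta> v) \<subseteq> lists A"
  unfolding \<theta>_def
proof (rule order_trans[OF keys_frag_extend], intro UN_least)
  fix S assume "v \<in> supp_in (Pow J)" "S \<in> Poly_Mapping.keys (coefs v)"
  then have "S \<subseteq> J" "finite S" using finite_keys_coefs by (auto simp: supp_in_def)
  then show "Poly_Mapping.keys (frag_of (map y (sorted_list_of_set S))) \<subseteq> lists A"
    by (auto intro!: y_closed)
qed

text \<open>Sorting a letter into a sorted word costs only anticommutation and square relations,
  that is, an error in \<open>I\<close>.\<close>

lemma theta_gen_mult:
  assumes "i \<in> J" "v \<in> supp_in (Pow J)"
  shows "\<theta> (gen i * v) - fmul (frag_of [y i]) (\<theta> v) \<in> I"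
proof (rule gen_step_mod[where A = J])
  fix i j S assume ij: "i \<in> J" "j \<in> J" and S: "finite S" "S \<subseteq> J"
  have c: "Poly_Mapping.keys (\<theta> (bas S)) \<subseteq> lists A" by (rule theta_closed) (simp add: S supp_in_bas)
  show "fmul (frag_of [y i]) (fmul (frag_of [y j]) (\<theta> (bas S))) + fmul (frag_of [y j]) (fmul (frag_of [y i]) (\<theta> (bas S))) \<in> I"
    using I_mult(1)[OF anti[OF ij] c] by (simp only: fmul_assoc[symmetric] fmul_additive[symmetric]) simp
next
  fix i S assume i: "i \<in> J" and S: "finite S" "S \<subseteq> J"
  have c: "Poly_Mapping.keys (\<theta> (bas S)) \<subseteq> lists A" by (rule theta_closed) (simp add: S supp_in_bas)
  show "fmul (frag_of [y i]) (fmul (frag_of [y i]) (\<theta> (bas S))) \<in> I"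
    using I_mult(1)[OF sq[OF i] c] by (simp only: fmul_assoc[symmetric]) simp
next
  fix i x assume "i \<in> J" "x \<in> I"
  then show "fmul (frag_of [y i]) x \<in> I" using y_closed by (intro I_mult(2)) auto
next
  fix i and S :: "nat set" assume "finite S" "\<forall>j\<in>S. i < j"
  then show "\<theta> (bas (insert i S)) = fmul (frag_of [y i]) (\<theta> (bas S))"
    by (simp add: theta_bas sorted_list_of_set_insert_less del: sorted_list_of_set_insert sorted_list_of_set_insert_remove)
qed (use assms in \<open>auto simp: theta_additive fmul_additive I_0 I_diff\<close>)

lemma val_supp: "a \<in> A \<Longrightarrow> val a \<in> supp_in {S. S \<subseteq> J \<and> dgs S = wt a}"
proof -
  assume a: "a \<in> A"
  have "of_int (\<kappa> a j) * gen j \<in> supp_in {S. S \<subseteq> J \<and> dgs S = wt a}" if "j \<in> J" for j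
    using wt[OF a that] that by (cases "\<kappa> a j = 0") (auto simp: gen_def dgs_def intro!: supp_in_of_int supp_in_bas)
  then show ?thesis unfolding val_def by (intro supp_in_sum)
qed

lemma dgs_Un: "S \<subseteq> J \<Longrightarrow> T \<subseteq> J \<Longrightarrow> S \<inter> T = {} \<Longrightarrow> dgs (S \<union> T) = dgs S + dgs T"
  unfolding dgs_def using finite_J by (intro sum.union_disjoint) (auto dest: finite_subset)

lemma word_supp: "w \<in> lists A \<Longrightarrow> prod_list (map val w) \<in> supp_in {S. S \<subseteq> J \<and> dgs S = sum_list (map wt w)}"
proof (induction w)
  case Nil
  then show ?case using supp_in_bas[of "{}"] by (simp add: dgs_def bas_empty)
next
  case (Cons a w)
  then show ?case by (auto intro!: supp_in_mult[OF val_supp[of a]] simp: dgs_Un)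
qed

lemma ev_supp: "Poly_Mapping.keys c \<subseteq> lists A \<Longrightarrow> ev c \<in> supp_in (Pow J)"
  unfolding ev_def by (intro supp_in_lin supp_in_mono[OF _ word_supp]) auto

lemma word_reduce: "w \<in> lists A \<Longrightarrow> frag_of w - \<theta> (ev (frag_of w)) \<in> I"
proof (induction w)
  case Nil
  then show ?case using theta_bas[of "{}"] I_0 by (simp add: ev_def bas_empty)
next
  case (Cons a w)
  then have a: "a \<in> A" and w: "w \<in> lists A" by auto
  let ?v = "ev (frag_of w)"
  have v: "?v \<in> supp_in (Pow J)" using w by (intro ev_supp) auto
  let ?t = "\<theta> ?v"
  let ?e = "\<Sum>j\<in>J. frag_cmul (\<kappa> a j) (frag_of [y j])"
  have 1: "fmul (frag_of [a]) (frag_of w - ?t) \<in> I"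
    using Cons a by (intro I_mult(2)) auto
  have 2: "fmul (frag_of [a] - ?e) ?t \<in> I"
    using theta_closed[OF v] by (intro I_mult(1) expand a)
  have "(\<Sum>j\<in>J. frag_cmul (\<kappa> a j) (\<theta> (gen j * ?v) - fmul (frag_of [y j]) ?t)) \<in> I"
    by (intro I_sum I_cmul theta_gen_mult v)
  also have "(\<Sum>j\<in>J. frag_cmul (\<kappa> a j) (\<theta> (gen j * ?v) - fmul (frag_of [y j]) ?t)) = \<theta> (val a * ?v) - fmul ?e ?t"
  proof -
    have "\<theta> (val a * ?v) = (\<Sum>j\<in>J. frag_cmul (\<kappa> a j) (\<theta> (gen j * ?v)))"
      by (simp add: val_def sum_distrib_right mult.assoc theta_sum theta_additive)
    moreover have "fmul ?e ?t = (\<Sum>j\<in>J. frag_cmul (\<kappa> a j) (fmul (frag_of [y j]) ?t))"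
      by (simp add: frag_extend_sum[OF finite_J] frag_extend_cmul o_def)
    ultimately show ?thesis by (simp only: frag_cmul_diff2 sum_subtractf)
  qed
  finally have 3: "\<theta> (val a * ?v) - fmul ?e ?t \<in> I" .
  \<comment> \<open>The error telescopes: bring the tail into normal form, expand the first letter
    in the letters \<open>y j\<close>, and sort each of these into the normal form of the
    tail.\<close>
  have "frag_of (a # w) - \<theta> (ev (frag_of (a # w))) = fmul (frag_of [a]) (frag_of w - ?t) + fmul (frag_of [a] - ?e) ?t
     - (\<theta> (val a * ?v) - fmul ?e ?t)"
    by (simp only: fmul_additive) (simp add: ev_def)
  also have "\<dots> \<in> I" by (intro I_add I_diff 1 2 3)
  finally show ?case .
qed

lemma reduce: "Poly_Mapping.keys c \<subseteq> lists A \<Longrightarrow> c - \<theta> (ev c) \<in> I"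
proof (induction c rule: frag_induction)
  case (diff a b)
  then show ?case using I_diff[OF diff] by (simp add: ev_additive theta_additive algebra_simps)
qed (auto simp: word_reduce I_0 ev_additive theta_additive)

text \<open>The chains on which \<open>ev\<close> vanishes form an ideal that contains the
  relations, hence also the ideal which these generate.\<close>

lemma ev_I: "c \<in> I \<Longrightarrow> ev c = 0"
proof -
  let ?K = "{c. Poly_Mapping.keys c \<subseteq> lists A \<and> ev c = 0}"
  have neg: "\<ominus>\<^bsub>free_ring A\<^esub> c = - c" if "Poly_Mapping.keys c \<subseteq> lists A" for c
    using that by (intro R.minus_equality) auto
  have "ideal ?K (free_ring A)"
  proof (intro idealI ring_free_ring R.add.subgroupI)
    fix a assume "a \<in> ?K"
    then show "\<ominus>\<^bsub>free_ring A\<^esub> a \<in> ?K"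
      using neg[of a] by (simp add: ev_additive)
  qed (auto simp: ev_additive ev_mult keys_fmul keys_add_subset intro!: exI[of _ 0])
  moreover have "rels \<subseteq> ?K" using rels_closed ev_rels by auto
  ultimately have "I \<subseteq> ?K" unfolding I_def by (rule R.genideal_minimal)
  then show "c \<in> I \<Longrightarrow> ev c = 0" by auto
qed

lemma mem_coset: "x \<in> I +>\<^bsub>free_ring A\<^esub> c \<longleftrightarrow> x - c \<in> I"
  by (force simp: a_r_coset_def' intro: bexI[of _ "x - c"])

text \<open>If the values agree, so do the normal forms, and each chain is congruent to its normal
  form.\<close>

lemma coset_eq: "Poly_Mapping.keys c \<subseteq> lists A \<Longrightarrow> Poly_Mapping.keys d \<subseteq> lists A \<Longrightarrow>
   I +>\<^bsub>free_ring A\<^esub> c = I +>\<^bsub>free_ring A\<^esub> d \<longleftrightarrow> ev c = ev d"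
proof
  assume "I +>\<^bsub>free_ring A\<^esub> c = I +>\<^bsub>free_ring A\<^esub> d"
  then have "c - d \<in> I" using I_0 by (metis mem_coset diff_self)
  then show "ev c = ev d" using ev_I[of "c - d"] by (simp add: ev_additive)
next
  assume k: "Poly_Mapping.keys c \<subseteq> lists A" "Poly_Mapping.keys d \<subseteq> lists A" and e: "ev c = ev d"
  have cd: "c - d \<in> I" using I_diff[OF reduce[OF k(1)] reduce[OF k(2)]] e by simp
  show "I +>\<^bsub>free_ring A\<^esub> c = I +>\<^bsub>free_ring A\<^esub> d"
  proof (rule Set.set_eqI)
    fix x
    show "x \<in> I +>\<^bsub>free_ring A\<^esub> c \<longleftrightarrow> x \<in> I +>\<^bsub>free_ring A\<^esub> d"
      unfolding mem_coset using I_add[OF _ cd, of "x - c"] I_diff[OF _ cd, of "x - d"] by auto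
  qed
qed

lemma psi_coset: "psi (I +>\<^bsub>free_ring A\<^esub> c) = ev c"
proof -
  have "c \<in> I +>\<^bsub>free_ring A\<^esub> c" by (simp add: mem_coset I_0)
  then have "(SOME d. d \<in> I +>\<^bsub>free_ring A\<^esub> c) \<in> I +>\<^bsub>free_ring A\<^esub> c" by (rule someI)
  then show ?thesis using ev_I[of "(SOME d. d \<in> I +>\<^bsub>free_ring A\<^esub> c) - c"] unfolding psi_def mem_coset by (simp add: ev_additive)
qed

lemma ev_theta: "v \<in> supp_in (Pow J) \<Longrightarrow> ev (\<theta> v) = v"
proof (induction v rule: ext_supp_induct)
  case (bas S)
  then have "map val (map y (sorted_list_of_set S)) = map gen (sorted_list_of_set S)"
    by (auto simp: val_y)
  then show ?case using bas by (simp add: theta_bas ev_def bas_prod_list[symmetric] del: map_map)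
qed (auto simp: theta_additive ev_additive)

section \<open>The presented ring in coordinates\<close>

abbreviation "P \<equiv> presented_ring A rels wt"

lemma P_simps: "carrier P = {I +>\<^bsub>free_ring A\<^esub> c | c. Poly_Mapping.keys c \<subseteq> lists A}"
   "\<zero>\<^bsub>P\<^esub> = I +>\<^bsub>free_ring A\<^esub> 0" "\<one>\<^bsub>P\<^esub> = I +>\<^bsub>free_ring A\<^esub> frag_of []"
   "hpart P d = {I +>\<^bsub>free_ring A\<^esub> c | c. Poly_Mapping.keys c \<subseteq> lists A \<and> (\<forall>w \<in> Poly_Mapping.keys c. sum_list (map wt w) = d)}"
  using I_0 by (auto simp: presented_ring_def Let_def FactRing_def A_RCOSETS_def' I_def[symmetric] a_r_coset_def')

lemma P_ops: 
  assumes "Poly_Mapping.keys c \<subseteq> lists A" "Poly_Mapping.keys d \<subseteq> lists A"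
  shows "(I +>\<^bsub>free_ring A\<^esub> c) \<oplus>\<^bsub>P\<^esub> (I +>\<^bsub>free_ring A\<^esub> d) = I +>\<^bsub>free_ring A\<^esub> (c + d)"
    "(I +>\<^bsub>free_ring A\<^esub> c) \<otimes>\<^bsub>P\<^esub> (I +>\<^bsub>free_ring A\<^esub> d) = I +>\<^bsub>free_ring A\<^esub> (fmul c d)"
  using ring_hom_add[OF ideal.rcos_ring_hom[OF ideal_I], of c d] ring_hom_mult[OF ideal.rcos_ring_hom[OF ideal_I], of c d] assms
  by (simp_all add: presented_ring_def Let_def I_def[symmetric])

lemma word_class: "word_class A rels w = I +>\<^bsub>free_ring A\<^esub> frag_of w"
  by (simp add: word_class_def I_def)

lemma word_class_closed: "w \<in> lists A \<Longrightarrow> word_class A rels w \<in> carrier P"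
  by (auto simp: word_class P_simps intro!: exI[of _ "frag_of w"])

lemma psi_word: "psi (word_class A rels w) = prod_list (map val w)"
  by (simp add: word_class psi_coset ev_def)

lemma carrier_elem: "X \<in> carrier P \<Longrightarrow> X \<noteq> {}"
   "X \<in> carrier P \<Longrightarrow> c \<in> X \<Longrightarrow> Poly_Mapping.keys c \<subseteq> lists A \<and> ev c = psi X"
proof -
  assume "X \<in> carrier P"
  then obtain d where d: "X = I +>\<^bsub>free_ring A\<^esub> d" "Poly_Mapping.keys d \<subseteq> lists A" by (auto simp: P_simps)
  then show "X \<noteq> {}" using I_0 mem_coset[of d d] by auto
  assume "c \<in> X"
  then have c: "c - d \<in> I" using d mem_coset by auto
  have "Poly_Mapping.keys c \<subseteq> lists A" using keys_add[of "c - d" d] I_closed[OF c] d(2) by auto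
  moreover have "ev c = ev d" using ev_I[OF c] by (simp add: ev_additive)
  ultimately show "Poly_Mapping.keys c \<subseteq> lists A \<and> ev c = psi X" using d psi_coset by auto
qed

lemma ring_model: "ext_ring_model P psi J dgs"
proof
  show "bij_betw psi (carrier P) (supp_in (Pow J))"
  proof (rule bij_betw_imageI)
    show "inj_on psi (carrier P)"
    proof (rule inj_onI)
      fix X Y assume "X \<in> carrier P" "Y \<in> carrier P" "psi X = psi Y"
      then obtain c d where "X = I +>\<^bsub>free_ring A\<^esub> c" "Y = I +>\<^bsub>free_ring A\<^esub> d" "Poly_Mapping.keys c \<subseteq> lists A"
        "Poly_Mapping.keys d \<subseteq> lists A" "ev c = ev d"
        by (auto simp: P_simps psi_coset)
      then show "X = Y" using coset_eq[of c d] by simp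
    qed
    show "psi ` carrier P = supp_in (Pow J)"
    proof (intro subset_antisym subsetI)
      fix v assume v: "v \<in> supp_in (Pow J)"
      then show "v \<in> psi ` carrier P"
        using theta_closed ev_theta by (intro image_eqI[where x = "I +>\<^bsub>free_ring A\<^esub> \<theta> v"]) (auto simp: P_simps psi_coset)
    qed (auto simp: P_simps psi_coset ev_supp)
  qed
  fix d
  show "psi ` hpart P d = supp_in {S \<in> Pow J. dgs S = d}"
  proof (intro subset_antisym subsetI)
    fix v assume v: "v \<in> supp_in {S \<in> Pow J. dgs S = d}"
    have vJ: "v \<in> supp_in (Pow J)" by (rule supp_in_mono[OF _ v]) auto
    \<comment> \<open>Each word of the normal form of v comes from a monomial of v, all of which
      have degree d. A normal form thus satisfies the wordwise condition that defines the
      component.\<close>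
    have "sum_list (map wt w) = d" if w: "w \<in> Poly_Mapping.keys (\<theta> v)" for w
    proof -
      obtain S where S: "S \<in> Poly_Mapping.keys (coefs v)" "w = map y (sorted_list_of_set S)"
        using w keys_frag_extend[of "\<lambda>S. frag_of (map y (sorted_list_of_set S))" "coefs v"]
        unfolding \<theta>_def by auto
      then have S': "finite S" "S \<subseteq> J" "dgs S = d" using v finite_keys_coefs by (auto simp: supp_in_def)
      then have "map wt w = map dg1 (sorted_list_of_set S)"
        unfolding S(2) using wt[OF y_closed] kappa_y by auto
      then show ?thesis using S' by (simp add: dgs_def sum_list_distinct_conv_sum_set)
    qed
    then show "v \<in> psi ` hpart P d"
      using theta_closed[OF vJ] ev_theta[OF vJ]
      by (intro image_eqI[where x = "I +>\<^bsub>free_ring A\<^esub> \<theta> v"]) (auto simp: P_simps psi_coset)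
  next
    fix v assume "v \<in> psi ` hpart P d"
    then obtain c where c: "v = ev c" "Poly_Mapping.keys c \<subseteq> lists A" "\<forall>w \<in> Poly_Mapping.keys c. sum_list (map wt w) = d"
      by (auto simp: P_simps psi_coset)
    show "v \<in> supp_in {S \<in> Pow J. dgs S = d}"
      unfolding c(1) ev_def using c by (intro supp_in_lin supp_in_mono[OF _ word_supp]) auto
  qed
  show "hpart P d \<subseteq> carrier P" by (auto simp: P_simps)
next
  fix X Y assume "X \<in> carrier P" "Y \<in> carrier P"
  then obtain c d where cd: "X = I +>\<^bsub>free_ring A\<^esub> c" "Y = I +>\<^bsub>free_ring A\<^esub> d"
     "Poly_Mapping.keys c \<subseteq> lists A" "Poly_Mapping.keys d \<subseteq> lists A" by (auto simp: P_simps)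
  then have XY: "X \<oplus>\<^bsub>P\<^esub> Y = I +>\<^bsub>free_ring A\<^esub> (c + d)" "X \<otimes>\<^bsub>P\<^esub> Y = I +>\<^bsub>free_ring A\<^esub> (fmul c d)"
    by (simp_all add: P_ops)
  show "X \<oplus>\<^bsub>P\<^esub> Y \<in> carrier P" "X \<otimes>\<^bsub>P\<^esub> Y \<in> carrier P"
    unfolding XY P_simps using keys_add_subset[OF cd(3,4)] keys_fmul[OF cd(3,4)] by blast+
  show "psi (X \<oplus>\<^bsub>P\<^esub> Y) = psi X + psi Y" "psi (X \<otimes>\<^bsub>P\<^esub> Y) = psi X * psi Y"
    by (simp_all only: XY psi_coset ev_additive ev_mult) (simp_all add: cd(1,2) psi_coset)
next
  show "\<zero>\<^bsub>P\<^esub> \<in> carrier P" unfolding P_simps by (intro CollectI exI[of _ 0]) simp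
  show "\<one>\<^bsub>P\<^esub> \<in> carrier P" unfolding P_simps by (intro CollectI exI[of _ "frag_of []"]) simp
qed (use finite_J in \<open>auto simp: dgs_def dgs_Un[unfolded dgs_def] P_simps psi_coset ev_additive ev_def\<close>)

end

lemma sum_anticommute:
  fixes f g :: "'i \<Rightarrow> 'r::ring_1"
  assumes "\<And>i j. f i * g j = - (g j * f i)"
  shows "sum f S * sum g T = - (sum g T * sum f S)"
proof -
  have "sum f S * sum g T = (\<Sum>i\<in>S. \<Sum>j\<in>T. - (g j * f i))"
    by (simp only: sum_product assms)
  also have "\<dots> = - (\<Sum>j\<in>T. \<Sum>i\<in>S. g j * f i)"
    by (subst sum.swap) (simp only: sum_negf)
  finally show ?thesis by (simp only: sum_product)
qed

lemma sum_square_zero: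
  fixes f :: "'i \<Rightarrow> 'r::ring_1"
  assumes "\<And>i j. f i * f j = - (f j * f i)" "\<And>i. f i * f i = 0"
  shows "sum f S * sum f S = 0"
proof (induction S rule: infinite_finite_induct)
  case (insert i S)
  have "sum f S * f i = - (f i * sum f S)"
    using sum_anticommute[of f f S "{i}", OF assms(1)] by simp
  with insert show ?case by (simp add: distrib_left distrib_right assms(2))
qed simp_all

lemma of_int_gen_anticomm: "(of_int a * gen i) * (of_int b * gen j) = - ((of_int b * gen j) * (of_int a * gen i))"
proof -
  have *: "(of_int a * gen i) * (of_int b * gen j) = of_int (a * b) * (gen i * gen j)" for a b i j
    by (simp add: mult.assoc mult_of_int_left[of "gen i"])
  show ?thesis by (simp only: * gen_anticomm[of i j] mult.commute[of b a]) simp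
qed

lemma of_int_gen_square: "(of_int a * gen i) * (of_int a * gen i) = 0"
  by (simp add: mult.assoc mult_of_int_left[of "gen _"])

section \<open>The algebra U\<close>

text \<open>The degree depends on the parity of the index only, even for E and odd for F. Passing to
  another tensor factor shifts the index by an even number and so preserves it.\<close>

definition dgT :: "nat \<Rightarrow> int \<times> bit" where "dgT j = (if even j then - 1 else 1, 1)"
definition U_kappa :: "gen \<Rightarrow> nat \<Rightarrow> int" where "U_kappa g j = (if j = case_gen 0 (Suc 0) g then 1 else 0)"
definition U_y :: "nat \<Rightarrow> gen" where "U_y j = (if j = 0 then GenE else GenF)"

interpretation Upres: presentation_data UNIV U_rels "case_gen (- 1, 1) (1, 1)" U_kappa "{0, Suc 0}" U_y dgT .

lemma U_val: "Upres.val = (\<lambda>g. gen (case_gen 0 (Suc 0) g))"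
  by (auto simp: fun_eq_iff Upres.val_def U_kappa_def split: gen.splits)

interpretation Upres: ext_presentation UNIV U_rels "case_gen (- 1, 1) (1, 1)" U_kappa "{0, Suc 0}" U_y dgT
proof
  have self: "U_rels \<subseteq> Upres.I"
    unfolding Upres.I_def by (rule ring.genideal_self[OF ring_free_ring]) auto
  have id: "ideal Upres.I (free_ring UNIV)"
    unfolding Upres.I_def by (rule ring.genideal_ideal[OF ring_free_ring]) auto
  have add: "c + d \<in> Upres.I" if "c \<in> Upres.I" "d \<in> Upres.I" for c d
    using additive_subgroup.a_closed[OF ideal.axioms(1)[OF id] that] by simp
  show sq: "frag_of [U_y i, U_y i] \<in> Upres.I" if "i \<in> {0, Suc 0}" for i
    using self that by (auto simp: U_y_def U_rels_def)
  \<comment> \<open>For \<open>i = j\<close> this element is twice a square.\<close>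
  show "frag_of [U_y i, U_y j] + frag_of [U_y j, U_y i] \<in> Upres.I" if "i \<in> {0, Suc 0}" "j \<in> {0, Suc 0}" for i j
    using self that sq[of i] add[of "frag_of [U_y i, U_y i]" "frag_of [U_y i, U_y i]"]
    by (auto simp: U_y_def U_rels_def add.commute)
  show "frag_of [a] - (\<Sum>j\<in>{0, Suc 0}. frag_cmul (U_kappa a j) (frag_of [U_y j])) \<in> Upres.I" for a
    using additive_subgroup.zero_closed[OF ideal.axioms(1)[OF id]]
    by (cases a) (auto simp: U_kappa_def U_y_def)
  show "Upres.ev r = 0" if "r \<in> U_rels" for r
    using that gen_anticomm[of 0 1] by (auto simp: U_rels_def Upres.ev_def U_val lin_add)
qed (auto simp: U_kappa_def U_y_def dgT_def split: gen.splits if_splits)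

definition psi_U :: "U \<Rightarrow> ext" where "psi_U = Upres.psi"
definition dgs :: "nat set \<Rightarrow> int \<times> bit" where "dgs S = (\<Sum>j\<in>S. dgT j)"

lemma U_dgs: "Upres.dgs = dgs" by (simp add: fun_eq_iff Upres.dgs_def dgs_def)

interpretation U: ext_ring_model U_ring psi_U "{0, Suc 0}" dgs
  using Upres.ring_model unfolding U_ring_def psi_U_def U_dgs .

lemma psi_U_word: "psi_U (word_class UNIV U_rels w) = prod_list (map (\<lambda>g. gen (case_gen 0 (Suc 0) g)) w)"
  by (simp add: psi_U_def Upres.psi_word U_val)

lemma U_gen_closed: "U_gen g \<in> carrier U_ring" and psi_U_gen: "psi_U (U_gen g) = gen (case_gen 0 (Suc 0) g)"
  unfolding U_gen_def U_ring_def by (auto simp: psi_U_word intro!: Upres.word_class_closed)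

lemma U_elem: "u \<in> carrier U_ring \<Longrightarrow> u \<noteq> {}"
  "u \<in> carrier U_ring \<Longrightarrow> c \<in> u \<Longrightarrow> lin (\<lambda>w. prod_list (map (\<lambda>g. gen (case_gen 0 (Suc 0) g)) w)) c = psi_U u"
  using Upres.carrier_elem[of u] unfolding U_ring_def[symmetric] psi_U_def
  by (auto simp: Upres.ev_def U_val)

section \<open>The exterior algebra of a free abelian group\<close>

text \<open>Freeness in the form that homology provides: coordinates dual to \<open>b\<close> give
  independence, and they will come from boundary coefficients and winding numbers, whereas
  generation will come from exactness and excision.\<close>

locale group_basis = comm_group H for H :: "'g monoid" (structure) +
  fixes k :: "'g \<Rightarrow> nat \<Rightarrow> int" and J :: "nat set" and b :: "nat \<Rightarrow> 'g"
  assumes finite_J: "finite J" and b_closed: "j \<in> J \<Longrightarrow> b j \<in> carrier H"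
    and k_mult: "x \<in> carrier H \<Longrightarrow> y \<in> carrier H \<Longrightarrow> k (x \<otimes> y) j = k x j + k y j"
    and k_b: "i \<in> J \<Longrightarrow> j \<in> J \<Longrightarrow> k (b i) j = (if i = j then 1 else 0)"
    and generate_b: "generate H (b ` J) = carrier H"
begin

lemma k_one: "k \<one> j = 0"
  using k_mult[of \<one> \<one> j] by simp

lemma k_inv: "x \<in> carrier H \<Longrightarrow> k (inv x) j = - k x j"
  using k_mult[of "inv x" x j] by (simp add: k_one)

sublocale E: presentation_data "carrier H" "exterior_rels H" "\<lambda>_. (1, 1)" k J b "\<lambda>_. (1, 1)" .

sublocale E: ext_presentation "carrier H" "exterior_rels H" "\<lambda>_. (1, 1)" k J b "\<lambda>_. (1, 1)"
proof
  show rc: "exterior_rels H \<subseteq> carrier (free_ring (carrier H))"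
  proof (rule subsetI)
    fix r assume "r \<in> exterior_rels H"
    then show "r \<in> carrier (free_ring (carrier H))"
      unfolding exterior_rels_def by (auto dest!: subsetD[OF keys_diff] split: if_splits)
  qed
  have self: "exterior_rels H \<subseteq> E.I"
    unfolding E.I_def by (rule ring.genideal_self[OF ring_free_ring rc])
  have id: "ideal E.I (free_ring (carrier H))"
    unfolding E.I_def by (rule ring.genideal_ideal[OF ring_free_ring rc])
  have add: "c + d \<in> E.I" if "c \<in> E.I" "d \<in> E.I" for c d
    using additive_subgroup.a_closed[OF ideal.axioms(1)[OF id] that] by simp
  have zero: "0 \<in> E.I"
    using additive_subgroup.zero_closed[OF ideal.axioms(1)[OF id]] by simp
  have mult: "fmul c d \<in> E.I" "fmul d c \<in> E.I" if "c \<in> E.I" "Poly_Mapping.keys d \<subseteq> lists (carrier H)" for c d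
    using ideal.I_l_closed[OF id that(1), of d] ideal.I_r_closed[OF id that(1), of d] that(2) by auto
  have minus: "- c \<in> E.I" if "c \<in> E.I" for c
    using mult(2)[OF that, of "- frag_of []"] by (simp add: fmul_additive flip: frag_expansion)
  have diff: "c - d \<in> E.I" if "c \<in> E.I" "d \<in> E.I" for c d
    using add[OF that(1) minus[OF that(2)]] by simp
  have rel: "frag_of [x \<otimes> y] - frag_of [x] - frag_of [y] \<in> E.I" if "x \<in> carrier H" "y \<in> carrier H" for x y
    using self that by (auto simp: exterior_rels_def)
  have sqr: "frag_of [x, x] \<in> E.I" if "x \<in> carrier H" for x
    using self that by (auto simp: exterior_rels_def)
  show "frag_of [b i, b i] \<in> E.I" if "i \<in> J" for i
    using sqr b_closed that by auto
  show "frag_of [b i, b j] + frag_of [b j, b i] \<in> E.I" if "i \<in> J" "j \<in> J" for i j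
  proof -
    let ?x = "frag_of [b i]" and ?y = "frag_of [b j]" and ?z = "frag_of [b i \<otimes> b j]"
    let ?r = "?z - ?x - ?y"
    have r: "?r \<in> E.I" using rel b_closed that by auto
    have sqs: "fmul ?z ?z \<in> E.I" "fmul ?x ?x \<in> E.I" "fmul ?y ?y \<in> E.I"
      using sqr[of "b i \<otimes> b j"] sqr[of "b i"] sqr[of "b j"] b_closed that by auto
    have ks: "Poly_Mapping.keys ?z \<subseteq> lists (carrier H)" "Poly_Mapping.keys (?x + ?y) \<subseteq> lists (carrier H)"
      using b_closed that by (auto dest!: subsetD[OF keys_add])
    \<comment> \<open>Polarisation: as \<open>?z = ?r + ?x + ?y\<close>, removing the multiples of
      \<open>?r\<close> and the squares of \<open>?x\<close> and \<open>?y\<close> from the square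
      of \<open>?z\<close> leaves the two mixed products.\<close>
    note diff[OF diff[OF diff[OF diff[OF sqs(1) mult(1)[OF r ks(1)]] mult(2)[OF r ks(2)]] sqs(2)] sqs(3)]
    also have "fmul ?z ?z - fmul ?r ?z - fmul (?x + ?y) ?r - fmul ?x ?x - fmul ?y ?y = fmul ?x ?y + fmul ?y ?x"
      by (simp only: fmul_additive) (simp add: algebra_simps)
    finally show ?thesis by simp
  qed
  let ?S = "\<lambda>a. \<Sum>j\<in>J. frag_cmul (k a j) (frag_of [b j])"
  have expand: "frag_of [a] - ?S a \<in> E.I" if "a \<in> generate H (b ` J)" for a
    using that
  proof (induction a rule: generate.induct)
    case one
    \<comment> \<open>The additivity relation for \<open>\<one> \<otimes> \<one>\<close> is the
      negative of the word \<open>[\<one>]\<close>, and all coordinates of the neutral element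
      vanish.\<close>
    show ?case using minus[OF rel[of \<one> \<one>]] by (simp add: k_one)
  next
    case (incl h)
    then obtain i where i: "h = b i" "i \<in> J" by auto
    then have "?S h = (\<Sum>j\<in>J. if i = j then frag_of [b j] else 0)"
      by (intro sum.cong) (auto simp: k_b)
    then show ?case using i finite_J zero by simp
  next
    case (inv h)
    then obtain i where i: "h = b i" "i \<in> J" by auto
    then have h: "h \<in> carrier H" using b_closed by auto
    have "?S (inv h) = - (\<Sum>j\<in>J. if i = j then frag_of [b j] else 0)"
      unfolding sum_negf[symmetric] using i h by (intro sum.cong) (auto simp: k_b k_inv)
    then have S: "?S (inv h) = - frag_of [h]" using i finite_J by simp
    have "- frag_of [\<one>] \<in> E.I" using rel[of \<one> \<one>] by simp
    \<comment> \<open>The word \<open>[\<one>]\<close> minus the additivity relation for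
      \<open>inv h \<otimes> h\<close> is \<open>[inv h] + [h]\<close>.\<close>
    from diff[OF minus[OF this] rel[of "inv h" h]] h
    show ?case unfolding S by (simp add: algebra_simps)
  next
    case (eng h1 h2)
    then have h: "h1 \<in> carrier H" "h2 \<in> carrier H" unfolding generate_b by auto
    have "?S (h1 \<otimes> h2) = ?S h1 + ?S h2"
      using h by (simp add: k_mult frag_cmul_distrib sum.distrib)
    then have eq: "frag_of [h1 \<otimes> h2] - ?S (h1 \<otimes> h2) =
       (frag_of [h1 \<otimes> h2] - frag_of [h1] - frag_of [h2]) + (frag_of [h1] - ?S h1) + (frag_of [h2] - ?S h2)"
      by simp
    show ?case unfolding eq by (rule add[OF add[OF rel[OF h] eng(3)] eng(4)])
  qed
  show "frag_of [a] - ?S a \<in> E.I" if "a \<in> carrier H" for a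
    using expand that generate_b by simp
  show "E.ev r = 0" if r: "r \<in> exterior_rels H" for r
  proof -
    have "E.val (x \<otimes> y) = E.val x + E.val y" if "x \<in> carrier H" "y \<in> carrier H" for x y
      using that by (simp add: E.val_def k_mult distrib_right sum.distrib)
    moreover have "E.val x * E.val x = 0" for x
      unfolding E.val_def by (intro sum_square_zero of_int_gen_anticomm of_int_gen_square)
    ultimately show ?thesis using r by (auto simp: exterior_rels_def E.ev_def lin_diff)
  qed
qed (use finite_J b_closed k_b in auto)

sublocale X: ext_ring_model "exterior H" E.psi J E.dgs
  using E.ring_model unfolding exterior_def .

lemma val_b: "j \<in> J \<Longrightarrow> E.val (b j) = gen j"
  by (rule E.val_y)

lemma psi_wedge: "E.psi (wedge H xs) = prod_list (map E.val xs)"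
  by (simp add: wedge_def E.psi_word)

lemma wedge_closed: "set xs \<subseteq> carrier H \<Longrightarrow> wedge H xs \<in> carrier (exterior H)"
  unfolding wedge_def exterior_def by (intro E.word_class_closed) auto

lemma exterior_elem: "X \<in> carrier (exterior H) \<Longrightarrow> X \<noteq> {}"
  "X \<in> carrier (exterior H) \<Longrightarrow> c \<in> X \<Longrightarrow> Poly_Mapping.keys c \<subseteq> lists (carrier H) \<and> lin (\<lambda>w. prod_list (map E.val w)) c = E.psi X"
  using E.carrier_elem[of X] unfolding exterior_def[symmetric] by (auto simp: E.ev_def)

end

section \<open>The tensor power of U\<close>

text \<open>
  The index \<open>j \<in> {0, 1}\<close> stands for \<open>E\<close>, respectively \<open>F\<close>, in \<open>U\<close>, and \<open>2 * i + j\<close> for the same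
  element in the \<open>i\<close>-th tensor factor. The factors are numbered from \<open>1\<close>, so the indices in use
  form the set \<open>JT\<close> below.
\<close>

definition shift :: "nat \<Rightarrow> ext \<Rightarrow> ext" where "shift k = extmap (\<lambda>j. gen (2 * k + j))"

lemma shift_additive: "shift k (v + w) = shift k v + shift k w" "shift k (v - w) = shift k v - shift k w" "shift k 0 = 0"
  by (simp_all add: shift_def extmap_additive)

lemma shift_mult: "shift k (v * w) = shift k v * shift k w"
  unfolding shift_def by (rule extmap_mult[OF gen_anticomm gen_square])

lemma shift_1 [simp]: "shift k 1 = 1" and shift_gen [simp]: "shift k (gen j) = gen (2 * k + j)"
  by (simp_all add: shift_def)

lemma shift_bas: "finite S \<Longrightarrow> shift k (bas S) = bas ((+) (2 * k) ` S)"
proof (induction S rule: finite_linorder_min_induct)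
  case empty
  then show ?case by (simp add: bas_empty)
next
  case (insert m S)
  then show ?case by (simp add: bas_insert_less shift_mult)
qed

lemma dgs_shift: "dgs ((+) (2 * k) ` S) = dgs S"
  unfolding dgs_def by (subst sum.reindex) (auto simp: dgT_def o_def)

lemma dgs_Un: "finite S \<Longrightarrow> finite T \<Longrightarrow> S \<inter> T = {} \<Longrightarrow> dgs (S \<union> T) = dgs S + dgs T"
  unfolding dgs_def by (rule sum.union_disjoint)

lemma dgs_empty [simp]: "dgs {} = 0" by (simp add: dgs_def)

lemma snd_dgs: "finite S \<Longrightarrow> snd (dgs S) = of_nat (card S)"
  by (induction S rule: finite_induct) (auto simp: dgs_def dgT_def)

lemma shift_supp: "v \<in> supp_in {S \<in> Pow {0, Suc 0}. dgs S = d} \<Longrightarrow> shift k v \<in> supp_in {S. S \<subseteq> {2 * k..<2 * Suc k} \<and> dgs S = d}"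
proof (induction v rule: ext_supp_induct)
  case (bas S)
  then show ?case by (auto simp: shift_bas dgs_shift intro!: supp_in_bas)
qed (auto simp: shift_additive supp_in_diff)

lemma bas_mult_less:
  assumes "\<And>i j. i \<in> S \<Longrightarrow> j \<in> T \<Longrightarrow> i < j"
  shows "bas S * bas T = bas (S \<union> T)"
proof -
  have "{(i, j). i \<in> S \<and> j \<in> T \<and> j < i} = {}" using assms by (auto dest: less_asym)
  moreover have "S \<inter> T = {}" using assms by auto
  ultimately have "xsg S T = 1" by (simp only: xsg_def) simp
  then show ?thesis by (simp add: bas_mult)
qed

section \<open>Evaluation of tensors and the Koszul sign\<close>

primrec tau :: "nat \<Rightarrow> U list \<Rightarrow> ext" where
  "tau k [] = 1"
| "tau k (u # us) = shift k (psi_U u) * tau (Suc k) us"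

lemma tau_append: "tau k (us @ vs) = tau k us * tau (k + length us) vs"
  by (induction us arbitrary: k) (auto simp: mult.assoc)

lemma tau_supp: "list_all2 (\<lambda>u d. u \<in> hpart U_ring d) us ds \<Longrightarrow>
   tau k us \<in> supp_in {S. S \<subseteq> {2 * k..<2 * (k + length us)} \<and> dgs S = sum_list ds}"
proof (induction us ds arbitrary: k rule: list_all2_induct)
  case Nil
  then show ?case using supp_in_bas[of "{}"] by (simp add: bas_empty)
next
  case (Cons u us d ds)
  have "shift k (psi_U u) \<in> supp_in {S. S \<subseteq> {2 * k..<2 * Suc k} \<and> dgs S = d}"
    using Cons(1) by (intro shift_supp) (simp add: U.mem_hpart_iff)
  then show ?case unfolding tau.simps
    by (rule supp_in_mult[OF _ Cons.IH[of "Suc k"]]) (fastforce simp: dgs_Un)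
qed

definition oddU :: "U \<Rightarrow> bool" where "oddU u \<longleftrightarrow> (\<exists>d. u \<in> hpart U_ring (d, 1))"
definition homU :: "U set" where "homU = (\<Union>d. hpart U_ring d)"

lemma homU_I: "u \<in> hpart U_ring d \<Longrightarrow> u \<in> homU"
  unfolding homU_def by blast

lemma homU_closed: "homU \<subseteq> carrier U_ring"
  using U.hpart_closed by (auto simp: homU_def)

abbreviation par :: "U list \<Rightarrow> nat" where "par us \<equiv> length (filter oddU us)"

lemma bit_of_nat_iff: "(of_nat n = (0 :: bit)) = even n" "(of_nat n = (1 :: bit)) = odd n"
  by (induction n) auto

text \<open>The parity of u is read off from \<open>oddU\<close>, as in \<open>koszul_sign\<close>.
  The zero element is both even and odd and gets called odd, which is harmless because its support
  is empty.\<close>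

lemma shift_parity: "u \<in> homU \<Longrightarrow> shift k (psi_U u) \<in> supp_in {S. even (card S + par [u])}"
proof -
  assume "u \<in> homU"
  then obtain d b where db: "u \<in> hpart U_ring (d, b)" by (auto simp: homU_def)
  define b' where "b' = (if oddU u then (1 :: bit) else 0)"
  have "\<exists>d. u \<in> hpart U_ring (d, b')"
    using db by (cases b) (auto simp: oddU_def b'_def)
  then obtain d' where d': "u \<in> hpart U_ring (d', b')" by blast
  have "shift k (psi_U u) \<in> supp_in {S. S \<subseteq> {2 * k..<2 * Suc k} \<and> dgs S = (d', b')}"
    using d' by (intro shift_supp) (simp add: U.mem_hpart_iff)
  then show ?thesis
  proof (rule supp_in_mono[rotated], intro subsetI)
    fix S assume "S \<in> {S. S \<subseteq> {2 * k..<2 * Suc k} \<and> dgs S = (d', b')}"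
    then have "finite S" "snd (dgs S) = b'" by (auto dest: finite_subset)
    then show "S \<in> {S. even (card S + par [u])}"
      by (auto simp: snd_dgs b'_def bit_of_nat_iff split: if_splits)
  qed
qed

lemma tau_parity: "set us \<subseteq> homU \<Longrightarrow> tau k us \<in> supp_in {S. even (card S + par us)}"
proof (induction us arbitrary: k)
  case Nil
  then show ?case using supp_in_bas[of "{}"] by (simp add: bas_empty)
next
  case (Cons u us)
  then show ?case unfolding tau.simps
    by (intro supp_in_mult[OF shift_parity[of u] Cons.IH]) (auto simp: card_Un_disjoint)
qed

lemma ext_commute:
  assumes "v \<in> supp_in {S. even (card S + a)}" "w \<in> supp_in {S. even (card S + b)}"
  shows "v * w = (- 1) ^ (a * b) * (w * v)"
  using assms(1)
proof (induction v rule: ext_supp_induct)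
  case (bas S)
  show ?case using assms(2)
  proof (induction w rule: ext_supp_induct)
    case (bas T)
    have "even (card S * card T + a * b)"
      using \<open>S \<in> _\<close> \<open>T \<in> _\<close> by auto
    then have "(- 1 :: ext) ^ (card S * card T) = (- 1) ^ (a * b)"
      by (metis even_add neg_one_even_power neg_one_odd_power)
    then show ?case using bas_commute[of S T] bas \<open>finite S\<close> by simp
  qed (auto simp: algebra_simps)
qed (auto simp: algebra_simps)

lemma koszul_sign_Nil: "koszul_sign U_ring [] ys = 1"
  by (simp add: koszul_sign_def)

text \<open>The head y of the right tensor passes the whole tail \<open>xs\<close>, which gives the
  pairs with \<open>j = 0\<close>; the head x passes nothing. The remaining pairs are the shifted
  pairs of the tails.\<close>

lemma koszul_sign_Cons:
  assumes "length xs = length ys"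
  shows "koszul_sign U_ring (x # xs) (y # ys) = (- 1) ^ (par xs * par [y]) * koszul_sign U_ring xs ys"
proof -
  let ?A = "{(i, j). i < length xs \<and> j < i \<and> oddU (xs ! i) \<and> oddU (ys ! j)}"
  let ?B = "{i. i < length xs \<and> oddU (xs ! i)}"
  have fin: "finite ?A" by (rule finite_subset[of _ "{..<length xs} \<times> {..<length xs}"]) auto
  have "{(i, j). i < length (x # xs) \<and> j < i \<and> oddU ((x # xs) ! i) \<and> oddU ((y # ys) ! j)} =
     map_prod Suc Suc ` ?A \<union> (if oddU y then (\<lambda>i. (Suc i, 0)) ` ?B else {})" (is "?L = ?M \<union> ?R")
  proof (intro subset_antisym subsetI)
    fix t assume "t \<in> ?L"
    then obtain i j where t: "t = (i, j)" "i < Suc (length xs)" "j < i" "oddU ((x # xs) ! i)" "oddU ((y # ys) ! j)" by auto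
    then obtain i' where i': "i = Suc i'" by (cases i) auto
    show "t \<in> ?M \<union> ?R"
    proof (cases j)
      case 0
      then show ?thesis using t i' by auto
    next
      case (Suc j')
      then have "(i', j') \<in> ?A" using t i' by auto
      then have "map_prod Suc Suc (i', j') \<in> ?M" by (rule imageI)
      then show ?thesis using t i' Suc by simp
    qed
  qed (auto split: if_splits)
  moreover have "card (?M \<union> ?R) = card ?M + card ?R"
    using fin by (intro card_Un_disjoint) auto
  moreover have "card ?M = card ?A" by (intro card_image inj_onI) auto
  moreover have "card ?R = par xs * par [y]"
    by (auto simp: card_image inj_on_def length_filter_conv_card)
  ultimately have "card ?L = card ?A + par xs * par [y]" by simp
  then show ?thesis unfolding koszul_sign_def oddU_def[symmetric] by (simp add: power_add mult.commute)
qed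

text \<open>In \<open>ext\<close> the sign arises by itself when each entry of \<open>ys\<close> is
  moved left past the later entries of \<open>xs\<close>; the recursion of
  \<open>koszul_sign\<close> counts the same crossings.\<close>

lemma tau_mult:
  assumes "length xs = length ys" "set xs \<subseteq> homU" "set ys \<subseteq> homU"
  shows "of_int (koszul_sign U_ring xs ys) * tau k (map2 (monoid.mult U_ring) xs ys) = tau k xs * tau k ys"
  using assms
proof (induction xs ys arbitrary: k rule: list_induct2)
  case Nil
  then show ?case by (simp add: koszul_sign_Nil)
next
  case (Cons x xs y ys)
  then have xy: "x \<in> carrier U_ring" "y \<in> carrier U_ring" using homU_closed by auto
  let ?X = "shift k (psi_U x)" and ?Y = "shift k (psi_U y)"
  have c: "tau (Suc k) xs * ?Y = (- 1) ^ (par xs * par [y]) * (?Y * tau (Suc k) xs)"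
    using Cons by (intro ext_commute tau_parity shift_parity) auto
  have p: "of_int ((- 1) ^ n) = (- 1 :: ext) ^ n" for n by simp
  have "tau k (x # xs) * tau k (y # ys) = ?X * ((tau (Suc k) xs * ?Y) * tau (Suc k) ys)"
    by (simp add: mult.assoc)
  also have "\<dots> = of_int ((- 1) ^ (par xs * par [y])) * (?X * ?Y * (tau (Suc k) xs * tau (Suc k) ys))"
    unfolding c p[symmetric] by (simp only: mult.assoc mult_of_int_left)
  also have "tau (Suc k) xs * tau (Suc k) ys = of_int (koszul_sign U_ring xs ys) * tau (Suc k) (map2 (monoid.mult U_ring) xs ys)"
    using Cons by simp
  also have "?X * ?Y = shift k (psi_U (x \<otimes>\<^bsub>U_ring\<^esub> y))" using xy by (simp add: U.psi_mult shift_mult)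
  finally show ?case
    using Cons(1) by (simp add: koszul_sign_Cons mult.assoc mult_of_int_left[of "shift _ _"] del: of_int_power)
qed

context
  fixes p :: nat
begin

section \<open>Normal forms of tensors\<close>

definition JT :: "nat set" where "JT = {2..<2 * Suc p}"
definition GT :: "(U list \<Rightarrow>\<^sub>0 int) monoid" where "GT = free_Abelian_group (tensor_gens U_ring p)"
definition KT :: "(U list \<Rightarrow>\<^sub>0 int) set" where "KT = generate GT (tensor_rels U_ring p)"
definition tauhat :: "(U list \<Rightarrow>\<^sub>0 int) \<Rightarrow> ext" where "tauhat = lin (tau 1)"
definition ubas :: "nat set \<Rightarrow> U" where "ubas T = (SOME u. u \<in> carrier U_ring \<and> psi_U u = bas T)"
definition part :: "nat set \<Rightarrow> nat \<Rightarrow> nat set" where "part S i = {j \<in> {0, Suc 0}. 2 * i + j \<in> S}"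
definition tbas :: "nat set \<Rightarrow> U list" where "tbas S = map (\<lambda>i. ubas (part S i)) [1..<Suc p]"
definition \<theta>T :: "ext \<Rightarrow> (U list \<Rightarrow>\<^sub>0 int)" where "\<theta>T v = frag_extend (\<lambda>S. frag_of (tbas S)) (coefs v)"
definition psi_T :: "(U list \<Rightarrow>\<^sub>0 int) set \<Rightarrow> ext" where "psi_T X = tauhat (SOME c. c \<in> X)"

lemma tensor_gens_iff: "xs \<in> tensor_gens U_ring p \<longleftrightarrow> length xs = p \<and> set xs \<subseteq> homU"
  by (simp add: tensor_gens_def homU_def)

lemma tauhat_additive: "tauhat (c + d) = tauhat c + tauhat d" "tauhat (c - d) = tauhat c - tauhat d" "tauhat (- c) = - tauhat c" "tauhat 0 = 0"
  by (simp_all add: tauhat_def lin_add lin_diff lin_minus)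

lemma \<theta>T_additive: "\<theta>T (v + w) = \<theta>T v + \<theta>T w" "\<theta>T (v - w) = \<theta>T v - \<theta>T w" "\<theta>T 0 = 0"
  by (simp_all add: \<theta>T_def frag_extend_add frag_extend_diff)

lemma \<theta>T_bas: "finite S \<Longrightarrow> \<theta>T (bas S) = frag_of (tbas S)"
  by (simp add: \<theta>T_def coefs_bas)

interpretation GT: comm_group GT unfolding GT_def by (rule abelian_free_Abelian_group)

lemma GT_simps: "carrier GT = {c. Poly_Mapping.keys c \<subseteq> tensor_gens U_ring p}" "\<one>\<^bsub>GT\<^esub> = 0" "c \<otimes>\<^bsub>GT\<^esub> d = c + d"
  "Poly_Mapping.keys c \<subseteq> tensor_gens U_ring p \<Longrightarrow> inv\<^bsub>GT\<^esub> c = - c"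
  by (auto simp: GT_def)

lemma rel_tensor_gens:
  assumes "us @ x # vs \<in> tensor_gens U_ring p" "x \<in> hpart U_ring d" "y \<in> hpart U_ring d"
  shows "us @ y # vs \<in> tensor_gens U_ring p" "us @ (x \<oplus>\<^bsub>U_ring\<^esub> y) # vs \<in> tensor_gens U_ring p"
proof -
  have "x \<oplus>\<^bsub>U_ring\<^esub> y \<in> hpart U_ring d"
    using assms by (auto simp: U.mem_hpart_iff U.add_mem U.psi_add supp_in_add)
  then show "us @ y # vs \<in> tensor_gens U_ring p" "us @ (x \<oplus>\<^bsub>U_ring\<^esub> y) # vs \<in> tensor_gens U_ring p"
    using assms homU_I[of _ d] unfolding tensor_gens_iff by auto
qed

lemma rels_closed_T: "tensor_rels U_ring p \<subseteq> carrier GT"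
proof
  fix c assume "c \<in> tensor_rels U_ring p"
  then obtain us vs x y d where c: "c = frag_of (us @ (x \<oplus>\<^bsub>U_ring\<^esub> y) # vs) - frag_of (us @ x # vs) - frag_of (us @ y # vs)"
    "us @ x # vs \<in> tensor_gens U_ring p" "x \<in> hpart U_ring d" "y \<in> hpart U_ring d"
    unfolding tensor_rels_def by blast
  then show "c \<in> carrier GT"
    using rel_tensor_gens[OF c(2-4)] by (auto simp: GT_simps dest!: subsetD[OF keys_diff] split: if_splits)
qed

lemma KT_subgroup: "subgroup KT GT"
  unfolding KT_def by (rule GT.generate_is_subgroup[OF rels_closed_T])

lemma KT_closed: "c \<in> KT \<Longrightarrow> Poly_Mapping.keys c \<subseteq> tensor_gens U_ring p"
  using subgroup.subset[OF KT_subgroup] by (auto simp: GT_simps)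

lemma KT_0: "0 \<in> KT" and KT_add: "c \<in> KT \<Longrightarrow> d \<in> KT \<Longrightarrow> c + d \<in> KT" and KT_minus: "c \<in> KT \<Longrightarrow> - c \<in> KT"
  using subgroup.one_closed[OF KT_subgroup] subgroup.m_closed[OF KT_subgroup, of c d]
    subgroup.m_inv_closed[OF KT_subgroup, of c] KT_closed by (auto simp: GT_simps)

lemma KT_diff: "c \<in> KT \<Longrightarrow> d \<in> KT \<Longrightarrow> c - d \<in> KT"
  using KT_add[OF _ KT_minus, of c d] by simp

lemma KT_rel:
  assumes "us @ x # vs \<in> tensor_gens U_ring p" "x \<in> hpart U_ring d" "y \<in> hpart U_ring d"
  shows "frag_of (us @ (x \<oplus>\<^bsub>U_ring\<^esub> y) # vs) - frag_of (us @ x # vs) - frag_of (us @ y # vs) \<in> KT"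
  unfolding KT_def unfolding tensor_rels_def using assms by (intro generate.incl) blast

lemma tau_add:
  assumes "x \<in> carrier U_ring" "y \<in> carrier U_ring"
  shows "tau k (us @ (x \<oplus>\<^bsub>U_ring\<^esub> y) # vs) = tau k (us @ x # vs) + tau k (us @ y # vs)"
  using assms by (simp add: tau_append U.psi_add shift_additive algebra_simps)

lemma tauhat_KT: "c \<in> KT \<Longrightarrow> tauhat c = 0"
proof -
  have rel: "tauhat h = 0" if "h \<in> tensor_rels U_ring p" for h
  proof -
    obtain us vs x y d where h: "h = frag_of (us @ (x \<oplus>\<^bsub>U_ring\<^esub> y) # vs) - frag_of (us @ x # vs) - frag_of (us @ y # vs)"
      "x \<in> hpart U_ring d" "y \<in> hpart U_ring d"
      using \<open>h \<in> tensor_rels U_ring p\<close> unfolding tensor_rels_def by blast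
    have "x \<in> carrier U_ring" "y \<in> carrier U_ring" using h U.hpart_closed[of d] by auto
    then show ?thesis unfolding h(1) by (simp add: tauhat_def lin_diff tau_add del: tau.simps)
  qed
  show "c \<in> KT \<Longrightarrow> tauhat c = 0"
  unfolding KT_def
proof (induction c rule: generate.induct)
  case one
  then show ?case by (simp add: GT_simps tauhat_additive)
next
  case (incl h)
  then show ?case by (rule rel)
next
  case (inv h)
  then show ?case using rel[of h] rels_closed_T by (auto simp: GT_simps tauhat_additive)
next
  case (eng h1 h2)
  then show ?case by (simp add: GT_simps tauhat_additive)
qed
qed

lemma ubas: "T \<subseteq> {0, Suc 0} \<Longrightarrow> ubas T \<in> carrier U_ring" "T \<subseteq> {0, Suc 0} \<Longrightarrow> psi_U (ubas T) = bas T"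
proof -
  assume "T \<subseteq> {0, Suc 0}"
  then have "\<exists>u. u \<in> carrier U_ring \<and> psi_U u = bas T"
    using U.psi_surj[of "bas T"] by (auto intro: supp_in_bas)
  from someI_ex[OF this] show "ubas T \<in> carrier U_ring" "psi_U (ubas T) = bas T" by (simp_all add: ubas_def)
qed

lemma ubas_hpart: "T \<subseteq> {0, Suc 0} \<Longrightarrow> ubas T \<in> hpart U_ring (dgs T)"
  unfolding U.mem_hpart_iff by (auto simp: ubas intro!: supp_in_bas)

lemma part_subset: "part S i \<subseteq> {0, Suc 0}" by (auto simp: part_def)

lemma tbas_gens: "tbas S \<in> tensor_gens U_ring p"
  unfolding tensor_gens_iff tbas_def using ubas_hpart[OF part_subset] by (auto simp: homU_def)

text \<open>All indices of factor k precede those of later factors, so the product of the shifted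
  pieces is already sorted and no sign appears.\<close>

lemma tau_tbas_aux: "tau k (map (\<lambda>i. ubas (part S i)) [k..<k + n]) = bas (S \<inter> {2 * k..<2 * (k + n)})"
proof (induction n arbitrary: k)
  case 0
  then show ?case by (simp add: bas_empty)
next
  case (Suc n)
  have f: "finite (part S k)" by (auto simp: part_def)
  have "[k..<k + Suc n] = k # [Suc k..<Suc k + n]" by (simp add: upt_conv_Cons)
  then have "tau k (map (\<lambda>i. ubas (part S i)) [k..<k + Suc n]) =
     bas ((+) (2 * k) ` part S k) * bas (S \<inter> {2 * Suc k..<2 * (Suc k + n)})"
    using Suc.IH[of "Suc k"] by (simp add: ubas(2)[OF part_subset] shift_bas[OF f])
  also have "\<dots> = bas ((+) (2 * k) ` part S k \<union> (S \<inter> {2 * Suc k..<2 * (Suc k + n)}))"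
    by (rule bas_mult_less) (auto simp: part_def)
  also have "(+) (2 * k) ` part S k \<union> (S \<inter> {2 * Suc k..<2 * (Suc k + n)}) = S \<inter> {2 * k..<2 * (k + Suc n)}"
  proof (intro subset_antisym subsetI)
    fix x assume x: "x \<in> S \<inter> {2 * k..<2 * (k + Suc n)}"
    then consider "x = 2 * k" | "x = 2 * k + 1" | "x \<ge> 2 * Suc k" by force
    then show "x \<in> (+) (2 * k) ` part S k \<union> (S \<inter> {2 * Suc k..<2 * (Suc k + n)})"
    proof cases
      case 1
      then have "0 \<in> part S k" using x by (auto simp: part_def)
      then show ?thesis using 1 by force
    next
      case 2
      then have "1 \<in> part S k" using x by (auto simp: part_def)
      then show ?thesis using 2 by force
    qed (use x in auto)
  qed (auto simp: part_def)
  finally show ?case .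
qed

lemma tau_tbas: "S \<subseteq> JT \<Longrightarrow> tau 1 (tbas S) = bas S"
  using tau_tbas_aux[of 1 S p] by (simp add: tbas_def JT_def inf.absorb1 del: upt_Suc)

lemma finite_JT: "finite JT" by (simp add: JT_def)

text \<open>Entries are replaced by basis elements of \<open>U\<close> from left to right, each by
  additivity in its slot; \<open>us\<close> holds the entries already treated.\<close>

lemma reduce_T:
  assumes "set us \<subseteq> ubas ` Pow {0, Suc 0}" "us @ vs \<in> tensor_gens U_ring p"
  shows "frag_of (us @ vs) - \<theta>T (tau 1 (us @ vs)) \<in> KT"
  using assms
proof (induction vs arbitrary: us)
  case Nil
  then have len: "length us = p" by (simp add: tensor_gens_iff)
  have "\<forall>i\<in>{1..p}. \<exists>T. T \<subseteq> {0, Suc 0} \<and> us ! (i - 1) = ubas T"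
  proof
    fix i assume "i \<in> {1..p}"
    then have "us ! (i - 1) \<in> set us" using len by (intro nth_mem) auto
    then have "us ! (i - 1) \<in> ubas ` Pow {0, Suc 0}" using Nil(1) by (rule subsetD[rotated])
    then show "\<exists>T. T \<subseteq> {0, Suc 0} \<and> us ! (i - 1) = ubas T" by blast
  qed
  then obtain T where T: "\<And>i. i \<in> {1..p} \<Longrightarrow> T i \<subseteq> {0, Suc 0}" "\<And>i. i \<in> {1..p} \<Longrightarrow> us ! (i - 1) = ubas (T i)" by metis
  \<comment> \<open>When every entry is a basis element, the tensor is the normal form of a single
    monomial, whose index set is reassembled from the entries.\<close>
  define S where "S = (\<Union>i\<in>{1..p}. (+) (2 * i) ` T i)"
  have pT: "part S i = T i" if i: "i \<in> {1..p}" for i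
  proof (intro subset_antisym subsetI)
    fix j assume "j \<in> part S i"
    then obtain i' j' where *: "j \<in> {0, Suc 0}" "i' \<in> {1..p}" "j' \<in> T i'" "2 * i + j = 2 * i' + j'" by (auto simp: part_def S_def)
    then have "j' \<in> {0, Suc 0}" using T(1) by blast
    then have "i = i' \<and> j = j'" using * by auto presburger+
    then show "j \<in> T i" using * by simp
  next
    fix j assume "j \<in> T i"
    then show "j \<in> part S i" using T(1)[OF i] i by (auto simp: part_def S_def)
  qed
  have us: "us = tbas S"
  proof (rule nth_equalityI)
    show "length us = length (tbas S)" by (simp add: len tbas_def)
    fix i assume i: "i < length us"
    then have "tbas S ! i = ubas (part S (Suc i))" by (simp add: tbas_def len del: upt_Suc)
    then show "us ! i = tbas S ! i" using T(2)[of "Suc i"] pT[of "Suc i"] i len by simp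
  qed
  have "S \<subseteq> JT"
  proof
    fix x assume "x \<in> S"
    then obtain i j where "i \<in> {1..p}" "j \<in> T i" "x = 2 * i + j" by (auto simp: S_def)
    moreover then have "j \<le> 1" using T(1)[of i] by auto
    ultimately show "x \<in> JT" by (auto simp: JT_def)
  qed
  then have "tau 1 us = bas S" "finite S" using tau_tbas us finite_JT finite_subset by auto
  then show ?case using us by (simp add: \<theta>T_bas KT_0)
next
  case (Cons x vs)
  obtain d where d: "x \<in> hpart U_ring d" using Cons.prems(2) by (auto simp: tensor_gens_iff homU_def)
  let ?A = "{S \<in> Pow {0, Suc 0}. dgs S = d}"
  have gens: "us @ y # vs \<in> tensor_gens U_ring p" if "y \<in> hpart U_ring d" for y
    using rel_tensor_gens(1)[OF Cons.prems(2) d that] .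
  let ?R = "\<lambda>y. frag_of (us @ y # vs) - \<theta>T (tau 1 (us @ y # vs))"
  \<comment> \<open>Tensors are additive within one degree only, so the entry is split into
    monomials of its own degree d, and the support condition has to be carried through the
    induction.\<close>
  have "v \<in> supp_in ?A \<and> (\<forall>y\<in>carrier U_ring. psi_U y = v \<longrightarrow> ?R y \<in> KT)" if "v \<in> supp_in ?A" for v
    using that
  proof (induction v rule: ext_supp_induct)
    case zero
    have "?R \<zero>\<^bsub>U_ring\<^esub> \<in> KT"
    proof -
      have z: "\<zero>\<^bsub>U_ring\<^esub> \<in> hpart U_ring d" by (simp add: U.mem_hpart_iff)
      \<comment> \<open>The additivity relation for \<open>0 + 0\<close> is minus the tensor with
        entry 0.\<close>
      have "- frag_of (us @ \<zero>\<^bsub>U_ring\<^esub> # vs) \<in> KT" using KT_rel[OF gens[OF z] z z] by simp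
      then have "frag_of (us @ \<zero>\<^bsub>U_ring\<^esub> # vs) \<in> KT" using KT_minus by fastforce
      then show ?thesis by (simp add: tau_append shift_additive \<theta>T_additive)
    qed
    then show ?case using U.psi_inj[of _ "\<zero>\<^bsub>U_ring\<^esub>"] by auto
  next
    case (bas S)
    then have S: "S \<subseteq> {0, Suc 0}" "dgs S = d" by auto
    have h: "ubas S \<in> hpart U_ring d" using ubas_hpart S by auto
    have "frag_of ((us @ [ubas S]) @ vs) - \<theta>T (tau 1 ((us @ [ubas S]) @ vs)) \<in> KT"
      using Cons.prems(1) S gens[OF h] by (intro Cons.IH) auto
    then have "?R (ubas S) \<in> KT" by simp
    moreover have "y = ubas S" if "y \<in> carrier U_ring" "psi_U y = bas S" for y
      using that ubas[OF S(1)] by (intro U.psi_inj) auto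
    ultimately show ?case using bas by (auto intro: supp_in_bas)
  next
    case (diff v w)
    have vw: "v - w \<in> supp_in ?A" using diff by (auto intro: supp_in_diff)
    have ex: "\<exists>y. y \<in> carrier U_ring \<and> psi_U y = v" if "v \<in> supp_in ?A" for v
      using U.psi_surj[of v] supp_in_mono[OF _ that, of "Pow {0, Suc 0}"] by auto
    show ?case
    proof (intro conjI vw ballI impI)
      fix x assume x: "x \<in> carrier U_ring" "psi_U x = v - w"
      obtain y z where y: "y \<in> carrier U_ring" "psi_U y = v" and z: "z \<in> carrier U_ring" "psi_U z = w"
        using ex diff by meson
      have h: "x \<in> hpart U_ring d" "z \<in> hpart U_ring d"
        using x z vw diff unfolding U.mem_hpart_iff by auto
      have yx: "y = x \<oplus>\<^bsub>U_ring\<^esub> z" using x y z by (intro U.psi_inj) (auto simp: U.add_mem U.psi_add)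
      have Ry: "?R y \<in> KT" and Rz: "?R z \<in> KT" using diff y z by auto
      have rel: "frag_of (us @ y # vs) - frag_of (us @ x # vs) - frag_of (us @ z # vs) \<in> KT"
        unfolding yx by (rule KT_rel[OF gens[OF h(1)] h])
      have eq: "?R x = (?R y - ?R z) - (frag_of (us @ y # vs) - frag_of (us @ x # vs) - frag_of (us @ z # vs))"
        unfolding yx tau_add[OF x(1) z(1)] by (simp add: \<theta>T_additive)
      show "?R x \<in> KT" unfolding eq by (rule KT_diff[OF KT_diff[OF Ry Rz] rel])
    qed
  qed
  from this[of "psi_U x"] show ?case using d by (auto simp: U.mem_hpart_iff)
qed

lemma reduce_T_all: "Poly_Mapping.keys c \<subseteq> tensor_gens U_ring p \<Longrightarrow> c - \<theta>T (tauhat c) \<in> KT"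
proof (induction c rule: frag_induction)
  case (one xs)
  then show ?case using reduce_T[of "[]" xs] by (simp add: tauhat_def)
next
  case (diff a b)
  then show ?case using KT_diff[OF diff] by (simp add: tauhat_additive \<theta>T_additive algebra_simps)
qed (simp add: KT_0 tauhat_additive \<theta>T_additive)

lemma \<theta>T_closed: "Poly_Mapping.keys (\<theta>T v) \<subseteq> tensor_gens U_ring p"
  unfolding \<theta>T_def by (rule order_trans[OF keys_frag_extend]) (use tbas_gens in auto)

lemma tauhat_\<theta>T: "v \<in> supp_in (Pow JT) \<Longrightarrow> tauhat (\<theta>T v) = v"
proof (induction v rule: ext_supp_induct)
  case (bas S)
  then show ?case by (simp add: \<theta>T_bas tauhat_def tau_tbas del: One_nat_def)
qed (auto simp: \<theta>T_additive tauhat_additive)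

section \<open>The tensor power in coordinates\<close>

lemma tensor_class_eq: "tensor_class U_ring p c = KT #>\<^bsub>GT\<^esub> c"
  by (simp add: tensor_class_def KT_def GT_def Let_def)

lemma mem_tensor_class: "x \<in> tensor_class U_ring p c \<longleftrightarrow> x - c \<in> KT"
  unfolding tensor_class_eq r_coset_def by (force simp: GT_simps intro: bexI[of _ "x - c"])

lemma tensor_class_eq_iff:
  assumes "Poly_Mapping.keys c \<subseteq> tensor_gens U_ring p" "Poly_Mapping.keys d \<subseteq> tensor_gens U_ring p"
  shows "tensor_class U_ring p c = tensor_class U_ring p d \<longleftrightarrow> tauhat c = tauhat d"
proof
  assume "tensor_class U_ring p c = tensor_class U_ring p d"
  then have "c - d \<in> KT" using mem_tensor_class[of c c] mem_tensor_class[of c d] KT_0 by simp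
  then show "tauhat c = tauhat d" using tauhat_KT[of "c - d"] by (simp add: tauhat_additive)
next
  assume e: "tauhat c = tauhat d"
  have cd: "c - d \<in> KT" using KT_diff[OF reduce_T_all[OF assms(1)] reduce_T_all[OF assms(2)]] e by simp
  show "tensor_class U_ring p c = tensor_class U_ring p d"
  proof (rule Set.set_eqI)
    fix x
    show "x \<in> tensor_class U_ring p c \<longleftrightarrow> x \<in> tensor_class U_ring p d"
      unfolding mem_tensor_class using KT_add[OF _ cd, of "x - c"] KT_diff[OF _ cd, of "x - d"] by auto
  qed
qed

lemma psi_T_class: "psi_T (tensor_class U_ring p c) = tauhat c"
proof -
  have "c \<in> tensor_class U_ring p c" by (simp add: mem_tensor_class KT_0)
  then have "(SOME d. d \<in> tensor_class U_ring p c) \<in> tensor_class U_ring p c" by (rule someI)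
  then show ?thesis using tauhat_KT[of "(SOME d. d \<in> tensor_class U_ring p c) - c"]
    unfolding psi_T_def mem_tensor_class by (simp add: tauhat_additive)
qed

abbreviation (input) "TP \<equiv> tensor_power U_ring p"

lemma TP_simps:
  "carrier TP = {tensor_class U_ring p c | c. Poly_Mapping.keys c \<subseteq> tensor_gens U_ring p}"
  "\<zero>\<^bsub>TP\<^esub> = tensor_class U_ring p 0"
  "\<one>\<^bsub>TP\<^esub> = tensor_class U_ring p (frag_of (replicate p \<one>\<^bsub>U_ring\<^esub>))"
  "hpart TP d = {tensor_class U_ring p c | c. Poly_Mapping.keys c \<subseteq>
         {xs \<in> tensor_gens U_ring p. \<exists>ds. list_all2 (\<lambda>x e. x \<in> hpart U_ring e) xs ds \<and> sum_list ds = d}}"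
proof -
  have "\<zero>\<^bsub>TP\<^esub> = KT" by (simp add: tensor_power_def Let_def FactGroup_def KT_def GT_def)
  also have "\<dots> = tensor_class U_ring p 0" by (auto simp: mem_tensor_class)
  finally show "\<zero>\<^bsub>TP\<^esub> = tensor_class U_ring p 0" .
  show "carrier TP = {tensor_class U_ring p c | c. Poly_Mapping.keys c \<subseteq> tensor_gens U_ring p}"
    by (auto simp: tensor_power_def Let_def FactGroup_def RCOSETS_def tensor_class_eq KT_def[symmetric] GT_def[symmetric] GT_simps)
qed (simp_all add: tensor_power_def Let_def)

lemma TP_add:
  assumes "Poly_Mapping.keys c \<subseteq> tensor_gens U_ring p" "Poly_Mapping.keys d \<subseteq> tensor_gens U_ring p"
  shows "tensor_class U_ring p c \<oplus>\<^bsub>TP\<^esub> tensor_class U_ring p d = tensor_class U_ring p (c + d)"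
proof -
  have "KT \<lhd> GT" by (rule GT.subgroup_imp_normal[OF KT_subgroup])
  from normal.rcos_sum[OF this, of c d] assms show ?thesis
    by (simp add: tensor_power_def Let_def FactGroup_def tensor_class_eq KT_def[symmetric] GT_def[symmetric] GT_simps)
qed

abbreviation tmul :: "(U list \<Rightarrow>\<^sub>0 int) \<Rightarrow> (U list \<Rightarrow>\<^sub>0 int) \<Rightarrow> (U list \<Rightarrow>\<^sub>0 int)" where
  "tmul c d \<equiv> frag_extend (\<lambda>xs. frag_extend (\<lambda>ys.
               frag_cmul (koszul_sign U_ring xs ys) (frag_of (map2 (monoid.mult U_ring) xs ys))) d) c"

lemma homU_mult: "x \<in> homU \<Longrightarrow> y \<in> homU \<Longrightarrow> x \<otimes>\<^bsub>U_ring\<^esub> y \<in> homU"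
proof -
  assume "x \<in> homU" "y \<in> homU"
  then obtain d e where "x \<in> hpart U_ring d" "y \<in> hpart U_ring e" by (auto simp: homU_def)
  then have "x \<otimes>\<^bsub>U_ring\<^esub> y \<in> hpart U_ring (d + e)"
    using U.super_ring_M unfolding super_ring_def by blast
  then show ?thesis by (rule homU_I)
qed

lemma tmul_closed:
  assumes "Poly_Mapping.keys c \<subseteq> tensor_gens U_ring p" "Poly_Mapping.keys d \<subseteq> tensor_gens U_ring p"
  shows "Poly_Mapping.keys (tmul c d) \<subseteq> tensor_gens U_ring p"
proof -
  have *: "map2 (monoid.mult U_ring) xs ys \<in> tensor_gens U_ring p" if "xs \<in> tensor_gens U_ring p" "ys \<in> tensor_gens U_ring p" for xs ys
    using that homU_mult by (auto simp: tensor_gens_iff set_zip) (metis nth_mem subsetD)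
  show ?thesis
    using assms by (intro order_trans[OF keys_frag_extend] UN_least order_trans[OF keys_cmul]) (auto intro: *)
qed

lemma tauhat_tmul:
  assumes "Poly_Mapping.keys c \<subseteq> tensor_gens U_ring p" "Poly_Mapping.keys d \<subseteq> tensor_gens U_ring p"
  shows "tauhat (tmul c d) = tauhat c * tauhat d"
proof -
  have "tauhat (tmul c d) = lin (\<lambda>xs. lin (\<lambda>ys. of_int (koszul_sign U_ring xs ys) * tau 1 (map2 (monoid.mult U_ring) xs ys)) d) c"
    by (simp add: tauhat_def lin_frag_extend lin_cmul)
  also have "\<dots> = lin (\<lambda>xs. lin (\<lambda>ys. tau 1 xs * tau 1 ys) d) c"
    using assms by (intro lin_cong tau_mult) (auto simp: tensor_gens_iff dest!: subsetD)
  finally show ?thesis by (simp add: tauhat_def lin_mult_left lin_mult_right)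
qed

text \<open>The product is a \<open>the_elem\<close> over all pairs of representatives. Since
  \<open>tauhat\<close> is multiplicative and determines the class, all of them give the same
  class.\<close>

lemma TP_mult:
  assumes "Poly_Mapping.keys c \<subseteq> tensor_gens U_ring p" "Poly_Mapping.keys d \<subseteq> tensor_gens U_ring p"
  shows "tensor_class U_ring p c \<otimes>\<^bsub>TP\<^esub> tensor_class U_ring p d = tensor_class U_ring p (tmul c d)"
proof -
  have k: "Poly_Mapping.keys c' \<subseteq> tensor_gens U_ring p \<and> tauhat c' = tauhat c"
    if "c' \<in> tensor_class U_ring p c" "Poly_Mapping.keys c \<subseteq> tensor_gens U_ring p" for c c'
  proof -
    have "c' - c \<in> KT" using that mem_tensor_class by simp
    then show ?thesis using keys_add_subset[OF KT_closed that(2), of "c' - c"] tauhat_KT[of "c' - c"] by (simp add: tauhat_additive)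
  qed
  have "{tensor_class U_ring p (tmul c' d') | c' d'. c' \<in> tensor_class U_ring p c \<and> d' \<in> tensor_class U_ring p d}
     = {tensor_class U_ring p (tmul c d)}"
  proof (intro subset_antisym subsetI)
    fix x assume "x \<in> {tensor_class U_ring p (tmul c' d') | c' d'. c' \<in> tensor_class U_ring p c \<and> d' \<in> tensor_class U_ring p d}"
    then obtain c' d' where x: "x = tensor_class U_ring p (tmul c' d')" "c' \<in> tensor_class U_ring p c" "d' \<in> tensor_class U_ring p d" by blast
    have kc: "Poly_Mapping.keys c' \<subseteq> tensor_gens U_ring p" "tauhat c' = tauhat c"
      and kd: "Poly_Mapping.keys d' \<subseteq> tensor_gens U_ring p" "tauhat d' = tauhat d"
      using k[OF x(2) assms(1)] k[OF x(3) assms(2)] by simp_all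
    have "tauhat (tmul c' d') = tauhat (tmul c d)"
      by (simp only: tauhat_tmul[OF kc(1) kd(1)] tauhat_tmul[OF assms] kc(2) kd(2))
    then have "x = tensor_class U_ring p (tmul c d)"
      unfolding x(1) tensor_class_eq_iff[OF tmul_closed[OF kc(1) kd(1)] tmul_closed[OF assms]] .
    then show "x \<in> {tensor_class U_ring p (tmul c d)}" by simp
  next
    fix x assume "x \<in> {tensor_class U_ring p (tmul c d)}"
    moreover have "c \<in> tensor_class U_ring p c" "d \<in> tensor_class U_ring p d" by (simp_all add: mem_tensor_class KT_0)
    ultimately show "x \<in> {tensor_class U_ring p (tmul c' d') | c' d'. c' \<in> tensor_class U_ring p c \<and> d' \<in> tensor_class U_ring p d}" by blast
  qed
  then show ?thesis by (simp add: tensor_power_def Let_def)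
qed

lemma TP_elem:
  assumes "X \<in> carrier TP"
  shows "X \<noteq> {}" "c \<in> X \<Longrightarrow> Poly_Mapping.keys c \<subseteq> tensor_gens U_ring p \<and> lin (tau 1) c = psi_T X"
proof -
  obtain d where d: "X = tensor_class U_ring p d" "Poly_Mapping.keys d \<subseteq> tensor_gens U_ring p"
    using assms by (auto simp: TP_simps)
  then show "X \<noteq> {}" using mem_tensor_class[of d d] KT_0 by auto
  assume "c \<in> X"
  then have c: "c - d \<in> KT" using d mem_tensor_class by simp
  then show "Poly_Mapping.keys c \<subseteq> tensor_gens U_ring p \<and> lin (tau 1) c = psi_T X"
    using keys_add_subset[OF KT_closed d(2), of "c - d"] tauhat_KT[OF c] unfolding d(1) psi_T_class
    by (simp add: tauhat_def lin_diff)
qed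

lemma U_one_hpart: "\<one>\<^bsub>U_ring\<^esub> \<in> hpart U_ring 0"
  using U.super_ring_M by (simp add: super_ring_def)

lemma tau_replicate: "tau k (replicate n \<one>\<^bsub>U_ring\<^esub>) = 1"
  by (induction n arbitrary: k) (auto simp: U.psi_one)

lemma replicate_gens: "replicate p \<one>\<^bsub>U_ring\<^esub> \<in> tensor_gens U_ring p"
  using U_one_hpart by (auto simp: tensor_gens_iff homU_def)

lemma TP_model: "ext_ring_model TP psi_T JT dgs"
proof
  show "bij_betw psi_T (carrier TP) (supp_in (Pow JT))"
  proof (rule bij_betw_imageI)
    show "inj_on psi_T (carrier TP)"
    proof (rule inj_onI)
      fix X Y assume "X \<in> carrier TP" "Y \<in> carrier TP" "psi_T X = psi_T Y"
      then obtain c d where "X = tensor_class U_ring p c" "Y = tensor_class U_ring p d" "Poly_Mapping.keys c \<subseteq> tensor_gens U_ring p"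
        "Poly_Mapping.keys d \<subseteq> tensor_gens U_ring p" "tauhat c = tauhat d"
        by (auto simp: TP_simps psi_T_class)
      then show "X = Y" using tensor_class_eq_iff[of c d] by simp
    qed
    show "psi_T ` carrier TP = supp_in (Pow JT)"
    proof (intro subset_antisym subsetI)
      fix v assume v: "v \<in> supp_in (Pow JT)"
      then show "v \<in> psi_T ` carrier TP"
        using \<theta>T_closed tauhat_\<theta>T by (intro image_eqI[where x = "tensor_class U_ring p (\<theta>T v)"]) (auto simp: TP_simps psi_T_class)
    next
      fix v assume "v \<in> psi_T ` carrier TP"
      then obtain c where c: "v = tauhat c" "Poly_Mapping.keys c \<subseteq> tensor_gens U_ring p" by (auto simp: TP_simps psi_T_class)
      show "v \<in> supp_in (Pow JT)" unfolding c(1) tauhat_def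
      proof (rule supp_in_lin)
        fix xs assume "xs \<in> Poly_Mapping.keys c"
        then have "xs \<in> tensor_gens U_ring p" using c(2) by blast
        then have xs: "length xs = p" "set xs \<subseteq> homU" by (simp_all add: tensor_gens_iff)
        then obtain D where "\<And>x. x \<in> set xs \<Longrightarrow> x \<in> hpart U_ring (D x)" unfolding homU_def by (metis UN_E subsetD)
        then have "list_all2 (\<lambda>u d. u \<in> hpart U_ring d) xs (map D xs)" by (simp add: list_all2_conv_all_nth)
        from tau_supp[OF this, of 1] show "tau 1 xs \<in> supp_in (Pow JT)"
          by (rule supp_in_mono[rotated]) (auto simp: JT_def xs)
      qed
    qed
  qed
  fix d
  show "psi_T ` hpart TP d = supp_in {S \<in> Pow JT. dgs S = d}"
  proof (intro subset_antisym subsetI)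
    fix v assume v: "v \<in> supp_in {S \<in> Pow JT. dgs S = d}"
    have vJ: "v \<in> supp_in (Pow JT)" by (rule supp_in_mono[OF _ v]) auto
    have "\<exists>ds. list_all2 (\<lambda>x e. x \<in> hpart U_ring e) w ds \<and> sum_list ds = d" if w: "w \<in> Poly_Mapping.keys (\<theta>T v)" for w
    proof -
      obtain S where S: "S \<in> Poly_Mapping.keys (coefs v)" "w = tbas S"
        using w keys_frag_extend[of "\<lambda>S. frag_of (tbas S)" "coefs v"]
        unfolding \<theta>T_def by auto
      then have S': "finite S" "S \<subseteq> JT" "dgs S = d" using v finite_keys_coefs by (auto simp: supp_in_def)
      let ?ds = "map (\<lambda>i. dgs (part S i)) [1..<Suc p]"
      have l: "list_all2 (\<lambda>x e. x \<in> hpart U_ring e) w ?ds"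
        unfolding S(2) tbas_def by (auto simp: list_all2_conv_all_nth ubas_hpart[OF part_subset] simp del: upt_Suc)
      \<comment> \<open>The degrees of the entries of \<open>tbas S\<close> add up to
        \<open>dgs S\<close>: the general degree statement for \<open>tau\<close> is applied where
        its value is known to be one monomial.\<close>
      have "bas S \<in> supp_in {S. S \<subseteq> {2 * 1..<2 * (1 + length w)} \<and> dgs S = sum_list ?ds}"
        using tau_supp[OF l, of 1] tau_tbas[OF S'(2)] S(2) by (simp del: upt_Suc)
      then have "dgs S = sum_list ?ds" using S'(1) by (simp add: supp_in_def coefs_bas del: upt_Suc)
      then show ?thesis using l S'(3) by metis
    qed
    then show "v \<in> psi_T ` hpart TP d"
      using \<theta>T_closed[of v] tauhat_\<theta>T[OF vJ]
      by (intro image_eqI[where x = "tensor_class U_ring p (\<theta>T v)"]) (auto simp: TP_simps psi_T_class)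
  next
    fix v assume "v \<in> psi_T ` hpart TP d"
    then obtain c where c: "v = tauhat c" "Poly_Mapping.keys c \<subseteq>
         {xs \<in> tensor_gens U_ring p. \<exists>ds. list_all2 (\<lambda>x e. x \<in> hpart U_ring e) xs ds \<and> sum_list ds = d}"
      by (auto simp: TP_simps psi_T_class)
    show "v \<in> supp_in {S \<in> Pow JT. dgs S = d}"
      unfolding c(1) tauhat_def
    proof (rule supp_in_lin)
      fix xs assume "xs \<in> Poly_Mapping.keys c"
      then obtain ds where ds: "list_all2 (\<lambda>x e. x \<in> hpart U_ring e) xs ds" "sum_list ds = d" "length xs = p"
        using c(2) by (auto simp: tensor_gens_iff)
      from tau_supp[OF ds(1), of 1] show "tau 1 xs \<in> supp_in {S \<in> Pow JT. dgs S = d}"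
        by (rule supp_in_mono[rotated]) (auto simp: JT_def ds)
    qed
  qed
  show "hpart TP d \<subseteq> carrier TP" by (auto simp: TP_simps)
next
  fix X Y assume "X \<in> carrier TP" "Y \<in> carrier TP"
  then obtain c d where cd: "X = tensor_class U_ring p c" "Y = tensor_class U_ring p d"
     "Poly_Mapping.keys c \<subseteq> tensor_gens U_ring p" "Poly_Mapping.keys d \<subseteq> tensor_gens U_ring p" by (auto simp: TP_simps)
  then have XY: "X \<oplus>\<^bsub>TP\<^esub> Y = tensor_class U_ring p (c + d)" "X \<otimes>\<^bsub>TP\<^esub> Y = tensor_class U_ring p (tmul c d)"
    by (simp_all add: TP_add TP_mult)
  show "X \<oplus>\<^bsub>TP\<^esub> Y \<in> carrier TP" "X \<otimes>\<^bsub>TP\<^esub> Y \<in> carrier TP"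
    unfolding XY TP_simps using keys_add_subset[OF cd(3,4)] tmul_closed[OF cd(3,4)] by blast+
  show "psi_T (X \<oplus>\<^bsub>TP\<^esub> Y) = psi_T X + psi_T Y" "psi_T (X \<otimes>\<^bsub>TP\<^esub> Y) = psi_T X * psi_T Y"
    by (simp_all only: XY psi_T_class tauhat_additive tauhat_tmul[OF cd(3,4)]) (simp_all add: cd(1,2) psi_T_class)
next
  show "\<zero>\<^bsub>TP\<^esub> \<in> carrier TP" unfolding TP_simps by (intro CollectI exI[of _ 0]) simp
  show "\<one>\<^bsub>TP\<^esub> \<in> carrier TP" unfolding TP_simps
    by (intro CollectI exI[of _ "frag_of (replicate p \<one>\<^bsub>U_ring\<^esub>)"]) (use replicate_gens in simp)
  show "psi_T \<zero>\<^bsub>TP\<^esub> = 0" by (simp add: TP_simps psi_T_class tauhat_additive)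
  show "psi_T \<one>\<^bsub>TP\<^esub> = 1" by (simp add: TP_simps psi_T_class tauhat_def tau_replicate)
  show "dgs (S \<union> T) = dgs S + dgs T" if "S \<subseteq> JT" "T \<subseteq> JT" "S \<inter> T = {}" for S T
    using that finite_JT by (intro dgs_Un) (auto dest: finite_subset)
qed (auto simp: finite_JT)

lemma pure_tensor_TP:
  assumes "xs \<in> tensor_gens U_ring p"
  shows "pure_tensor U_ring xs \<in> carrier TP" "psi_T (pure_tensor U_ring xs) = tau 1 xs"
proof -
  have l: "length xs = p" using assms by (simp add: tensor_gens_iff)
  show "pure_tensor U_ring xs \<in> carrier TP"
    unfolding l TP_simps using assms by (intro CollectI exI[of _ "frag_of xs"]) simp
  show "psi_T (pure_tensor U_ring xs) = tau 1 xs" unfolding l psi_T_class by (simp add: tauhat_def)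
qed

end

section \<open>Winding numbers of singular chains\<close>

definition edge :: "real \<Rightarrow> nat \<Rightarrow> real" where
  "edge t = (\<lambda>i. if i = 0 then 1 - t else if i = 1 then t else 0)"

lemma edge_in_simplex: "t \<in> {0..1} \<Longrightarrow> edge t \<in> standard_simplex 1"
  by (auto simp: edge_def standard_simplex_def)

lemma simplex_1_edge: "x \<in> standard_simplex 1 \<Longrightarrow> x = edge (x 1) \<and> x 1 \<in> {0..1}"
  by (force simp: edge_def standard_simplex_def fun_eq_iff)

lemma continuous_edge:
  "continuous_map (top_of_set {0..1}) (subtopology (powertop_real UNIV) (standard_simplex 1)) edge"
  unfolding continuous_map_in_subtopology continuous_map_componentwise_UNIV
proof (intro conjI allI)
  fix i
  show "continuous_map (top_of_set {0..1}) euclideanreal (\<lambda>t. edge t i)"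
    by (cases "i = 0"; cases "i = 1") (auto simp: edge_def intro!: continuous_intros)
qed (use edge_in_simplex in auto)

text \<open>On simplices whose ends differ the value need not be an integer; defining it on all
  simplices allows linear extension to chains.\<close>

definition wind_simplex :: "('a \<Rightarrow> complex) \<Rightarrow> ((nat \<Rightarrow> real) \<Rightarrow> 'a) \<Rightarrow> complex" where
  "wind_simplex f \<sigma> = winding_number (\<lambda>t. f (\<sigma> (edge t))) 0"

definition wind :: "('a \<Rightarrow> complex) \<Rightarrow> 'a chain \<Rightarrow> complex" where
  "wind f = lin (wind_simplex f)"

lemma wind_frag_of [simp]: "wind f (frag_of \<sigma>) = wind_simplex f \<sigma>" by (simp add: wind_def)

lemma wind_additive: "wind f 0 = 0" "wind f (c + d) = wind f c + wind f d" "wind f (c - d) = wind f c - wind f d"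
  by (simp_all add: wind_def lin_add lin_diff)

text \<open>Barycentric coordinates on the triangle with vertices 0, 1 and \<open>\<i>\<close>,
  through which the faces of a singular 2-simplex are read along line segments.\<close>

definition tri :: "complex \<Rightarrow> nat \<Rightarrow> real" where
  "tri w = (\<lambda>i. if i = 0 then 1 - Re w - Im w else if i = 1 then Re w else if i = 2 then Im w else 0)"

definition tri_set :: "complex set" where "tri_set = {w. 0 \<le> Re w \<and> 0 \<le> Im w \<and> Re w + Im w \<le> 1}"

lemma convex_tri_set: "convex tri_set"
proof -
  have eq: "tri_set = {w. 0 \<le> Re w} \<inter> {w. 0 \<le> Im w} \<inter> {w. Re w + Im w \<le> 1}" by (auto simp: tri_set_def)
  have c: "convex {w. Re w + Im w \<le> 1}"
  proof -
    have "{w. Re w + Im w \<le> 1} = {w. Complex 1 1 \<bullet> w \<le> 1}" by (auto simp: inner_complex_def)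
    then show ?thesis by (simp only: convex_halfspace_le)
  qed
  show ?thesis
    unfolding eq by (intro convex_Int convex_halfspace_Re_ge convex_halfspace_Im_ge c)
qed

lemma tri_in_simplex: "w \<in> tri_set \<Longrightarrow> tri w \<in> standard_simplex 2"
  by (auto simp: tri_def standard_simplex_def tri_set_def atMost_nat_numeral eval_nat_numeral)

lemma continuous_tri:
  "continuous_map (top_of_set tri_set) (subtopology (powertop_real UNIV) (standard_simplex 2)) tri"
  unfolding continuous_map_in_subtopology continuous_map_componentwise_UNIV
proof (intro conjI allI)
  fix i
  show "continuous_map (top_of_set tri_set) euclideanreal (\<lambda>w. tri w i)"
    by (cases "i = 0"; cases "i = 1"; cases "i = 2") (auto simp: tri_def intro!: continuous_intros)
qed (use tri_in_simplex in auto)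

lemma face_edges:
  assumes "t \<in> {0..1}"
  shows "singular_face 2 0 \<sigma> (edge t) = \<sigma> (tri (linepath 1 \<i> t))"
    "singular_face 2 1 \<sigma> (edge t) = \<sigma> (tri (linepath 0 \<i> t))"
    "singular_face 2 2 \<sigma> (edge t) = \<sigma> (tri (linepath 0 1 t))"
proof -
  have "simplical_face 0 (edge t) = tri (linepath 1 \<i> t)" "simplical_face 1 (edge t) = tri (linepath 0 \<i> t)"
    "simplical_face 2 (edge t) = tri (linepath 0 1 t)"
    by (auto simp: simplical_face_def edge_def tri_def linepath_def fun_eq_iff)
  then show "singular_face 2 0 \<sigma> (edge t) = \<sigma> (tri (linepath 1 \<i> t))"
    "singular_face 2 1 \<sigma> (edge t) = \<sigma> (tri (linepath 0 \<i> t))"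
    "singular_face 2 2 \<sigma> (edge t) = \<sigma> (tri (linepath 0 1 t))"
    using edge_in_simplex[OF assms] by (simp_all add: singular_face_def)
qed

text \<open>On the triangle, which is contractible, the map to the punctured plane has a logarithm
  L. The winding along a side is the increment of L divided by \<open>2 * pi * \<i>\<close>, and the
  increments cancel around the boundary.\<close>

lemma wind_boundary_simplex:
  assumes \<sigma>: "singular_simplex 2 X \<sigma>" and f: "continuous_map X euclidean f" "\<And>x. x \<in> topspace X \<Longrightarrow> f x \<noteq> 0"
  shows "wind f (chain_boundary 2 (frag_of \<sigma>)) = 0"
proof -
  let ?g = "f \<circ> \<sigma> \<circ> tri"
  have sc: "continuous_map (subtopology (powertop_real UNIV) (standard_simplex 2)) X \<sigma>"
    using \<sigma> by (simp add: singular_simplex_def)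
  have "continuous_map (top_of_set tri_set) euclidean ?g"
    by (intro continuous_map_compose[OF continuous_tri] continuous_map_compose[OF sc] f)
  then have "continuous_on tri_set ?g" by simp
  moreover have "?g w \<noteq> 0" if "w \<in> tri_set" for w
    using tri_in_simplex[OF that] sc f(2) by (auto simp: continuous_map_def Pi_iff)
  ultimately obtain L where L: "continuous_on tri_set L" "\<And>w. w \<in> tri_set \<Longrightarrow> ?g w = exp (L w)"
    using continuous_logarithm_on_contractible[OF _ convex_imp_contractible[OF convex_tri_set], of ?g] by metis
  have w: "winding_number (\<lambda>t. f (\<sigma> (tri (linepath a b t)))) 0 = (L b - L a) / (2 * pi * \<i>)"
    if "a \<in> tri_set" "b \<in> tri_set" for a b
  proof -
    have sub: "closed_segment a b \<subseteq> tri_set"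
      using closed_segment_subset[OF that convex_tri_set] .
    have "path (L \<circ> linepath a b)"
      by (intro path_continuous_image continuous_on_subset[OF L(1)]) (use sub in auto)
    then have "winding_number (exp \<circ> (L \<circ> linepath a b)) 0 = (L b - L a) / (2 * pi * \<i>)"
      using winding_number_compose_exp[of "L \<circ> linepath a b"]
      by (simp add: pathstart_def pathfinish_def linepath_def)
    moreover have "winding_number (\<lambda>t. f (\<sigma> (tri (linepath a b t)))) 0 = winding_number (exp \<circ> (L \<circ> linepath a b)) 0"
    proof (rule winding_number_cong)
      fix t :: real assume "0 \<le> t" "t \<le> 1"
      then have "linepath a b t \<in> tri_set" using sub linepath_in_path[of t a b] by auto
      then show "f (\<sigma> (tri (linepath a b t))) = (exp \<circ> (L \<circ> linepath a b)) t"
        using L(2) by simp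
    qed
    ultimately show ?thesis by simp
  qed
  have tr: "0 \<in> tri_set" "1 \<in> tri_set" "\<i> \<in> tri_set" by (auto simp: tri_set_def)
  have *: "wind_simplex f (singular_face 2 j \<sigma>) = (L b - L a) / (2 * pi * \<i>)"
    if "\<And>t. t \<in> {0..1} \<Longrightarrow> singular_face 2 j \<sigma> (edge t) = \<sigma> (tri (linepath a b t))" "a \<in> tri_set" "b \<in> tri_set" for j a b
    unfolding wind_simplex_def w[OF that(2,3), symmetric] by (intro winding_number_cong) (simp add: that(1))
  have s: "wind_simplex f (singular_face 2 0 \<sigma>) = (L \<i> - L 1) / (2 * pi * \<i>)"
     "wind_simplex f (singular_face 2 1 \<sigma>) = (L \<i> - L 0) / (2 * pi * \<i>)"
     "wind_simplex f (singular_face 2 2 \<sigma>) = (L 1 - L 0) / (2 * pi * \<i>)"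
    by (rule *; rule tr face_edges; assumption?)+
  have "chain_boundary 2 (frag_of \<sigma>) = frag_of (singular_face 2 0 \<sigma>) - frag_of (singular_face 2 1 \<sigma>) + frag_of (singular_face 2 2 \<sigma>)"
    by (simp add: chain_boundary_of eval_nat_numeral)
  then show ?thesis by (simp add: wind_additive s diff_divide_distrib del: One_nat_def)
qed

lemma wind_boundary:
  assumes c: "singular_chain 2 X c" and f: "continuous_map X euclidean f" "\<And>x. x \<in> topspace X \<Longrightarrow> f x \<noteq> 0"
  shows "wind f (chain_boundary 2 c) = 0"
  using c unfolding singular_chain_def
proof (induction c rule: frag_induction)
  case (one \<sigma>)
  then show ?case using wind_boundary_simplex[OF _ f] by simp
qed (auto simp: chain_boundary_diff wind_additive)

subsection \<open>Chains in a finite set of points\<close>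

text \<open>The injective continuous \<open>k\<close> stands in for a separation property of X: the
  image of the simplex under it is finite and connected, hence one point.\<close>

lemma singular_simplex_finite_const:
  assumes \<sigma>: "singular_simplex p (subtopology X S) \<sigma>" and S: "finite S"
    and k: "continuous_map X euclidean (k :: 'a \<Rightarrow> complex)" "inj_on k (topspace X)"
  shows "\<exists>q\<in>S. q \<in> topspace X \<and> \<sigma> = restrict (\<lambda>_. q) (standard_simplex p)"
proof -
  have sc: "continuous_map (subtopology (powertop_real UNIV) (standard_simplex p)) (subtopology X S) \<sigma>"
    and ext: "\<sigma> \<in> extensional (standard_simplex p)"
    using \<sigma> by (auto simp: singular_simplex_def)
  have im: "\<sigma> x \<in> S \<inter> topspace X" if "x \<in> standard_simplex p" for x
    using sc that by (auto simp: continuous_map_def Pi_iff)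
  have "continuous_map (subtopology (powertop_real UNIV) (standard_simplex p)) euclidean (k \<circ> \<sigma>)"
    by (intro continuous_map_compose[OF sc] continuous_map_from_subtopology k)
  from connectedin_continuous_map_image[OF this, of "standard_simplex p"]
  have "connected ((k \<circ> \<sigma>) ` standard_simplex p)"
    by (simp add: connectedin_subtopology connectedin_standard_simplex)
  moreover have "finite ((k \<circ> \<sigma>) ` standard_simplex p)"
    using im by (intro finite_subset[OF _ finite_imageI[OF S, of k]]) auto
  ultimately obtain a where a: "(k \<circ> \<sigma>) ` standard_simplex p = {a}"
    using connected_finite_iff_sing nonempty_standard_simplex by (metis image_is_empty)
  obtain x0 where x0: "x0 \<in> standard_simplex p" using nonempty_standard_simplex by blast
  have "\<sigma> x = \<sigma> x0" if "x \<in> standard_simplex p" for x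
  proof -
    have "k (\<sigma> x) = a" "k (\<sigma> x0) = a" using a that x0 by (metis comp_apply imageI singletonD)+
    then show ?thesis using k(2) im[OF that] im[OF x0] by (auto simp: inj_on_def)
  qed
  then have "\<sigma> = restrict (\<lambda>_. \<sigma> x0) (standard_simplex p)"
    using ext by (auto simp: fun_eq_iff extensional_def)
  then show ?thesis using im[OF x0] by blast
qed

abbreviation cpt :: "'a \<Rightarrow> (nat \<Rightarrow> real) \<Rightarrow> 'a" where
  "cpt q \<equiv> restrict (\<lambda>_. q) (standard_simplex 0)"

lemma chain_boundary_1: "chain_boundary 1 (frag_of \<sigma>) = frag_of (cpt (\<sigma> (edge 1))) - frag_of (cpt (\<sigma> (edge 0)))"
proof -
  have "singular_face 1 0 \<sigma> = cpt (\<sigma> (edge 1))" "singular_face 1 1 \<sigma> = cpt (\<sigma> (edge 0))"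
    by (auto simp: singular_face_def standard_simplex_0 fun_eq_iff simplical_face_def edge_def
        intro!: arg_cong[where f = \<sigma>])
  then show ?thesis by (simp add: chain_boundary_of)
qed

lemma cpt_inject: "cpt q = cpt q' \<longleftrightarrow> q = q'"
proof
  assume "cpt q = cpt q'"
  then have "cpt q (\<lambda>j. if j = 0 then 1 else 0) = cpt q' (\<lambda>j. if j = 0 then 1 else 0)" by simp
  then show "q = q'" by simp
qed simp

context
  fixes X :: "'a topology" and S :: "'a set" and k :: "'a \<Rightarrow> complex"
  assumes S: "finite S" and k: "continuous_map X euclidean k" "inj_on k (topspace X)"
begin

lemma finite_chain_boundary_1:
  assumes "singular_chain 1 (subtopology X S) c"
  shows "chain_boundary 1 c = 0"
  using assms unfolding singular_chain_def
proof (induction c rule: frag_induction)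
  case (one \<sigma>)
  then obtain q where "\<sigma> = restrict (\<lambda>_. q) (standard_simplex 1)"
    using singular_simplex_finite_const[OF _ S k, of 1 \<sigma>] by auto
  then show ?case unfolding chain_boundary_1 using edge_in_simplex[of 0] edge_in_simplex[of 1] by simp
qed (auto simp: chain_boundary_diff)

lemma finite_wind_0:
  assumes "singular_chain 1 (subtopology X S) c"
  and f: "\<And>x. x \<in> topspace X \<Longrightarrow> f x \<noteq> 0"
  shows "wind f c = 0"
  using assms(1) unfolding singular_chain_def
proof (induction c rule: frag_induction)
  case (one \<sigma>)
  then obtain q where q: "\<sigma> = restrict (\<lambda>_. q) (standard_simplex 1)" "q \<in> topspace X"
    using singular_simplex_finite_const[OF _ S k, of 1 \<sigma>] by auto
  show ?case unfolding wind_frag_of wind_simplex_def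
    by (rule winding_number_constI[of "f q"]) (use q f edge_in_simplex in auto)
qed (auto simp: wind_additive)

text \<open>A relative boundary is a boundary plus a chain of constant simplices, and neither winds;
  so winding descends to relative classes.\<close>

lemma finite_wind_relboundary:
  assumes "singular_relboundary 1 X S c"
    and f: "continuous_map X euclidean f" "\<And>x. x \<in> topspace X \<Longrightarrow> f x \<noteq> 0"
  shows "wind f c = 0"
proof -
  obtain d e where de: "singular_chain 2 X d" "singular_chain 1 (subtopology X S) e" "chain_boundary 2 d + e = c"
    using assms(1) unfolding singular_relboundary by (auto simp: numeral_2_eq_2)
  have "wind f c = wind f (chain_boundary 2 d) + wind f e" by (simp add: wind_additive flip: de(3))
  then show ?thesis using wind_boundary[OF de(1) f] finite_wind_0[OF de(2) f(2)] by simp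
qed

text \<open>1-chains in a finite point set have zero boundary, so a class in degree zero contains a
  single chain. This gives the \<open>the_elem\<close> in \<open>boundary_coeff\<close> its
  meaning.\<close>

lemma boundary_coeff_class:
  assumes "singular_relcycle 1 X S c"
  shows "boundary_coeff X S q (homologous_rel_set 1 X S c) = Poly_Mapping.lookup (chain_boundary 1 c) (cpt q)"
proof -
  have "hom_boundary 1 X S (homologous_rel_set 1 X S c) = homologous_rel_set 0 (subtopology X S) {} (chain_boundary 1 c)"
    using hom_boundary_chain_boundary[OF assms] by simp
  also have "\<dots> = {chain_boundary 1 c}"
  proof -
    have "a = b" if ab: "homologous_rel 0 (subtopology X S) {} a b" for a b
    proof -
      obtain d where "singular_chain 1 (subtopology X S) d" "chain_boundary 1 d = a - b"
        using ab unfolding homologous_rel_def singular_boundary by auto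
      then show ?thesis using finite_chain_boundary_1[of d] by simp
    qed
    then show ?thesis using homologous_rel_refl by blast
  qed
  finally show ?thesis by (simp add: boundary_coeff_def)
qed

end

definition wind_class :: "('a \<Rightarrow> complex) \<Rightarrow> 'a chain set \<Rightarrow> complex" where
  "wind_class f A = wind f (SOME c. c \<in> A)"

lemma wind_class_eq:
  assumes "finite S" "continuous_map X euclidean (k :: 'a \<Rightarrow> complex)" "inj_on k (topspace X)"
    and f: "continuous_map X euclidean f" "\<And>x. x \<in> topspace X \<Longrightarrow> f x \<noteq> 0"
  shows "wind_class f (homologous_rel_set 1 X S c) = wind f c"
proof -
  have "(SOME d. d \<in> homologous_rel_set 1 X S c) \<in> homologous_rel_set 1 X S c"
    by (rule someI[of _ c]) simp
  then have "singular_relboundary 1 X S (c - (SOME d. d \<in> homologous_rel_set 1 X S c))"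
    by (simp add: homologous_rel_def)
  from finite_wind_relboundary[OF assms(1-3) this f] show ?thesis
    by (simp add: wind_class_def wind_additive)
qed

lemma homology_class_mult:
  assumes "singular_relcycle p X S c" "singular_relcycle p X S d"
  shows "homologous_rel_set p X S c \<otimes>\<^bsub>relative_homology_group (int p) X S\<^esub> homologous_rel_set p X S d
     = homologous_rel_set p X S (c + d)"
proof -
  have "homologous_rel_set p X S c \<otimes>\<^bsub>relative_homology_group (int p) X S\<^esub> homologous_rel_set p X S d
     = {a + b | a b. homologous_rel p X S c a \<and> homologous_rel p X S d b}"
    by (auto simp: mult_relative_homology_group)
  also have "\<dots> = homologous_rel_set p X S (c + d)"
  proof (intro subset_antisym subsetI)
    fix x assume "x \<in> homologous_rel_set p X S (c + d)"
    then have "homologous_rel p X S d (x - c)" by (simp add: homologous_rel_def algebra_simps)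
    then show "x \<in> {a + b | a b. homologous_rel p X S c a \<and> homologous_rel p X S d b}"
      by (intro CollectI exI[of _ c] exI[of _ "x - c"]) simp
  qed (auto intro: homologous_rel_add)
  finally show ?thesis .
qed

lemma homology_class_exists:
  assumes "x \<in> carrier (relative_homology_group 1 X S)"
  obtains c where "singular_relcycle 1 X S c" "x = homologous_rel_set 1 X S c"
  using assms carrier_relative_homology_group[of 1 X S] by auto

lemma homology_class_closed:
  "singular_relcycle 1 X S c \<Longrightarrow> homologous_rel_set 1 X S c \<in> carrier (relative_homology_group 1 X S)"
  using carrier_relative_homology_group[of 1 X S] by auto

subsection \<open>Path classes\<close>

abbreviation path_simplex :: "(real \<Rightarrow> 'a) \<Rightarrow> (nat \<Rightarrow> real) \<Rightarrow> 'a" where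
  "path_simplex g \<equiv> restrict (\<lambda>x. g (x 1)) (standard_simplex 1)"

lemma path_simplex_edge: "t \<in> {0..1} \<Longrightarrow> path_simplex g (edge t) = g t"
  using edge_in_simplex by (simp add: edge_def)

lemma singular_simplex_path:
  assumes "pathin X g"
  shows "singular_simplex 1 X (path_simplex g)"
proof -
  have "continuous_map (subtopology (powertop_real UNIV) (standard_simplex 1)) (top_of_set {0..1}) (\<lambda>x. x 1)"
    unfolding continuous_map_in_subtopology
    using simplex_1_edge by (auto intro!: continuous_map_from_subtopology continuous_map_product_projection)
  from continuous_map_compose[OF this, of X g] assms
  show ?thesis unfolding singular_simplex_def pathin_def o_def
    by (auto intro: continuous_map_eq)
qed

lemma chain_boundary_path: "chain_boundary 1 (frag_of (path_simplex g)) = frag_of (cpt (g 1)) - frag_of (cpt (g 0))"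
  unfolding chain_boundary_1 using path_simplex_edge[of 0 g] path_simplex_edge[of 1 g] by simp

lemma wind_path: "wind f (frag_of (path_simplex g)) = winding_number (f \<circ> g) 0"
  unfolding wind_frag_of wind_simplex_def o_def
  by (intro winding_number_cong) (simp add: path_simplex_edge del: One_nat_def restrict_apply restrict_apply')

lemma relcycle_path:
  assumes "pathin X g" "g 0 = g 1 \<or> {g 0, g 1} \<subseteq> S"
  shows "singular_relcycle 1 X S (frag_of (path_simplex g))"
proof -
  have [simp]: "g 0 \<in> topspace X" "g 1 \<in> topspace X"
    using assms(1) by (auto simp: pathin_def continuous_map_def Pi_iff)
  have "singular_simplex 0 (subtopology X S) (cpt q)" if "q \<in> S" "q \<in> topspace X" for q
    using that by (auto simp: singular_simplex_def)
  then have "singular_chain 0 (subtopology X S) (frag_of (cpt (g 1)) - frag_of (cpt (g 0)))"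
    using assms(2) by (cases "g 0 = g 1") (auto intro!: singular_chain_diff simp: singular_chain_of)
  then show ?thesis
    unfolding singular_relcycle chain_boundary_path
    using singular_simplex_path[OF assms(1)] by (simp add: singular_chain_of)
qed

text \<open>The exponential of \<open>2 * pi * \<i>\<close> times the winding is the quotient of the
  end values, and so is that of the difference of their logarithms; the branch chosen by
  \<open>Ln\<close> matters only up to integers.\<close>

lemma wind_simplex_Ln:
  assumes \<sigma>: "singular_simplex 1 X \<sigma>" and f: "continuous_map X euclidean f" "\<And>x. x \<in> topspace X \<Longrightarrow> f x \<noteq> 0"
  shows "wind_simplex f \<sigma> - (Ln (f (\<sigma> (edge 1))) - Ln (f (\<sigma> (edge 0)))) / (2 * pi * \<i>) \<in> \<int>"
proof -
  let ?g = "\<lambda>t. f (\<sigma> (edge t))"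
  have sc: "continuous_map (subtopology (powertop_real UNIV) (standard_simplex 1)) X \<sigma>"
    using \<sigma> by (simp add: singular_simplex_def)
  have "continuous_map (top_of_set {0..1}) euclidean (f \<circ> \<sigma> \<circ> edge)"
    by (intro continuous_map_compose[OF continuous_edge] continuous_map_compose[OF sc] f)
  then have p: "path ?g" by (simp add: path_def o_def)
  have nz: "?g t \<noteq> 0" if "t \<in> {0..1}" for t
    using edge_in_simplex[OF that] sc f(2) by (auto simp: continuous_map_def Pi_iff)
  then have "0 \<notin> path_image ?g" by (auto simp: path_image_def)
  from winding_number_exp_2pi[OF p this]
  have e: "?g 1 = exp (2 * pi * \<i> * wind_simplex f \<sigma>) * ?g 0"
    by (simp add: pathstart_def pathfinish_def wind_simplex_def)
  let ?u = "wind_simplex f \<sigma> - (Ln (?g 1) - Ln (?g 0)) / (2 * pi * \<i>)"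
  have "2 * pi * \<i> * ?u = 2 * pi * \<i> * wind_simplex f \<sigma> - Ln (?g 1) + Ln (?g 0)"
    by (simp add: field_simps)
  then have "exp (2 * pi * \<i> * ?u) = exp (2 * pi * \<i> * wind_simplex f \<sigma>) / ?g 1 * ?g 0"
    using nz[of 0] nz[of 1] by (simp add: exp_add exp_diff)
  also have "\<dots> = 1" using e nz[of 0] nz[of 1] by (simp add: field_simps)
  finally have "exp (2 * pi * \<i> * ?u) = 1" .
  then obtain n :: int where n: "Re (2 * pi * \<i> * ?u) = 0" "Im (2 * pi * \<i> * ?u) = of_int (2 * n) * pi"
    unfolding exp_eq_1 by blast
  have "Im ?u = 0" "Re ?u = of_int n" using n by (simp_all only: Re_i_times Im_i_times mult.assoc Re_complex_of_real Im_complex_of_real times_complex.simps complex_Re_numeral complex_Im_numeral; simp)+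
  then have "?u = of_int n" by (simp add: complex_eq_iff)
  then show ?thesis by simp
qed

text \<open>The logarithms at end points assemble to a linear function of the boundary chain and so
  vanish on cycles. The argument passed to \<open>\<tau>\<close> is the only point of the standard
  0-simplex.\<close>

lemma wind_cycle_integer:
  assumes c: "singular_chain 1 X c" "chain_boundary 1 c = 0"
    and f: "continuous_map X euclidean f" "\<And>x. x \<in> topspace X \<Longrightarrow> f x \<noteq> 0"
  shows "wind f c \<in> \<int>"
proof -
  let ?l = "lin (\<lambda>\<tau>. Ln (f (\<tau> (\<lambda>j. if j = 0 then 1 else 0))) / (2 * pi * \<i>))"
  have "wind f c - ?l (chain_boundary 1 c) \<in> \<int>"
    using c(1) unfolding singular_chain_def
  proof (induction c rule: frag_induction)
    case (one \<sigma>)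
    then show ?case using wind_simplex_Ln[OF _ f, of \<sigma>]
      by (simp add: chain_boundary_1 lin_diff diff_divide_distrib del: One_nat_def)
  next
    case (diff a b)
    then show ?case using Ints_diff[OF diff(1,2)]
      by (simp add: wind_additive chain_boundary_diff lin_diff algebra_simps)
  qed (simp add: wind_additive)
  then show ?thesis using c(2) by simp
qed

lemma winding_circle:
  assumes "0 < r"
  shows "dist z w < r \<Longrightarrow> winding_number (\<lambda>t. z + of_real r * cis (2 * pi * t) - w) 0 = 1"
    and "dist z w < r \<Longrightarrow> winding_number (\<lambda>t. z + of_real r * cis (- 2 * pi * t) - w) 0 = - 1"
    and "dist z w > r \<Longrightarrow> winding_number (\<lambda>t. z + of_real r * cis (- 2 * pi * t) - w) 0 = 0"
proof -
  have c: "circlepath z r = (\<lambda>t. z + of_real r * cis (2 * pi * t))"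
    by (auto simp: circlepath fun_eq_iff cis_conv_exp mult_ac)
  have rc: "reversepath (circlepath z r) = (\<lambda>t. z + of_real r * cis (- 2 * pi * t))"
  proof
    fix t :: real
    have "cis (2 * pi * (1 - t)) = cis (2 * pi) * cis (- (2 * pi * t))" by (simp add: cis_mult algebra_simps)
    then show "reversepath (circlepath z r) t = z + of_real r * cis (- 2 * pi * t)"
      by (simp add: c reversepath_def)
  qed
  show 1: "dist z w < r \<Longrightarrow> winding_number (\<lambda>t. z + of_real r * cis (2 * pi * t) - w) 0 = 1"
    using winding_number_circlepath[of w z r] winding_number_offset[of "circlepath z r" w]
    by (simp add: c dist_norm norm_minus_commute)
  show "winding_number (\<lambda>t. z + of_real r * cis (- 2 * pi * t) - w) 0 = - 1" if d: "dist z w < r"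
  proof -
    have "w \<notin> path_image (circlepath z r)" using d assms by (simp add: path_image_circlepath)
    then have "winding_number (reversepath (circlepath z r)) w = - 1"
      using winding_number_circlepath[of w z r] d by (simp add: winding_number_reversepath dist_norm norm_minus_commute)
    then show ?thesis using winding_number_offset[of "reversepath (circlepath z r)" w] unfolding rc by simp
  qed
  show "winding_number (\<lambda>t. z + of_real r * cis (- 2 * pi * t) - w) 0 = 0" if d: "dist z w > r"
  proof -
    have "winding_number (reversepath (circlepath z r)) w = 0"
      by (rule winding_number_zero_outside[of _ "cball z r"]) (use d assms in \<open>auto simp: path_image_circlepath\<close>)
    then show ?thesis using winding_number_offset[of "reversepath (circlepath z r)" w] unfolding rc by simp
  qed
qed

lemma pathin_top_of_set: "pathin (top_of_set Y) g \<longleftrightarrow> path g \<and> path_image g \<subseteq> Y"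
  by (auto simp: pathin_def path_def path_image_def)

lemma wind_class_mult:
  assumes "finite S" "continuous_map X euclidean (k :: 'a \<Rightarrow> complex)" "inj_on k (topspace X)"
    and f: "continuous_map X euclidean f" "\<And>x. x \<in> topspace X \<Longrightarrow> f x \<noteq> 0"
    and xy: "x \<in> carrier (relative_homology_group 1 X S)" "y \<in> carrier (relative_homology_group 1 X S)"
  shows "wind_class f (x \<otimes>\<^bsub>relative_homology_group 1 X S\<^esub> y) = wind_class f x + wind_class f y"
proof -
  obtain c d where c: "singular_relcycle 1 X S c" "x = homologous_rel_set 1 X S c"
    and d: "singular_relcycle 1 X S d" "y = homologous_rel_set 1 X S d"
    using homology_class_exists[OF xy(1)] homology_class_exists[OF xy(2)] by metis
  show ?thesis unfolding c d using homology_class_mult[OF c(1) d(1)]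
    by (simp add: wind_class_eq[OF assms(1-3) f] wind_additive del: One_nat_def)
qed

section \<open>The first homology of a planar domain\<close>

lemma additive_int_pow:
  fixes f :: "'g \<Rightarrow> complex"
  assumes "group G" and f: "\<And>x y. x \<in> carrier G \<Longrightarrow> y \<in> carrier G \<Longrightarrow> f (x \<otimes>\<^bsub>G\<^esub> y) = f x + f y" and x: "x \<in> carrier G"
  shows "f (x [^]\<^bsub>G\<^esub> (n :: int)) = of_int n * f x"
proof -
  interpret group G by fact
  have 1: "f \<one>\<^bsub>G\<^esub> = 0" using f[of "\<one>\<^bsub>G\<^esub>" "\<one>\<^bsub>G\<^esub>"] by simp
  have nat: "f (x [^]\<^bsub>G\<^esub> (m :: nat)) = of_nat m * f x" for m
    by (induction m) (use x in \<open>simp_all add: 1 f distrib_right\<close>)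
  have inv: "f (inv\<^bsub>G\<^esub> y) = - f y" if "y \<in> carrier G" for y
    using f[of "inv\<^bsub>G\<^esub> y" y] that by (simp add: 1 eq_neg_iff_add_eq_0)
  show ?thesis
    by (cases n rule: int_cases2) (use x in \<open>simp_all add: int_pow_int int_pow_neg_int nat inv\<close>)
qed

text \<open>The annulus contains its inner circle and retracts radially onto it. This gives the
  isomorphism type only; a generator is recognised afterwards by its winding number.\<close>

lemma annulus_H1:
  fixes z :: complex
  assumes r: "0 < r" "r < \<rho>"
  defines "A \<equiv> ball z \<rho> - ball z r"
  shows "homology_group 1 (top_of_set A) \<cong> integer_group"
proof -
  let ?N = "subtopology (powertop_real UNIV) {x. (\<Sum>i\<le>1. x i ^ 2) = 1 \<and> (\<forall>i>1. x i = 0)}"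
  define F :: "complex \<Rightarrow> nat \<Rightarrow> real" where
    "F x = (\<lambda>i. if i = 0 then Re ((x - z) / norm (x - z)) else if i = 1 then Im ((x - z) / norm (x - z)) else 0)" for x
  define G :: "(nat \<Rightarrow> real) \<Rightarrow> complex" where "G y = z + of_real r * Complex (y 0) (y 1)" for y
  have A: "x \<in> A \<longleftrightarrow> r \<le> norm (x - z) \<and> norm (x - z) < \<rho>" for x
    by (auto simp: A_def dist_norm norm_minus_commute)
  have F: "continuous_map (top_of_set A) ?N F"
    unfolding continuous_map_in_subtopology continuous_map_componentwise_UNIV
  proof (intro conjI allI image_subsetI)
    fix i
    show "continuous_map (top_of_set A) euclideanreal (\<lambda>x. F x i)"
      by (cases "i = 0"; cases "i = 1") (use r in \<open>auto simp: F_def A intro!: continuous_intros\<close>)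
  next
    show "F \<in> topspace (top_of_set A) \<rightarrow> {x. (\<Sum>i\<le>1. x i ^ 2) = 1 \<and> (\<forall>i>1. x i = 0)}"
    proof
      fix x assume "x \<in> topspace (top_of_set A)"
      then have "x \<noteq> z" using A[of x] r by auto
      then have "norm (x - z) \<noteq> 0" "(Re (x - z))\<^sup>2 + (Im (x - z))\<^sup>2 = (norm (x - z))\<^sup>2" by (simp_all add: cmod_power2)
      then have "(Re (x - z) / norm (x - z))\<^sup>2 + (Im (x - z) / norm (x - z))\<^sup>2 = 1"
        by (simp add: power_divide flip: add_divide_distrib)
      then show "F x \<in> {x. (\<Sum>i\<le>1. x i ^ 2) = 1 \<and> (\<forall>i>1. x i = 0)}"
        by (auto simp: F_def)
    qed
  qed
  have Gn: "norm (G y - z) = r" if "(\<Sum>i\<le>1. y i ^ 2) = 1" for y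
  proof -
    have "norm (Complex (y 0) (y 1)) = 1" using that by (simp add: cmod_def)
    then show ?thesis using r by (simp only: G_def add_diff_cancel_left' norm_mult) simp
  qed
  have G: "continuous_map ?N (top_of_set A) G"
  proof -
    have of: "continuous_map ?N euclidean (\<lambda>y. f (y i))" if "continuous_on UNIV f" for f :: "real \<Rightarrow> complex" and i
    proof -
      have "continuous_map ?N euclideanreal (\<lambda>y. y i)"
        by (intro continuous_map_from_subtopology continuous_map_product_projection) simp
      from continuous_map_compose[OF this, of euclidean f] that show ?thesis by (simp add: o_def)
    qed
    have "continuous_map ?N euclidean (\<lambda>y. (z + of_real (r * y 0)) + \<i> * of_real (r * y 1))"
      by (intro continuous_map_add of[of "\<lambda>t. z + of_real (r * t)"] of[of "\<lambda>t. \<i> * of_real (r * t)"]) (intro continuous_intros)+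
    then have "continuous_map ?N euclidean (\<lambda>y. z + of_real r * (of_real (y 0) + \<i> * of_real (y 1)))"
      by (simp add: algebra_simps)
    moreover have "G = (\<lambda>y. z + of_real r * (of_real (y 0) + \<i> * of_real (y 1)))"
      by (auto simp: G_def Complex_eq fun_eq_iff)
    ultimately have Gc: "continuous_map ?N euclidean G" by (simp only:)
    moreover have "G y \<in> A" if "y \<in> topspace ?N" for y
    proof -
      have "(\<Sum>i\<le>1. y i ^ 2) = 1" using that by simp
      from Gn[OF this] show ?thesis using A r by simp
    qed
    ultimately show ?thesis unfolding continuous_map_in_subtopology by blast
  qed
  have FG: "F (G y) = y" if "y \<in> topspace ?N" for y
  proof -
    have y: "(\<Sum>i\<le>1. y i ^ 2) = 1" "\<And>i. i > 1 \<Longrightarrow> y i = 0" using that by auto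
    have "(G y - z) / norm (G y - z) = Complex (y 0) (y 1)" unfolding Gn[OF y(1)] using r by (simp add: G_def)
    then show ?thesis using y(2) by (auto simp: F_def fun_eq_iff)
  qed
  \<comment> \<open>The segment from x to its projection is radial, and the distance from z stays
    between r and its value at x.\<close>
  have GF: "homotopic_with_canon (\<lambda>_. True) A A (G \<circ> F) id"
  proof (rule homotopic_with_linear)
    show "continuous_on A (G \<circ> F)"
      using continuous_map_compose[OF F G] by (simp add: continuous_map_in_subtopology)
    fix x assume x: "x \<in> A"
    define d where "d = norm (x - z)"
    have d: "r \<le> d" "d < \<rho>" "0 < d" using x A r by (auto simp: d_def)
    have gf: "G (F x) = z + of_real (r / d) * (x - z)"
      by (simp add: G_def F_def d_def complex_eq_iff)
    show "closed_segment ((G \<circ> F) x) (id x) \<subseteq> A"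
    proof
      fix w assume "w \<in> closed_segment ((G \<circ> F) x) (id x)"
      then obtain u where u: "0 \<le> u" "u \<le> 1" "w = (1 - u) *\<^sub>R (G (F x)) + u *\<^sub>R x"
        by (auto simp: closed_segment_def)
      have "w - z = of_real ((1 - u) * (r / d) + u) * (x - z)"
        unfolding u(3) gf by (simp add: scaleR_conv_of_real algebra_simps)
      then have "norm (w - z) = \<bar>(1 - u) * (r / d) + u\<bar> * d"
        by (simp only: norm_mult norm_of_real d_def)
      also have "\<bar>(1 - u) * (r / d) + u\<bar> = (1 - u) * (r / d) + u" using u d r by simp
      also have "((1 - u) * (r / d) + u) * d = (1 - u) * r + u * d" using d by (simp add: field_simps)
      finally have n: "norm (w - z) = (1 - u) * r + u * d" .
      have "(1 - u) * r + u * d \<ge> (1 - u) * r + u * r" "(1 - u) * r + u * d \<le> (1 - u) * d + u * d"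
        using u d by (auto intro!: add_mono mult_left_mono)
      then show "w \<in> A" using d unfolding A n by (simp add: algebra_simps)
    qed
  qed simp
  have FG': "homotopic_with (\<lambda>_. True) ?N ?N (F \<circ> G) id"
    by (rule homotopic_with_equal[OF _ _ continuous_map_compose[OF G F]]) (simp_all only: FG o_apply id_apply)
  have "top_of_set A homotopy_equivalent_space nsphere 1"
    unfolding homotopy_equivalent_space_def nsphere
    by (intro exI[of _ F] exI[of _ G] conjI F G GF FG')
  then have "homology_group 1 (top_of_set A) \<cong> homology_group 1 (nsphere 1)"
    by (rule homotopy_equivalent_space_imp_isomorphic_homology_groups)
  also have "homology_group 1 (nsphere 1) \<cong> integer_group"
    using reduced_homology_group_nsphere(1)[of 1] un_reduced_homology_group[of 1 "nsphere 1"] by simp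
  finally show ?thesis .
qed

text \<open>Winding around z is an integer-valued homomorphism, hence a multiple of any isomorphism
  h to the integers. Its value -1 at c forces \<open>h c\<close> to be a unit.\<close>

lemma annulus_H1_generator:
  fixes z :: complex
  assumes r: "0 < r" "r < \<rho>"
  defines "A \<equiv> ball z \<rho> - ball z r"
  defines "c \<equiv> path_class (top_of_set A) {} (\<lambda>t. z + of_real r * cis (- 2 * pi * t))"
  assumes x: "x \<in> carrier (homology_group 1 (top_of_set A))"
  shows "c \<in> carrier (homology_group 1 (top_of_set A))" "\<exists>n::int. x = c [^]\<^bsub>homology_group 1 (top_of_set A)\<^esub> n"
proof -
  let ?H = "homology_group 1 (top_of_set A)" and ?g = "\<lambda>t. z + of_real r * cis (- 2 * pi * t)"
  interpret comm_group ?H by simp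
  have pg: "pathin (top_of_set A) ?g"
    unfolding pathin_top_of_set using r
    by (auto simp: path_def path_image_def A_def dist_norm norm_mult intro!: continuous_intros)
  have rc: "singular_relcycle 1 (top_of_set A) {} (frag_of (path_simplex ?g))"
    by (rule relcycle_path[OF pg]) (simp add: complex_eq_iff)
  show c: "c \<in> carrier ?H"
    unfolding c_def path_class_def by (rule homology_class_closed[OF rc])
  let ?f = "\<lambda>x. x - z" and ?W = "wind_class (\<lambda>x. x - z)"
  have f: "continuous_map (top_of_set A) euclidean ?f" "\<And>x. x \<in> topspace (top_of_set A) \<Longrightarrow> ?f x \<noteq> 0"
    using r by (auto simp: A_def intro!: continuous_intros)
  have k: "continuous_map (top_of_set A) euclidean id" "inj_on id (topspace (top_of_set A))"
    by (simp_all)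
  have Wc': "?W c = winding_number (?f \<circ> ?g) 0"
    unfolding c_def path_class_def wind_path[symmetric] by (rule wind_class_eq[OF finite.emptyI k f])
  have Wc: "?W c = - 1"
    unfolding Wc' o_def using winding_circle(2)[OF r(1), of z z] r by simp
  have Wint: "?W y \<in> \<int>" if y: "y \<in> carrier ?H" for y
  proof -
    obtain d where d: "singular_relcycle 1 (top_of_set A) {} d" "y = homologous_rel_set 1 (top_of_set A) {} d"
      using homology_class_exists[OF y] .
    have "?W y = wind ?f d" unfolding d(2) by (rule wind_class_eq[OF finite.emptyI k f])
    then show ?thesis using d(1) wind_cycle_integer[OF _ _ f, of d] by (simp add: singular_cycle)
  qed
  note Wm = wind_class_mult[OF finite.emptyI k f]
  obtain h where h: "h \<in> iso ?H integer_group" using annulus_H1[OF r, of z] unfolding A_def is_iso_def by blast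
  then have hm: "h (a \<otimes>\<^bsub>?H\<^esub> b) = h a + h b" if "a \<in> carrier ?H" "b \<in> carrier ?H" for a b
    using that by (auto simp: iso_def hom_def)
  have hb: "bij_betw h (carrier ?H) UNIV" using h by (auto simp: iso_def)
  have hp: "h (a [^]\<^bsub>?H\<^esub> n) = n * h a" if "a \<in> carrier ?H" for a and n :: int
  proof -
    have "(complex_of_int \<circ> h) (a [^]\<^bsub>?H\<^esub> n) = of_int n * (complex_of_int \<circ> h) a"
      by (rule additive_int_pow) (use that hm in auto)
    then show ?thesis by (simp flip: of_int_mult)
  qed
  obtain g where g: "g \<in> carrier ?H" "h g = 1" using hb by (metis UNIV_I bij_betw_def imageE)
  have xg: "y = g [^]\<^bsub>?H\<^esub> h y" if "y \<in> carrier ?H" for y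
    using hb that g hp[OF g(1), of "h y"] by (auto simp: bij_betw_def inj_on_def)
  obtain m where m: "?W g = of_int m" using Wint[OF g(1)] by (auto elim: Ints_cases)
  have "?W c = of_int (h c) * ?W g"
    using additive_int_pow[of ?H ?W g "h c", OF group_axioms Wm g(1)] xg[OF c] by simp
  then have "(of_int (h c * m) :: complex) = of_int (- 1)" using Wc m by simp
  then have "h c * m = - 1" by (simp only: of_int_eq_iff)
  then have hc: "h c * h c = 1"
    by (metis minus_mult_left mult_minus_right pos_zmult_eq_1_iff_lemma zmult_eq_1_iff mult.left_neutral minus_equation_iff)
  \<comment> \<open>As \<open>h c\<close> is its own inverse, \<open>h x * h c\<close> is the
    exponent with which c yields x.\<close>
  have "h (c [^]\<^bsub>?H\<^esub> (h x * h c)) = h x" using hp[OF c, of "h x * h c"] hc by (simp add: mult.assoc)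
  then have "x = c [^]\<^bsub>?H\<^esub> (h x * h c)"
    using hb x c by (auto simp: bij_betw_def inj_on_def)
  then show "\<exists>n::int. x = c [^]\<^bsub>?H\<^esub> n" by blast
qed

lemma hom_induced_path_class:
  assumes f: "continuous_map X Y f" "f \<in> S \<rightarrow> T" and g: "pathin X g" "g 0 = g 1 \<or> {g 0, g 1} \<subseteq> S"
  shows "hom_induced 1 X S Y T f (path_class X S g) = path_class Y T (f \<circ> g)"
proof -
  have "hom_induced (int 1) X S Y T f (homologous_rel_set 1 X S (frag_of (path_simplex g)))
     = homologous_rel_set 1 Y T (chain_map 1 f (frag_of (path_simplex g)))"
    by (rule hom_induced_chain_map[OF f relcycle_path[OF g]])
  moreover have "simplex_map 1 f (path_simplex g) = path_simplex (f \<circ> g)"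
    by (auto simp: simplex_map_def fun_eq_iff)
  ultimately show ?thesis by (simp add: path_class_def del: One_nat_def)
qed

lemma path_class_closed:
  "pathin X g \<Longrightarrow> g 0 = g 1 \<or> {g 0, g 1} \<subseteq> S \<Longrightarrow> path_class X S g \<in> carrier (relative_homology_group 1 X S)"
  unfolding path_class_def by (rule homology_class_closed[OF relcycle_path])

section \<open>Generators for a disc with holes\<close>

lemma (in comm_group) finprod_generate:
  assumes "\<And>i. i \<in> I \<Longrightarrow> f i \<in> generate G K" "K \<subseteq> carrier G"
  shows "finprod G f I \<in> generate G K"
proof -
  interpret S: subgroup "generate G K" G using generate_is_subgroup[OF assms(2)] .
  show ?thesis using assms(1)
  proof (induction I rule: infinite_finite_induct)
    case (insert x F)
    then show ?case by (subst finprod_insert) auto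
  qed auto
qed

lemma disjoint_cball_dist:
  fixes z w :: complex
  assumes "cball z r \<inter> cball w s = {}" "0 < r" "0 < s"
  shows "r + s < dist z w"
proof (rule ccontr)
  assume "\<not> r + s < dist z w"
  then have d: "dist z w \<le> r + s" by simp
  \<comment> \<open>This point divides the segment between the centres in the ratio
    \<open>r : s\<close>; if the centres were too close, it would lie in both discs.\<close>
  let ?x = "z + of_real (r / (r + s)) * (w - z)"
  have "?x - z = of_real (r / (r + s)) * (w - z)" by simp
  then have "dist z ?x = r / (r + s) * dist z w"
    using assms by (simp only: dist_norm norm_minus_commute[of z] norm_mult norm_of_real) simp
  also have "\<dots> \<le> r / (r + s) * (r + s)" using d assms by (intro mult_left_mono) auto
  finally have 1: "dist z ?x \<le> r" using assms by simp
  have "s / (r + s) = 1 - r / (r + s)" using assms by (simp add: field_simps)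
  then have "w - ?x = of_real (s / (r + s)) * (w - z)" by (simp only: of_real_diff of_real_1) (simp add: algebra_simps)
  then have "dist w ?x = s / (r + s) * dist z w"
    using assms by (simp only: dist_norm norm_mult norm_of_real) (simp add: norm_minus_commute)
  also have "\<dots> \<le> s / (r + s) * (r + s)" using d assms by (intro mult_left_mono) auto
  finally have "dist w ?x \<le> s" using assms by simp
  with 1 assms(1) show False by auto
qed

text \<open>Excision asks for a margin around the holes. Finitely many strict inequalities leave
  room for one common enlargement of the radii.\<close>

lemma enlarge_discs:
  fixes z :: "nat \<Rightarrow> complex" and r :: "nat \<Rightarrow> real"
  assumes "\<And>i. i \<in> I \<Longrightarrow> 0 < r i \<and> cball (z i) (r i) \<subseteq> ball z0 r0" "finite I"
    and "\<And>i j. i \<in> I \<Longrightarrow> j \<in> I \<Longrightarrow> i \<noteq> j \<Longrightarrow> cball (z i) (r i) \<inter> cball (z j) (r j) = {}"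
  obtains \<rho> where "\<And>i. i \<in> I \<Longrightarrow> r i < \<rho> i \<and> ball (z i) (\<rho> i) \<subseteq> ball z0 r0"
    "\<And>i j. i \<in> I \<Longrightarrow> j \<in> I \<Longrightarrow> i \<noteq> j \<Longrightarrow> ball (z i) (\<rho> i) \<inter> ball (z j) (\<rho> j) = {}"
proof -
  have pos: "\<forall>\<^sub>F \<epsilon> in at_right 0. 0 < (\<epsilon> :: real)" by (simp add: eventually_at_right_less)
  have small: "\<forall>\<^sub>F \<epsilon> in at_right 0. (\<epsilon> :: real) < d" if "0 < d" for d
    using that by (auto simp: eventually_at_right_field intro!: exI[of _ d])
  have 1: "\<forall>\<^sub>F \<epsilon> in at_right 0. \<forall>i\<in>I. (\<epsilon> :: real) < r0 - r i - dist (z i) z0"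
    using assms(1) by (intro eventually_ball_finite \<open>finite I\<close> ballI small) (fastforce simp: cball_subset_ball_iff)
  have 2: "\<forall>\<^sub>F \<epsilon> in at_right 0. \<forall>i\<in>I. \<forall>j\<in>I. i \<noteq> j \<longrightarrow> (\<epsilon> :: real) < (dist (z i) (z j) - r i - r j) / 2"
  proof (intro eventually_ball_finite \<open>finite I\<close> ballI)
    fix i j assume ij: "i \<in> I" "j \<in> I"
    show "\<forall>\<^sub>F \<epsilon> in at_right 0. i \<noteq> j \<longrightarrow> (\<epsilon> :: real) < (dist (z i) (z j) - r i - r j) / 2"
    proof (cases "i = j")
      case False
      then have "r i + r j < dist (z i) (z j)" using disjoint_cball_dist assms ij by metis
      then have "\<forall>\<^sub>F \<epsilon> in at_right 0. (\<epsilon> :: real) < (dist (z i) (z j) - r i - r j) / 2" by (intro small) simp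
      then show ?thesis by eventually_elim simp
    qed simp
  qed
  obtain \<epsilon> :: real where e: "0 < \<epsilon>" "\<forall>i\<in>I. \<epsilon> < r0 - r i - dist (z i) z0"
     "\<forall>i\<in>I. \<forall>j\<in>I. i \<noteq> j \<longrightarrow> \<epsilon> < (dist (z i) (z j) - r i - r j) / 2"
    using eventually_happens'[OF _ eventually_conj[OF pos eventually_conj[OF 1 2]]] trivial_limit_at_right_real by auto
  show ?thesis
  proof (rule that[of "\<lambda>i. r i + \<epsilon>"])
    show "r i < r i + \<epsilon> \<and> ball (z i) (r i + \<epsilon>) \<subseteq> ball z0 r0" if "i \<in> I" for i
      using e that by (auto simp: ball_subset_ball_iff)
    show "ball (z i) (r i + \<epsilon>) \<inter> ball (z j) (r j + \<epsilon>) = {}" if "i \<in> I" "j \<in> I" "i \<noteq> j" for i j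
      using e(3) that by (intro disjoint_ballI) (fastforce simp: field_simps)
  qed
qed

text \<open>
  The outer disc is contractible, so every class bounds relative to \<open>Y\<close>. By excision the
  bounding chain can be taken in a union of disjoint discs around the holes, so its
  boundary lies in a disjoint union of annuli.
\<close>

lemma planar_H1_generated:
  fixes z :: "nat \<Rightarrow> complex" and r :: "nat \<Rightarrow> real"
  assumes zr: "\<And>i. i \<in> I \<Longrightarrow> 0 < r i \<and> cball (z i) (r i) \<subseteq> ball z0 r0" and I: "finite I"
    and dis: "\<And>i j. i \<in> I \<Longrightarrow> j \<in> I \<Longrightarrow> i \<noteq> j \<Longrightarrow> cball (z i) (r i) \<inter> cball (z j) (r j) = {}"
  defines "Y \<equiv> cball z0 r0 - (\<Union>i\<in>I. ball (z i) (r i))"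
  defines "c \<equiv> \<lambda>i t. z i + of_real (r i) * cis (- 2 * pi * t)"
  assumes x: "x \<in> carrier (homology_group 1 (top_of_set Y))"
  shows "x \<in> generate (homology_group 1 (top_of_set Y)) ((\<lambda>i. path_class (top_of_set Y) {} (c i)) ` I)"
proof -
  obtain \<rho> where \<rho>: "\<And>i. i \<in> I \<Longrightarrow> r i < \<rho> i" "\<And>i. i \<in> I \<Longrightarrow> ball (z i) (\<rho> i) \<subseteq> ball z0 r0"
    "\<And>i j. i \<in> I \<Longrightarrow> j \<in> I \<Longrightarrow> i \<noteq> j \<Longrightarrow> ball (z i) (\<rho> i) \<inter> ball (z j) (\<rho> j) = {}"
    using enlarge_discs[of I r z z0 r0] zr I dis by metis
  define D where "D = cball z0 r0"
  define N where "N = (\<Union>i\<in>I. ball (z i) (\<rho> i))"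
  define V where "V i = ball (z i) (\<rho> i) - ball (z i) (r i)" for i
  define A where "A = (\<Union>i\<in>I. V i)"
  have bd: "ball z0 r0 \<subseteq> D" by (auto simp: D_def)
  have YD: "Y \<subseteq> D" by (auto simp: Y_def D_def)
  have ND: "N \<subseteq> D" using \<rho>(2) bd by (auto simp: N_def)
  have NY: "N \<inter> Y = A"
  proof
    show "N \<inter> Y \<subseteq> A" by (auto simp: N_def Y_def A_def V_def)
    show "A \<subseteq> N \<inter> Y"
    proof
      fix w assume "w \<in> A"
      then obtain i where i: "i \<in> I" "w \<in> ball (z i) (\<rho> i)" "w \<notin> ball (z i) (r i)" by (auto simp: A_def V_def)
      have "w \<notin> ball (z j) (r j)" if "j \<in> I" for j
      proof (cases "j = i")
        case False
        then show ?thesis using \<rho>(3)[of i j] i that \<rho>(1)[of j] by force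
      qed (use i in simp)
      then show "w \<in> N \<inter> Y" using i \<rho>(2)[OF i(1)] bd by (auto simp: N_def Y_def D_def)
    qed
  qed
  have AY: "A \<subseteq> Y" "A \<subseteq> N" using NY by auto
  let ?TD = "top_of_set D"
  let ?HY = "homology_group 1 (top_of_set Y)"
  interpret comm_group ?HY by simp
  have sub: "subtopology ?TD Y = top_of_set Y" "subtopology ?TD N = top_of_set N" "subtopology ?TD D = ?TD"
     "subtopology (top_of_set N) A = top_of_set A"
    using YD ND AY by (simp_all add: subtopology_subtopology inf.absorb2 inf.absorb_iff2[symmetric])
  have "contractible_space ?TD" by (simp add: D_def convex_imp_contractible)
  then have "trivial_group (homology_group 1 ?TD)"
    using trivial_reduced_homology_group_contractible_space[of ?TD 1] un_reduced_homology_group[of 1 ?TD] by simp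
  then have "hom_induced 1 (top_of_set Y) {} ?TD {} id x = \<one>\<^bsub>homology_group 1 ?TD\<^esub>"
    using hom_induced_carrier[of 1 "top_of_set Y" "{}" ?TD "{}" id x] by (auto simp: trivial_group_def)
  then have "x \<in> kernel ?HY (homology_group 1 ?TD) (hom_induced 1 (top_of_set Y) {} ?TD {} id)"
    using x by (simp add: kernel_def)
  also have "\<dots> = hom_boundary 2 ?TD Y ` carrier (relative_homology_group 2 ?TD Y)"
    using homology_exactness_axiom_2[of 2 ?TD Y] by (simp add: sub)
  finally obtain y where y: "x = hom_boundary 2 ?TD Y y" "y \<in> carrier (relative_homology_group 2 ?TD Y)" by auto
  have "hom_induced 2 (subtopology ?TD (D - (D - N))) (Y - (D - N)) (subtopology ?TD D) Y id
     \<in> iso (relative_homology_group 2 (subtopology ?TD (D - (D - N))) (Y - (D - N))) (relative_homology_group 2 (subtopology ?TD D) Y)"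
  proof (rule homology_excision_axiom)
    have "D \<inter> N = N" using ND by auto
    then have "openin ?TD N" using openin_open_Int[of N D] by (simp add: N_def open_UN)
    then have "closedin ?TD (D - N)" by (simp add: closedin_def ND double_diff)
    then have "?TD closure_of (D - N) = D - N" by (rule closure_of_closedin)
    \<comment> \<open>The excised part stays away from the closed holes and so lies in the interior
      of Y relative to D. This is where the enlarged radii enter.\<close>
    moreover have "D - N \<subseteq> ?TD interior_of Y"
    proof (rule order_trans)
      show "D - N \<subseteq> D - (\<Union>i\<in>I. cball (z i) (r i))" using \<rho>(1) by (force simp: N_def)
      have "openin ?TD (D \<inter> - (\<Union>i\<in>I. cball (z i) (r i)))"
        by (intro openin_open_Int open_Compl closed_UN I ballI closed_cball)
      then show "D - (\<Union>i\<in>I. cball (z i) (r i)) \<subseteq> ?TD interior_of Y"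
        by (intro interior_of_maximal) (use ball_subset_cball in \<open>auto simp: Y_def D_def Diff_eq dest!: less_imp_le\<close>)
    qed
    ultimately show "?TD closure_of (D - N) \<subseteq> ?TD interior_of Y" by simp
  qed (use YD in auto)
  moreover have "D - (D - N) = N" "Y - (D - N) = A" using ND NY YD by auto
  ultimately have "hom_induced 2 (top_of_set N) A ?TD Y id
     \<in> iso (relative_homology_group 2 (top_of_set N) A) (relative_homology_group 2 ?TD Y)"
    by (simp add: sub)
  then obtain y' where y': "y = hom_induced 2 (top_of_set N) A ?TD Y id y'" "y' \<in> carrier (relative_homology_group 2 (top_of_set N) A)"
    using y(2) by (auto simp: iso_def bij_betw_def)
  have "id \<in> N \<rightarrow> D" "id \<in> A \<rightarrow> Y" using ND AY by auto
  \<comment> \<open>Naturality lets the boundary be taken inside the enlarged discs, which gives a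
    class on the annuli that maps to x.\<close>
  then have nat: "hom_boundary 2 ?TD Y \<circ> hom_induced 2 (top_of_set N) A ?TD Y id
     = hom_induced 1 (top_of_set A) {} (top_of_set Y) {} id \<circ> hom_boundary 2 (top_of_set N) A"
    using naturality_hom_induced[of "top_of_set N" ?TD id A Y 2] ND AY by (simp add: sub)
  define x' where "x' = hom_boundary 2 (top_of_set N) A y'"
  have xx': "x = hom_induced 1 (top_of_set A) {} (top_of_set Y) {} id x'"
    using y(1) y'(1) fun_cong[OF nat, of y'] by (simp add: x'_def)
  have x': "x' \<in> carrier (homology_group 1 (top_of_set A))"
    using hom_boundary_carrier[of 2 "top_of_set N" A y'] by (simp add: x'_def sub)
  let ?HA = "homology_group 1 (top_of_set A)"
  let ?K = "(\<lambda>i. path_class (top_of_set Y) {} (c i)) ` I"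
  let ?KA = "(\<lambda>i. path_class (top_of_set A) {} (c i)) ` I"
  have rV: "r i > 0" "V i \<subseteq> A" if "i \<in> I" for i using that zr by (auto simp: A_def)
  have pc: "pathin (top_of_set (V i)) (c i)" "c i 0 = c i 1" if "i \<in> I" for i
    unfolding pathin_top_of_set using rV[OF that] \<rho>(1)[OF that]
    by (auto simp: path_def path_image_def V_def c_def dist_norm norm_mult complex_eq_iff intro!: continuous_intros)
  have pcA: "pathin (top_of_set A) (c i)" if "i \<in> I" for i
    using pc(1)[OF that] rV[OF that] by (auto simp: pathin_top_of_set)
  have KA: "?KA \<subseteq> carrier ?HA" using path_class_closed[OF pcA] pc(2) by auto
  have "x' \<in> generate ?HA ?KA"
  proof -
    interpret A: comm_group ?HA by simp
    let ?h = "\<lambda>x. gfinprod ?HA (\<lambda>U. hom_induced 1 (subtopology (top_of_set A) U) {} (top_of_set A) {} id (x U)) (V ` I)"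
    have "?h \<in> iso (sum_group (V ` I) (\<lambda>U. homology_group 1 (subtopology (top_of_set A) U))) ?HA"
    proof (rule homology_additivity_axiom)
      show "pairwise disjnt (V ` I)"
        using \<rho>(3) by (fastforce simp: pairwise_def disjnt_def V_def)
      show "\<Union> (V ` I) = topspace (top_of_set A)" by (simp add: A_def)
      fix v assume "v \<in> V ` I"
      then obtain i where i: "i \<in> I" "v = V i" by auto
      have "V i = A \<inter> ball (z i) (\<rho> i)"
        using i \<rho>(3) by (fastforce simp: A_def V_def)
      then show "openin (top_of_set A) v" using i by (simp add: openin_open_Int)
    qed
    then obtain g where g: "g \<in> carrier (sum_group (V ` I) (\<lambda>U. homology_group 1 (subtopology (top_of_set A) U)))" "x' = ?h g"
      using x' by (auto simp: iso_def bij_betw_def)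
    have "x' = finprod ?HA (\<lambda>U. hom_induced 1 (subtopology (top_of_set A) U) {} (top_of_set A) {} id (g U)) (V ` I)"
      unfolding g(2) by (rule A.gfinprod_eq_finprod) (use I hom_induced_carrier in auto)
    also have "\<dots> \<in> generate ?HA ?KA"
    proof (rule A.finprod_generate[OF _ KA])
      fix U assume "U \<in> V ` I"
      then obtain i where i: "i \<in> I" "U = V i" by auto
      have s: "subtopology (top_of_set A) U = top_of_set (V i)"
        using rV[OF i(1)] i(2) by (simp add: subtopology_subtopology inf.absorb2)
      have "g U \<in> carrier (homology_group 1 (top_of_set (V i)))"
        using g(1) \<open>U \<in> V ` I\<close> by (auto simp: carrier_sum_group s[symmetric] PiE_def Pi_def)
      then obtain n :: int where n: "g U = path_class (top_of_set (V i)) {} (c i) [^]\<^bsub>homology_group 1 (top_of_set (V i))\<^esub> n"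
        and cl: "path_class (top_of_set (V i)) {} (c i) \<in> carrier (homology_group 1 (top_of_set (V i)))"
        using annulus_H1_generator[of "r i" "\<rho> i" "g U" "z i"] zr[OF i(1)] \<rho>(1)[OF i(1)] unfolding V_def c_def by blast
      let ?i = "hom_induced 1 (top_of_set (V i)) {} (top_of_set A) {} id"
      interpret gh: group_hom "homology_group 1 (top_of_set (V i))" ?HA ?i
        by (simp add: group_hom_def group_hom_axioms_def hom_induced_hom)
      have "id \<in> V i \<rightarrow> A" using rV[OF i(1)] by auto
      then have "?i (g U) = path_class (top_of_set A) {} (c i) [^]\<^bsub>?HA\<^esub> n"
        unfolding n using gh.hom_int_pow[OF cl, of n] hom_induced_path_class[of "top_of_set (V i)" "top_of_set A" id "{}" "{}" "c i"]
          pc[OF i(1)] rV[OF i(1)] by simp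
      moreover have "path_class (top_of_set A) {} (c i) \<in> generate ?HA ?KA" using i(1) by (intro generate.incl) auto
      ultimately show "hom_induced 1 (subtopology (top_of_set A) U) {} (top_of_set A) {} id (g U) \<in> generate ?HA ?KA"
        unfolding s using A.subgroup_int_pow_closed[OF A.generate_is_subgroup[OF KA]] by simp
    qed
    finally show ?thesis .
  qed
  then have "x \<in> hom_induced 1 (top_of_set A) {} (top_of_set Y) {} id ` generate ?HA ?KA" using xx' by blast
  also have "\<dots> = generate ?HY (hom_induced 1 (top_of_set A) {} (top_of_set Y) {} id ` ?KA)"
  proof -
    interpret gh: group_hom ?HA ?HY "hom_induced 1 (top_of_set A) {} (top_of_set Y) {} id"
      by (simp add: group_hom_def group_hom_axioms_def hom_induced_hom)
    show ?thesis using gh.generate_img[OF KA] by simp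
  qed
  also have "hom_induced 1 (top_of_set A) {} (top_of_set Y) {} id ` ?KA = ?K"
    unfolding image_image
    by (intro image_cong refl, subst hom_induced_path_class) (use pcA pc AY in auto)
  finally show ?thesis .
qed

section \<open>The first homology of the closed tuple of pants\<close>

lemma path_class_cong: "(\<And>t. t \<in> {0..1} \<Longrightarrow> f t = g t) \<Longrightarrow> path_class X S f = path_class X S g"
proof -
  assume "\<And>t. t \<in> {0..1} \<Longrightarrow> f t = g t"
  then have "path_simplex f = path_simplex g"
    using simplex_1_edge by (fastforce simp: fun_eq_iff)
  then show ?thesis by (simp only: path_class_def)
qed

text \<open>Membership in the generated subgroup is recorded for chains, because explicit
  combinations of arcs are subtracted there before passing to classes.\<close>

lemma generate_chain_closed:
  assumes K: "K \<subseteq> carrier (relative_homology_group 1 X S)"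
  defines "Q \<equiv> \<lambda>d. singular_relcycle 1 X S d \<and> homologous_rel_set 1 X S d \<in> generate (relative_homology_group 1 X S) K"
  shows "Q 0" "\<And>c d. Q c \<Longrightarrow> Q d \<Longrightarrow> Q (c - d)" "\<And>c n. Q c \<Longrightarrow> Q (frag_cmul n c)" "\<And>c d. Q c \<Longrightarrow> Q d \<Longrightarrow> Q (c + d)"
    "\<And>f I. (\<And>i. i \<in> I \<Longrightarrow> Q (f i)) \<Longrightarrow> Q (sum f I)"
proof -
  let ?H = "relative_homology_group 1 X S"
  interpret comm_group ?H by simp
  interpret S: subgroup "generate ?H K" ?H using generate_is_subgroup[OF K] .
  have "homologous_rel_set 1 X S 0 = \<one>\<^bsub>?H\<^esub>"
    using one_relative_homology_group[of 1 X S] homologous_rel_set_eq_relboundary[of 1 X S 0] by simp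
  then show 0: "Q 0" by (simp add: Q_def del: One_nat_def)
  show diff: "Q (c - d)" if "Q c" "Q d" for c d
  proof -
    have r: "singular_relcycle 1 X S (c - d)" using that by (auto simp: Q_def intro: singular_relcycle_diff)
    let ?c = "homologous_rel_set 1 X S c" and ?d = "homologous_rel_set 1 X S d" and ?cd = "homologous_rel_set 1 X S (c - d)"
    have car: "?c \<in> carrier ?H" "?d \<in> carrier ?H" "?cd \<in> carrier ?H"
      using that r by (auto simp: Q_def intro!: homology_class_closed simp del: One_nat_def)
    have "?cd \<otimes>\<^bsub>?H\<^esub> ?d = ?c"
      using homology_class_mult[OF r, of d] that by (simp add: Q_def del: One_nat_def)
    then have "?cd = ?c \<otimes>\<^bsub>?H\<^esub> inv\<^bsub>?H\<^esub> ?d" using car by (metis inv_solve_right)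
    also have "\<dots> \<in> generate ?H K" using that by (auto simp: Q_def simp del: One_nat_def)
    finally show ?thesis using r by (simp add: Q_def del: One_nat_def)
  qed
  show "Q (frag_cmul n c)" if "Q c" for c n
    by (rule frag_closure_minus_cmul[of Q, OF 0 diff that])
  show add: "Q (c + d)" if "Q c" "Q d" for c d
    using diff[OF that(1) diff[OF 0 that(2)]] by simp
  show "Q (sum f I)" if "\<And>i. i \<in> I \<Longrightarrow> Q (f i)" for f I
    using that by (induction I rule: infinite_finite_induct) (auto simp: 0 add)
qed

text \<open>\<open>W i\<close> is the winding number around the \<open>i\<close>-th hole. On the arcs it depends on their
  choice, and it need not be an integer there.\<close>

locale pants_homology_facts =
  fixes p :: nat and X :: "'a topology" and C :: "nat \<Rightarrow> real \<Rightarrow> 'a" and q :: "nat \<Rightarrow> 'a" and e :: "nat \<Rightarrow> real \<Rightarrow> 'a"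
    and W :: "nat \<Rightarrow> 'a H1_class \<Rightarrow> complex"
  fixes H and ec and bc
  defines "H \<equiv> pants_H1 p X q"
    and "ec \<equiv> \<lambda>i. path_class X (q ` {0..p}) (e i)"
    and "bc \<equiv> boundary_class p X C q"
  assumes ec_closed: "i \<in> {1..p} \<Longrightarrow> ec i \<in> carrier H" and bc_closed: "i \<le> p \<Longrightarrow> bc i \<in> carrier H"
    and generate_classes: "generate H (ec ` {1..p} \<union> bc ` {1..p}) = carrier H"
    and phi_mult: "x \<in> carrier H \<Longrightarrow> y \<in> carrier H \<Longrightarrow> pants_phi p X q i (x \<otimes>\<^bsub>H\<^esub> y) = pants_phi p X q i x + pants_phi p X q i y"
    and W_mult: "i \<in> {1..p} \<Longrightarrow> x \<in> carrier H \<Longrightarrow> y \<in> carrier H \<Longrightarrow> W i (x \<otimes>\<^bsub>H\<^esub> y) = W i x + W i y"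
    and phi_ec: "i \<le> p \<Longrightarrow> j \<in> {1..p} \<Longrightarrow> pants_phi p X q i (ec j) =
        (- 1) ^ (p - j) * ((if i = j then 1 else 0) - (if i = 0 then 1 else 0))"
    and phi_bc: "j \<le> p \<Longrightarrow> pants_phi p X q i (bc j) = 0"
    and W_bc: "i \<in> {1..p} \<Longrightarrow> j \<le> p \<Longrightarrow> W i (bc j) = (if j = 0 then 1 else if i = j then - 1 else 0)"

text \<open>Winding numbers are taken in the plane, through the inverse of the homeomorphism, around
  the centres of the holes. For generation, subtracting arcs turns a relative cycle into an absolute
  one.\<close>

lemma pants_homology:
  fixes p :: nat and X :: "'a topology" and C :: "nat \<Rightarrow> real \<Rightarrow> 'a"
    and q :: "nat \<Rightarrow> 'a" and e :: "nat \<Rightarrow> real \<Rightarrow> 'a"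
  assumes "1 \<le> p"
    and pants: "closed_pants p X C"
    and q: "\<And>i. i \<le> p \<Longrightarrow> q i \<in> C i ` {0..1}"
    and e: "\<And>i. i \<in> {1..p} \<Longrightarrow> pathin X (e i) \<and> inj_on (e i) {0..1}"
    and e_even: "\<And>i. i \<in> {1..p} \<Longrightarrow> even (p - i) \<Longrightarrow> e i 0 = q 0 \<and> e i 1 = q i"
    and e_odd: "\<And>i. i \<in> {1..p} \<Longrightarrow> odd (p - i) \<Longrightarrow> e i 0 = q i \<and> e i 1 = q 0"
  shows "\<exists>W. pants_homology_facts p X C q e W"
proof -
  define H where "H = pants_H1 p X q"
  define ec where "ec = (\<lambda>i. path_class X (q ` {0..p}) (e i))"
  define bc where "bc = boundary_class p X C q"
  obtain z r h where *: "\<forall>i \<in> {1..p}. 0 < r i \<and> cball (z i) (r i) \<subseteq> ball (z 0) (r 0)"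
      "\<forall>i \<in> {1..p}. \<forall>j \<in> {1..p}. i \<noteq> j \<longrightarrow> cball (z i) (r i) \<inter> cball (z j) (r j) = {}"
    and hom: "homeomorphic_map (top_of_set (cball (z 0) (r 0) - (\<Union>i \<in> {1..p}. ball (z i) (r i)))) X h"
    and **: "\<forall>t \<in> {0..1}. C 0 t = h (z 0 + of_real (r 0) * cis (2 * pi * t))"
      "\<forall>i \<in> {1..p}. \<forall>t \<in> {0..1}. C i t = h (z i + of_real (r i) * cis (- 2 * pi * t))"
    using pants unfolding closed_pants_def by (elim exE conjE) (rule that)
  have zr: "\<And>i. i \<in> {1..p} \<Longrightarrow> 0 < r i \<and> cball (z i) (r i) \<subseteq> ball (z 0) (r 0)"
    and dis: "\<And>i j. i \<in> {1..p} \<Longrightarrow> j \<in> {1..p} \<Longrightarrow> i \<noteq> j \<Longrightarrow> cball (z i) (r i) \<inter> cball (z j) (r j) = {}"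
    and C0: "\<And>t. t \<in> {0..1} \<Longrightarrow> C 0 t = h (z 0 + of_real (r 0) * cis (2 * pi * t))"
    and Ci: "\<And>i t. i \<in> {1..p} \<Longrightarrow> t \<in> {0..1} \<Longrightarrow> C i t = h (z i + of_real (r i) * cis (- 2 * pi * t))"
    using * ** by simp_all
  define Y where "Y = cball (z 0) (r 0) - (\<Union>i \<in> {1..p}. ball (z i) (r i))"
  let ?TY = "top_of_set Y"
  have hom: "homeomorphic_map ?TY X h" using hom by (simp add: Y_def)
  then obtain k where hk: "homeomorphic_maps ?TY X h k" unfolding homeomorphic_map_maps by blast
  have hc: "continuous_map ?TY X h" and kc: "continuous_map X ?TY k"
    and kh: "\<And>y. y \<in> Y \<Longrightarrow> k (h y) = y" and hk': "\<And>x. x \<in> topspace X \<Longrightarrow> h (k x) = x"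
    using hk by (auto simp: homeomorphic_maps_def)
  have kY: "k x \<in> Y" if "x \<in> topspace X" for x using kc that by (auto simp: continuous_map_def)
  have kcE: "continuous_map X euclidean k" using kc by (simp add: continuous_map_in_subtopology)
  have kinj: "inj_on k (topspace X)" by (metis hk' inj_onI)
  define S where "S = q ` {0..p}"
  have Sf: "finite S" by (simp add: S_def)
  have Hdef: "H = relative_homology_group 1 X S" by (simp add: H_def pants_H1_def S_def)
  interpret comm_group H by (simp add: Hdef)
  have r0: "0 < r 0"
    using zr[of 1] \<open>1 \<le> p\<close> by (auto simp: cball_subset_ball_iff) (smt (verit) zero_le_dist)
  have rpos: "0 < r i" if "i \<le> p" for i using zr[of i] r0 that by (cases "i = 0") auto
  define c where "c i t = (if i = 0 then z 0 + of_real (r 0) * cis (2 * pi * t) else z i + of_real (r i) * cis (- 2 * pi * t))" for i t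
  have Cc: "C i t = h (c i t)" if "i \<le> p" "t \<in> {0..1}" for i t
    using C0 Ci that by (cases "i = 0") (auto simp: c_def)
  have cs: "c i t \<in> sphere (z i) (r i)" if "i \<le> p" for i t
    using rpos[OF that] by (auto simp: c_def dist_norm norm_mult)
  have far: "dist (z i) (z 0) + r i < r 0" if "i \<in> {1..p}" for i
    using zr[OF that] by (auto simp: cball_subset_ball_iff)
  have sY: "sphere (z i) (r i) \<subseteq> Y" if i: "i \<le> p" for i
  proof
    fix w assume w: "w \<in> sphere (z i) (r i)"
    have "w \<in> cball (z 0) (r 0)"
    proof (cases "i = 0")
      case False
      then have "w \<in> cball (z i) (r i)" "i \<in> {1..p}" using i w by auto
      then show ?thesis using zr ball_subset_cball by blast
    qed (use w in auto)
    moreover have "w \<notin> ball (z j) (r j)" if j: "j \<in> {1..p}" for j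
    proof (cases "i = j")
      case False
      show ?thesis
      proof (cases "i = 0")
        case True
        then show ?thesis using w zr[OF j] ball_subset_cball[of "z j" "r j"] by fastforce
      next
        case i0: False
        then have "cball (z i) (r i) \<inter> cball (z j) (r j) = {}" using dis i j False by auto
        moreover have "w \<in> cball (z i) (r i)" using w by simp
        ultimately have "w \<notin> cball (z j) (r j)" by blast
        then show ?thesis by simp
      qed
    qed (use w in auto)
    ultimately show "w \<in> Y" by (auto simp: Y_def)
  qed
  have cY: "c i t \<in> Y" if "i \<le> p" for i t using cs[OF that] sY[OF that] by auto
  have sdis: "sphere (z i) (r i) \<inter> sphere (z j) (r j) = {}" if "i \<le> p" "j \<le> p" "i \<noteq> j" for i j
  proof -
    have *: "sphere (z 0) (r 0) \<inter> cball (z j) (r j) = {}" if "j \<in> {1..p}" for j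
      using zr[OF that] by force
    have **: "sphere (z i) (r i) \<subseteq> cball (z i) (r i)" for i by auto
    consider "i = 0" "j \<in> {1..p}" | "j = 0" "i \<in> {1..p}" | "i \<in> {1..p}" "j \<in> {1..p}"
      using \<open>i \<le> p\<close> \<open>j \<le> p\<close> \<open>i \<noteq> j\<close> by fastforce
    then show ?thesis
    proof cases
      case 1 then show ?thesis using *[of j] **[of j] by blast
    next
      case 2 then show ?thesis using *[of i] **[of i] by blast
    next
      case 3 then show ?thesis using dis[of i j] **[of i] **[of j] \<open>i \<noteq> j\<close> by blast
    qed
  qed
  have qs: "\<exists>w. w \<in> sphere (z i) (r i) \<and> q i = h w" if "i \<le> p" for i
    using q[OF that] cs[OF that] Cc[OF that] by auto
  have qX: "q i \<in> topspace X" if "i \<le> p" for i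
    using qs[OF that] sY[OF that] hc by (auto simp: continuous_map_def Pi_iff)
  have qinj: "q i = q j \<longleftrightarrow> i = j" if "i \<le> p" "j \<le> p" for i j
  proof
    assume eq: "q i = q j"
    obtain v w where "v \<in> sphere (z i) (r i)" "q i = h v" "w \<in> sphere (z j) (r j)" "q j = h w"
      using qs[OF \<open>i \<le> p\<close>] qs[OF \<open>j \<le> p\<close>] by blast
    moreover then have "v = w" using eq kh sY that by (metis subsetD)
    ultimately show "i = j" using sdis[OF that] by blast
  qed simp
  have pc: "pathin ?TY (c i)" "c i 0 = c i 1" if "i \<le> p" for i
  proof -
    have "path (c i)" unfolding path_def c_def by (cases "i = 0") (auto intro!: continuous_intros)
    then show "pathin ?TY (c i)" using cY[OF that] by (auto simp: pathin_top_of_set path_image_def)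
    show "c i 0 = c i 1" by (simp add: c_def complex_eq_iff)
  qed
  have bc: "bc i = path_class X S (h \<circ> c i)" if "i \<le> p" for i
    unfolding bc_def boundary_class_def S_def[symmetric] by (rule path_class_cong) (use Cc that in simp)
  have phc: "pathin X (h \<circ> c i)" "(h \<circ> c i) 0 = (h \<circ> c i) 1" if "i \<le> p" for i
    using continuous_map_compose[OF pc(1)[OF that, unfolded pathin_def] hc] pc(2)[OF that]
    by (simp_all add: pathin_def)
  have rbc: "singular_relcycle 1 X S (frag_of (path_simplex (h \<circ> c i)))" if "i \<le> p" for i
    by (rule relcycle_path[OF phc(1)]) (use phc that in auto)
  have bcH: "bc i \<in> carrier H" if "i \<le> p" for i
    unfolding bc[OF that] Hdef path_class_def by (rule homology_class_closed[OF rbc[OF that]])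
  have ee: "e i 0 = (if even (p - i) then q 0 else q i)" "e i 1 = (if even (p - i) then q i else q 0)" if "i \<in> {1..p}" for i
    using e_even[OF that] e_odd[OF that] by auto
  have eS: "{e i 0, e i 1} \<subseteq> S" if "i \<in> {1..p}" for i
    using that by (auto simp: ee[OF that] S_def)
  have rec: "singular_relcycle 1 X S (frag_of (path_simplex (e i)))" if "i \<in> {1..p}" for i
    by (rule relcycle_path) (use e[OF that] eS[OF that] in auto)
  have ecH: "ec i \<in> carrier H" if "i \<in> {1..p}" for i
    unfolding ec_def Hdef path_class_def S_def[symmetric] by (rule homology_class_closed[OF rec[OF that]])
  have phi: "pants_phi p X q i (homologous_rel_set 1 X S d) = Poly_Mapping.lookup (chain_boundary 1 d) (cpt (q i))"
    if "singular_relcycle 1 X S d" for i d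
    unfolding pants_phi_def S_def[symmetric] by (rule boundary_coeff_class[OF Sf kcE kinj that])
  let ?f = "\<lambda>i x. k x - z i"
  let ?W = "\<lambda>i. wind_class (?f i)"
  have f: "continuous_map X euclidean (?f i)" "\<And>x. x \<in> topspace X \<Longrightarrow> ?f i x \<noteq> 0" if i: "i \<in> {1..p}" for i
  proof -
    show "continuous_map X euclidean (?f i)" by (intro continuous_intros kcE)
    fix x assume "x \<in> topspace X"
    moreover have "z i \<in> ball (z i) (r i)" using i rpos[of i] by simp
    then have "z i \<notin> Y" using i unfolding Y_def by blast
    ultimately have "k x \<noteq> z i" using kY by metis
    then show "?f i x \<noteq> 0" by simp
  qed
  have phi_ec: "pants_phi p X q i (ec j) = (- 1) ^ (p - j) * ((if i = j then 1 else 0) - (if i = 0 then 1 else 0))"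
    if i: "i \<le> p" and j: "j \<in> {1..p}" for i j
  proof -
    have "pants_phi p X q i (ec j) = Poly_Mapping.lookup (frag_of (cpt (e j 1)) - frag_of (cpt (e j 0))) (cpt (q i))"
      unfolding ec_def path_class_def S_def[symmetric] phi[OF rec[OF j]] chain_boundary_path ..
    also have "\<dots> = (if q i = e j 1 then 1 else 0) - (if q i = e j 0 then 1 else 0)"
      by (simp add: lookup_minus cpt_inject)
    finally show ?thesis using i j qinj[of i j] qinj[of i 0] by (auto simp: ee[OF j])
  qed
  have phi_bc: "pants_phi p X q i (bc j) = 0" if "j \<le> p" for i j
    unfolding bc[OF that] path_class_def phi[OF rbc[OF that]] chain_boundary_path phc(2)[OF that] by simp
  have phi_mult: "pants_phi p X q i (x \<otimes>\<^bsub>H\<^esub> y) = pants_phi p X q i x + pants_phi p X q i y"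
    if "x \<in> carrier H" "y \<in> carrier H" for i x y
  proof -
    obtain a where a: "singular_relcycle 1 X S a" "x = homologous_rel_set 1 X S a"
      by (rule homology_class_exists[OF \<open>x \<in> carrier H\<close>[unfolded Hdef]])
    obtain b where b: "singular_relcycle 1 X S b" "y = homologous_rel_set 1 X S b"
      by (rule homology_class_exists[OF \<open>y \<in> carrier H\<close>[unfolded Hdef]])
    have "x \<otimes>\<^bsub>H\<^esub> y = homologous_rel_set 1 X S (a + b)"
      unfolding a b Hdef using homology_class_mult[OF a(1) b(1)] by simp
    then show ?thesis
      by (simp only: a(2) b(2) phi[OF a(1)] phi[OF b(1)] phi[OF singular_relcycle_add[OF a(1) b(1)]] chain_boundary_add lookup_add)
  qed
  have W_bc: "?W i (bc j) = (if j = 0 then 1 else if i = j then - 1 else 0)" if i: "i \<in> {1..p}" and j: "j \<le> p" for i j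
  proof -
    have "?W i (bc j) = winding_number (?f i \<circ> (h \<circ> c j)) 0"
      unfolding bc[OF j] path_class_def wind_path[symmetric] by (rule wind_class_eq[OF Sf kcE kinj f[OF i]])
    also have "\<dots> = winding_number (\<lambda>t. c j t - z i) 0"
      by (rule winding_number_cong) (simp add: kh cY[OF j])
    also have "\<dots> = (if j = 0 then 1 else if i = j then - 1 else 0)"
    proof (cases "j = 0")
      case True
      then show ?thesis using winding_circle(1)[OF r0, of "z 0" "z i"] far[OF i] rpos[of i] i
        by (simp add: c_def dist_commute)
    next
      case False
      then have j': "j \<in> {1..p}" using j by auto
      show ?thesis
      proof (cases "i = j")
        case True
        then show ?thesis using winding_circle(2)[of "r j" "z j" "z i"] rpos[OF j] False by (simp add: c_def)
      next
        case ij: False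
        have "z i \<in> cball (z i) (r i)" using rpos[of i] i by simp
        then have "z i \<notin> cball (z j) (r j)" using dis[OF i j' ij] by blast
        then show ?thesis using winding_circle(3)[of "r j" "z j" "z i"] rpos[OF j] False ij by (simp add: c_def)
      qed
    qed
    finally show ?thesis .
  qed
  have W_mult: "?W i (x \<otimes>\<^bsub>H\<^esub> y) = ?W i x + ?W i y" if "i \<in> {1..p}" "x \<in> carrier H" "y \<in> carrier H" for i x y
    using wind_class_mult[OF Sf kcE kinj f[OF that(1)]] that(2,3) unfolding Hdef by blast
  let ?K = "ec ` {1..p} \<union> bc ` {1..p}"
  have K: "?K \<subseteq> carrier H" using ecH bcH by auto
  \<comment> \<open>An absolute cycle is moved to the planar domain, expressed there by the circles
    around the holes, and sent to the relative group of X.\<close>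
  have abs: "homologous_rel_set 1 X S d \<in> generate H ?K" if d: "singular_chain 1 X d" "chain_boundary 1 d = 0" for d
  proof -
    have dc: "singular_relcycle 1 X {} d" using d by (simp add: singular_cycle)
    have dS: "singular_relcycle 1 X S d" using d by (simp add: singular_relcycle)
    have "homologous_rel_set 1 X {} d \<in> carrier (homology_group 1 X)" by (rule homology_class_closed[OF dc])
    moreover have "hom_induced 1 ?TY {} X {} h \<in> iso (homology_group 1 ?TY) (homology_group 1 X)"
      by (rule homeomorphic_map_homology_iso[OF hom])
    ultimately obtain x where x: "x \<in> carrier (homology_group 1 ?TY)" "homologous_rel_set 1 X {} d = hom_induced 1 ?TY {} X {} h x"
      by (auto simp: iso_def bij_betw_def simp del: One_nat_def)
    let ?KY = "(\<lambda>i. path_class ?TY {} (c i)) ` {1..p}"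
    have ci: "(\<lambda>t. z i + of_real (r i) * cis (- 2 * pi * t)) = c i" if "i \<in> {1..p}" for i
      using that by (auto simp: c_def fun_eq_iff)
    have "x \<in> generate (homology_group 1 ?TY) ((\<lambda>i. path_class ?TY {} (\<lambda>t. z i + of_real (r i) * cis (- 2 * pi * t))) ` {1..p})"
      unfolding Y_def by (rule planar_H1_generated[OF zr _ dis]) (use x(1) in \<open>auto simp: Y_def\<close>)
    moreover have "(\<lambda>i. path_class ?TY {} (\<lambda>t. z i + of_real (r i) * cis (- 2 * pi * t))) ` {1..p} = ?KY"
      by (rule image_cong[OF refl]) (simp only: ci)
    ultimately have xg: "x \<in> generate (homology_group 1 ?TY) ?KY" by (simp only:)
    have KY: "?KY \<subseteq> carrier (homology_group 1 ?TY)" using path_class_closed[OF pc(1)] pc(2) by auto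
    interpret gh: group_hom "homology_group 1 ?TY" H "hom_induced 1 ?TY {} X S h"
      by (simp add: group_hom_def group_hom_axioms_def Hdef hom_induced_hom)
    have "homologous_rel_set 1 X S d = hom_induced 1 X {} X S id (homologous_rel_set 1 X {} d)"
      using hom_induced_chain_map[of X X id "{}" S 1 d] dc d(1) by (simp add: chain_map_ident del: One_nat_def)
    also have "\<dots> = hom_induced 1 ?TY {} X S h x"
      unfolding x(2) using hom_induced_compose'[of ?TY X h "{}" "{}" X id S 1 x] hc by simp
    also have "\<dots> \<in> generate H (hom_induced 1 ?TY {} X S h ` ?KY)"
      using gh.generate_img[OF KY] xg by blast
    also have "hom_induced 1 ?TY {} X S h ` ?KY = bc ` {1..p}"
      unfolding image_image by (intro image_cong refl, subst hom_induced_path_class) (use pc hc bc in auto)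
    also have "generate H (bc ` {1..p}) \<subseteq> generate H ?K" by (rule mono_generate) auto
    finally show ?thesis .
  qed
  have "x \<in> generate H ?K" if "x \<in> carrier H" for x
  proof -
    obtain d where d: "singular_relcycle 1 X S d" "x = homologous_rel_set 1 X S d"
      by (rule homology_class_exists[OF \<open>x \<in> carrier H\<close>[unfolded Hdef]])
    \<comment> \<open>\<open>e i\<close> is the only arc with an end point at \<open>q i\<close>,
      its end if \<open>p - i\<close> is even and its start otherwise; the sign converts the
      boundary coefficient of d at \<open>q i\<close> into the multiple of \<open>e i\<close> to be
      subtracted.\<close>
    define n where "n i = (- 1) ^ (p - i) * Poly_Mapping.lookup (chain_boundary 1 d) (cpt (q i))" for i
    let ?E = "\<Sum>i\<in>{1..p}. frag_cmul (n i) (frag_of (path_simplex (e i)))"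
    let ?Q = "\<lambda>d. singular_relcycle 1 X S d \<and> homologous_rel_set 1 X S d \<in> generate H ?K"
    have K': "?K \<subseteq> carrier (relative_homology_group 1 X S)" using K by (simp add: Hdef)
    note Q = generate_chain_closed[OF K', folded Hdef]
    have QE: "?Q ?E"
    proof (intro Q(5) Q(3))
      fix i assume i: "i \<in> {1..p}"
      have "ec i \<in> generate H ?K" using i by (intro generate.incl) auto
      then show "?Q (frag_of (path_simplex (e i)))"
        using rec[OF i] by (simp add: ec_def path_class_def S_def[symmetric] del: One_nat_def)
    qed
    let ?b = "chain_boundary 1 (d - ?E)"
    have dE: "singular_relcycle 1 X S (d - ?E)" using d QE by (blast intro: singular_relcycle_diff)
    have look: "Poly_Mapping.lookup ?b (cpt (q i)) = 0" if i: "i \<in> {1..p}" for i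
    proof -
      have "Poly_Mapping.lookup (chain_boundary 1 ?E) (cpt (q i)) =
         (\<Sum>j\<in>{1..p}. n j * Poly_Mapping.lookup (chain_boundary 1 (frag_of (path_simplex (e j)))) (cpt (q i)))"
        by (simp add: chain_boundary_sum chain_boundary_cmul lookup_sum del: One_nat_def)
      also have "\<dots> = (\<Sum>j\<in>{1..p}. n j * pants_phi p X q i (ec j))"
        by (intro sum.cong refl) (simp add: ec_def path_class_def S_def[symmetric] phi[OF rec] del: One_nat_def)
      also have "\<dots> = (\<Sum>j\<in>{1..p}. if i = j then Poly_Mapping.lookup (chain_boundary 1 d) (cpt (q i)) else 0)"
        by (intro sum.cong refl) (use i in \<open>auto simp: phi_ec n_def simp flip: power_mult_distrib mult.assoc power_add simp del: One_nat_def\<close>)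
      also have "\<dots> = Poly_Mapping.lookup (chain_boundary 1 d) (cpt (q i))" using i by simp
      finally show ?thesis by (simp add: chain_boundary_diff lookup_minus del: One_nat_def)
    qed
    have keys: "Poly_Mapping.keys ?b \<subseteq> {cpt (q 0)}"
    proof
      fix \<tau> assume t: "\<tau> \<in> Poly_Mapping.keys ?b"
      have "singular_chain 0 (subtopology X S) ?b" using dE by (simp add: singular_relcycle)
      then have "singular_simplex 0 (subtopology X S) \<tau>" using t by (auto simp: singular_chain_def)
      then obtain s where s: "s \<in> S" "\<tau> = cpt s" using singular_simplex_finite_const[OF _ Sf kcE kinj] by blast
      then obtain i where i: "i \<le> p" "s = q i" by (auto simp: S_def)
      then show "\<tau> \<in> {cpt (q 0)}" using look[of i] t s by (cases "i = 0") (auto simp: in_keys_iff)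
    qed
    \<comment> \<open>The coefficients of the boundary of a 1-chain add up to 0. Since
      \<open>q 0\<close> is the only point where a coefficient can be left, that one vanishes
      too.\<close>
    have aug: "lin (\<lambda>_. 1 :: int) (chain_boundary 1 a) = 0" for a :: "'a chain"
      by (rule frag_induction[OF subset_UNIV, of _ a]) (auto simp: chain_boundary_1 chain_boundary_diff lin_diff simp del: One_nat_def)
    have "lin (\<lambda>_. 1 :: int) ?b = Poly_Mapping.lookup ?b (cpt (q 0))"
      using lin_superset[OF _ keys, of "\<lambda>_. 1 :: int"] by simp
    then have "Poly_Mapping.lookup ?b (cpt (q 0)) = 0" using aug by simp
    then have "cpt (q 0) \<notin> Poly_Mapping.keys ?b" by (simp add: in_keys_iff)
    then have "Poly_Mapping.keys ?b = {}" using keys by blast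
    then have b0: "?b = 0" by simp
    have "singular_chain 1 X (d - ?E)" using dE by (simp add: singular_relcycle)
    then have "?Q (d - ?E)" using abs[OF _ b0] dE by blast
    from Q(4)[OF this QE] show ?thesis using d(2) by (simp del: One_nat_def)
  qed
  then have gen: "generate H ?K = carrier H" using generate_incl[OF K] by blast
  have ec_ap: "path_class X (q ` {0..p}) (e i) = ec i" for i by (simp add: ec_def)
  have "pants_homology_facts p X C q e ?W"
    by (unfold_locales, fold H_def ec_def bc_def, unfold ec_ap) (fact ecH bcH gen phi_mult W_mult phi_ec phi_bc W_bc)+
  then show ?thesis by blast
qed

section \<open>Bimodules modelled on the exterior algebra\<close>

text \<open>In coordinates both actions are multiplications, the left one through
  \<open>\<Delta>\<close>. The axioms become ring axioms of \<open>ext\<close>, with compatibility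
  of the two sides being associativity.\<close>

lemma model_bimodule:
  assumes R: "ext_ring_model R \<rho> JR dg" and S: "ext_ring_model S \<sigma> J dg" and M: "ext_model M \<mu> J dg"
    and \<Delta>: "\<And>v w. \<Delta> (v + w) = \<Delta> v + \<Delta> w" "\<And>v w. \<Delta> (v * w) = \<Delta> v * \<Delta> w" "\<Delta> 1 = 1"
    and \<Delta>_deg: "\<And>v d. v \<in> supp_in {S \<in> Pow JR. dg S = d} \<Longrightarrow> \<Delta> v \<in> supp_in {S \<in> Pow J. dg S = d}"
    and l: "\<And>a x. a \<in> carrier R \<Longrightarrow> x \<in> carrier M \<Longrightarrow> l a x \<in> carrier M"
      "\<And>a x. a \<in> carrier R \<Longrightarrow> x \<in> carrier M \<Longrightarrow> \<mu> (l a x) = \<Delta> (\<rho> a) * \<mu> x"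
    and r: "\<And>x b. x \<in> carrier M \<Longrightarrow> b \<in> carrier S \<Longrightarrow> r x b \<in> carrier M"
      "\<And>x b. x \<in> carrier M \<Longrightarrow> b \<in> carrier S \<Longrightarrow> \<mu> (r x b) = \<mu> x * \<sigma> b"
  shows "graded_bimodule R S M l r"
proof -
  interpret R: ext_ring_model R \<rho> JR dg by (rule R)
  interpret S: ext_ring_model S \<sigma> J dg by (rule S)
  interpret M: ext_model M \<mu> J dg by (rule M)
  note closed = l(1) r(1) M.add_mem R.add_mem S.add_mem R.mult_mem S.mult_mem R.one_mem S.one_mem
  note simps = l(2) r(2) closed M.psi_add R.psi_add S.psi_add R.psi_mult S.psi_mult R.psi_one S.psi_one \<Delta>
  have dgU: "dg (A \<union> B) = d + e" if "A \<in> {A \<in> Pow J. dg A = d}" "B \<in> {A \<in> Pow J. dg A = e}" "A \<inter> B = {}" for A B d e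
    using that S.dg_Un[of A B] by auto
  have h1: "l a x \<in> hpart M (d + e)" if "a \<in> hpart R d" "x \<in> hpart M e" for d e a x
  proof -
    have ax: "a \<in> carrier R" "x \<in> carrier M" "\<rho> a \<in> supp_in {S \<in> Pow JR. dg S = d}" "\<mu> x \<in> supp_in {S \<in> Pow J. dg S = e}"
      using that unfolding R.mem_hpart_iff M.mem_hpart_iff by blast+
    have "\<Delta> (\<rho> a) * \<mu> x \<in> supp_in {S \<in> Pow J. dg S = d + e}"
      by (rule supp_in_mult[OF \<Delta>_deg[OF ax(3)] ax(4)]) (use dgU in blast)
    then show ?thesis unfolding M.mem_hpart_iff using ax l by simp
  qed
  have h2: "r x b \<in> hpart M (d + e)" if "x \<in> hpart M d" "b \<in> hpart S e" for d e x b
  proof -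
    have ax: "x \<in> carrier M" "b \<in> carrier S" "\<mu> x \<in> supp_in {S \<in> Pow J. dg S = d}" "\<sigma> b \<in> supp_in {S \<in> Pow J. dg S = e}"
      using that unfolding S.mem_hpart_iff M.mem_hpart_iff by blast+
    have "\<mu> x * \<sigma> b \<in> supp_in {S \<in> Pow J. dg S = d + e}"
      by (rule supp_in_mult[OF ax(3,4)]) (use dgU in blast)
    then show ?thesis unfolding M.mem_hpart_iff using ax r by simp
  qed
  show ?thesis
    unfolding graded_bimodule_def
  proof (intro conjI ballI allI)
    show "super_ring R" "super_ring S" "graded_group M"
      by (rule R.super_ring_M S.super_ring_M M.graded_group_M)+
  qed (fact h1 h2 closed | (rule M.psi_inj; simp add: simps algebra_simps))+
qed

text \<open>Both sides have the same image in \<open>ext\<close>, so a map that is the identity in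
  coordinates is bijective and matches the gradings.\<close>

lemma model_iso:
  assumes M: "ext_model M \<mu> J dg" and N: "ext_model N \<nu> J dg"
    and \<Phi>: "\<And>x. x \<in> carrier M \<Longrightarrow> \<Phi> x \<in> carrier N" "\<And>x. x \<in> carrier M \<Longrightarrow> \<nu> (\<Phi> x) = \<mu> x"
  shows "\<Phi> \<in> iso (add_monoid M) (add_monoid N)" "\<Phi> ` hpart M d = hpart N d"
proof -
  interpret M: ext_model M \<mu> J dg by (rule M)
  interpret N: ext_model N \<nu> J dg by (rule N)
  have sur: "\<exists>x\<in>carrier M. \<Phi> x = y" if y: "y \<in> carrier N" for y
  proof -
    obtain x where "x \<in> carrier M" "\<mu> x = \<nu> y" using M.psi_surj[OF N.psi_supp[OF y]] by blast
    then show ?thesis using N.psi_inj[of "\<Phi> x" y] \<Phi> y by auto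
  qed
  have "\<Phi> (x \<oplus>\<^bsub>M\<^esub> y) = \<Phi> x \<oplus>\<^bsub>N\<^esub> \<Phi> y" if "x \<in> carrier M" "y \<in> carrier M" for x y
    using that by (intro N.psi_inj) (simp_all add: \<Phi> M.add_mem N.add_mem M.psi_add N.psi_add)
  moreover have "inj_on \<Phi> (carrier M)"
    using M.psi_inj \<Phi>(2) by (metis inj_onI)
  ultimately show "\<Phi> \<in> iso (add_monoid M) (add_monoid N)"
    using \<Phi>(1) sur by (auto simp: iso_def hom_def bij_betw_def image_iff) (metis sur)
  show "\<Phi> ` hpart M d = hpart N d"
  proof (intro subset_antisym subsetI)
    fix y assume "y \<in> \<Phi> ` hpart M d"
    then obtain x where "y = \<Phi> x" "x \<in> hpart M d" by blast
    then show "y \<in> hpart N d" using \<Phi> unfolding N.mem_hpart_iff M.mem_hpart_iff by simp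
  next
    fix y assume y: "y \<in> hpart N d"
    then have yc: "y \<in> carrier N" unfolding N.mem_hpart_iff by blast
    then obtain x where x: "x \<in> carrier M" "\<Phi> x = y" using sur by blast
    then have "x \<in> hpart M d" using y \<Phi>(2)[OF x(1)] unfolding N.mem_hpart_iff M.mem_hpart_iff by simp
    then show "y \<in> \<Phi> ` hpart M d" using x(2) by blast
  qed
qed

section \<open>The iterated coproduct\<close>

lemma extmap_cong:
  "v \<in> supp_in (Pow A) \<Longrightarrow> (\<And>j. j \<in> A \<Longrightarrow> \<delta> j = \<delta>' j) \<Longrightarrow> extmap \<delta> v = extmap \<delta>' v"
proof (induction v rule: ext_supp_induct)
  case (bas S)
  then have "map \<delta> (sorted_list_of_set S) = map \<delta>' (sorted_list_of_set S)" by auto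
  then show ?case using bas by (simp only: extmap_bas)
qed (auto simp: extmap_additive)

lemma extmap_extmap:
  assumes "\<And>i j. \<xi> i * \<xi> j = - (\<xi> j * \<xi> i)" "\<And>i. \<xi> i * \<xi> i = 0"
  shows "extmap \<xi> (extmap \<eta> v) = extmap (\<lambda>j. extmap \<xi> (\<eta> j)) v"
proof (induction v rule: ext_induct)
  case (bas S)
  then show ?case by (simp add: extmap_bas extmap_prod_list[OF assms] o_def)
qed (auto simp: extmap_additive)

text \<open>The image of E (\<open>j = 0\<close>) or F (\<open>j = 1\<close>) under the n-fold
  coproduct: the sum of its copies in the factors 1 to n.\<close>

definition coprod_gen :: "nat \<Rightarrow> nat \<Rightarrow> ext" where "coprod_gen n j = (\<Sum>i\<in>{1..n}. gen (2 * i + j))"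
abbreviation coprod :: "nat \<Rightarrow> ext \<Rightarrow> ext" where "coprod n \<equiv> extmap (coprod_gen n)"

lemma coprod_gen_anticomm: "coprod_gen n i * coprod_gen n j = - (coprod_gen n j * coprod_gen n i)"
  unfolding coprod_gen_def by (rule sum_anticommute) (rule gen_anticomm)

lemma coprod_gen_square: "coprod_gen n i * coprod_gen n i = 0"
  unfolding coprod_gen_def by (rule sum_square_zero) (rule gen_anticomm gen_square)+

lemmas coprod_mult = extmap_mult[OF coprod_gen_anticomm coprod_gen_square]

abbreviation gidx :: "gen \<Rightarrow> nat" where "gidx \<equiv> case_gen 0 (Suc 0)"

lemma dgs_singleton: "dgs {j} = dgT j" by (simp add: dgs_def)

lemma coprod_gen_supp: "coprod_gen n j \<in> supp_in {S \<in> Pow {2 * Suc 0 + j..2 * n + j}. dgs S = dgT j}"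
  unfolding coprod_gen_def gen_def by (intro supp_in_sum supp_in_bas) (auto simp: dgs_singleton dgT_def)

lemma coprod_degree:
  assumes "v \<in> supp_in {S \<in> Pow {0, Suc 0}. dgs S = d}"
  shows "coprod n v \<in> supp_in {S \<in> Pow (JT n). dgs S = d}"
  using assms
proof (induction v rule: ext_supp_induct)
  case (bas S)
  have "finite S \<Longrightarrow> S \<subseteq> {0, Suc 0} \<Longrightarrow> coprod n (bas S) \<in> supp_in {T \<in> Pow (JT n). dgs T = dgs S}" for S
  proof (induction S rule: finite_linorder_min_induct)
    case empty
    then show ?case using supp_in_bas[of "{}"] by (simp add: bas_empty)
  next
    case (insert m S)
    have "m \<notin> S" using insert by auto
    then have dg: "dgs (Set.insert m S) = dgT m + dgs S" using insert by (simp add: dgs_def)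
    have "coprod_gen n m \<in> supp_in {T \<in> Pow (JT n). dgs T = dgT m}"
      by (rule supp_in_mono[OF _ coprod_gen_supp]) (use insert in \<open>auto simp: JT_def\<close>)
    then have "coprod_gen n m * coprod n (bas S) \<in> supp_in {T \<in> Pow (JT n). dgs T = dgT m + dgs S}"
      using insert by (intro supp_in_mult[of _ "{T \<in> Pow (JT n). dgs T = dgT m}" _ "{T \<in> Pow (JT n). dgs T = dgs S}"]) (auto simp: dgs_Un)
    then show ?case using insert by (simp add: bas_insert_less coprod_mult dg)
  qed
  with bas show ?case by auto
qed (auto simp: extmap_additive supp_in_diff)

lemma U_hom_model:
  assumes T: "ext_ring_model T \<psi> J dg" and a: "\<And>g. a g \<in> carrier T" "\<And>g. \<psi> (a g) = \<delta> (gidx g)"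
    and \<delta>: "\<And>i j. \<delta> i * \<delta> j = - (\<delta> j * \<delta> i)" "\<And>i. \<delta> i * \<delta> i = 0"
    and u: "u \<in> carrier U_ring"
  shows "U_hom T a u \<in> carrier T" "\<psi> (U_hom T a u) = extmap \<delta> (psi_U u)"
proof -
  interpret T: ext_ring_model T \<psi> J dg by (rule T)
  let ?f = "\<lambda>w. foldr (\<lambda>g t. a g \<otimes>\<^bsub>T\<^esub> t) w \<one>\<^bsub>T\<^esub>"
  let ?w = "\<lambda>w. prod_list (map (\<lambda>g. gen (gidx g)) w)"
  have f: "?f w \<in> carrier T \<and> \<psi> (?f w) = extmap \<delta> (?w w)" for w
    by (induction w) (simp_all add: T.one_mem T.psi_one T.mult_mem T.psi_mult a extmap_mult[OF \<delta>])
  have "lin (\<lambda>w. extmap \<delta> (?w w)) c = extmap \<delta> (psi_U u)" if "c \<in> u" for c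
    unfolding U_elem(2)[OF u that, symmetric] by (rule lin_compose_additive[symmetric]) (rule extmap_additive)
  from T.coset_ext_model[OF U_elem(1)[OF u] f this]
  show "U_hom T a u \<in> carrier T" "\<psi> (U_hom T a u) = extmap \<delta> (psi_U u)" unfolding U_hom_def by blast+
qed

lemma U_gen_homU: "U_gen g \<in> homU"
proof -
  have "U_gen g \<in> hpart U_ring (dgT (gidx g))"
    unfolding U.mem_hpart_iff by (auto simp: U_gen_closed psi_U_gen gen_def dgs_singleton split: gen.splits intro!: supp_in_bas)
  then show ?thesis by (rule homU_I)
qed

lemma U_one_homU: "\<one>\<^bsub>U_ring\<^esub> \<in> homU"
  using U_one_hpart by (rule homU_I)

lemma coproduct_model:
  assumes u: "u \<in> carrier U_ring"
  shows "coproduct u \<in> carrier (tensor_power U_ring 2)" "psi_T (coproduct u) = coprod 2 (psi_U u)"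
proof -
  interpret T: ext_ring_model "tensor_power U_ring 2" "psi_T" "JT 2" dgs by (rule TP_model)
  let ?a = "\<lambda>g. pure_tensor U_ring [U_gen g, \<one>\<^bsub>U_ring\<^esub>]" and ?b = "\<lambda>g. pure_tensor U_ring [\<one>\<^bsub>U_ring\<^esub>, U_gen g]"
  have g: "[U_gen g, \<one>\<^bsub>U_ring\<^esub>] \<in> tensor_gens U_ring 2" "[\<one>\<^bsub>U_ring\<^esub>, U_gen g] \<in> tensor_gens U_ring 2" for g
    using U_gen_homU U_one_homU by (auto simp: tensor_gens_iff)
  have a: "?a g \<in> carrier (tensor_power U_ring 2)" "?b g \<in> carrier (tensor_power U_ring 2)"
    "psi_T (?a g) = gen (2 + gidx g)" "psi_T (?b g) = gen (4 + gidx g)" for g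
    using pure_tensor_TP[OF g(1)] pure_tensor_TP[OF g(2)] by (simp_all add: psi_U_gen U.psi_one)
  have "{1..2} = {1, 2 :: nat}" by auto
  then have c: "coprod_gen 2 j = gen (2 + j) + gen (4 + j)" for j by (simp add: coprod_gen_def)
  have s: "?a g \<oplus>\<^bsub>tensor_power U_ring 2\<^esub> ?b g \<in> carrier (tensor_power U_ring 2)"
     "psi_T (?a g \<oplus>\<^bsub>tensor_power U_ring 2\<^esub> ?b g) = coprod_gen 2 (gidx g)" for g
    by (simp_all only: T.add_mem T.psi_add a c)
  note * = U_hom_model[where \<delta> = "coprod_gen 2", OF TP_model s coprod_gen_anticomm coprod_gen_square u]
  show "coproduct u \<in> carrier (tensor_power U_ring 2)" "psi_T (coproduct u) = coprod 2 (psi_U u)"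
    unfolding coproduct_def using * by blast+
qed

text \<open>One step of the iteration is a ring endomorphism of \<open>ext\<close> in coordinates;
  the nested extensions are evaluated from the inside out against it.\<close>

lemma iter_coproduct_model:
  assumes u: "u \<in> carrier U_ring"
  shows "iter_coproduct n u \<in> carrier (tensor_power U_ring (Suc n)) \<and>
    psi_T (iter_coproduct n u) = coprod (Suc n) (psi_U u)"
proof (induction n)
  case 0
  have g: "[U_gen g] \<in> tensor_gens U_ring (Suc 0)" for g
    using U_gen_homU by (auto simp: tensor_gens_iff)
  have a: "pure_tensor U_ring [U_gen g] \<in> carrier (tensor_power U_ring (Suc 0))"
     "psi_T (pure_tensor U_ring [U_gen g]) = coprod_gen (Suc 0) (gidx g)" for g
    using pure_tensor_TP[OF g] by (simp_all add: psi_U_gen coprod_gen_def)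
  note * = U_hom_model[where \<delta> = "coprod_gen (Suc 0)", OF TP_model a coprod_gen_anticomm coprod_gen_square u]
  show ?case unfolding iter_coproduct.simps One_nat_def using * by blast
next
  case (Suc n)
  let ?T = "tensor_power U_ring (Suc (Suc n))" and ?\<psi> = "psi_T"
  interpret T: ext_ring_model ?T ?\<psi> "JT (Suc (Suc n))" dgs by (rule TP_model)
  \<comment> \<open>The substitution of one step. Indices 2 and 3, the first factor, go to the sum
    of their copies in factors 1 and 2; every later factor moves up by one, an index shift by
    2.\<close>
  define \<xi> where "\<xi> j = (if j < 4 then gen j + gen (j + 2) else gen (j + 2))" for j
  have \<xi>_sum: "\<xi> j = (\<Sum>i\<in>(if j < 4 then {j, j + 2} else {j + 2}). gen i)" for j by (simp add: \<xi>_def)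
  have anti: "\<xi> i * \<xi> j = - (\<xi> j * \<xi> i)" for i j
    unfolding \<xi>_sum by (rule sum_anticommute) (rule gen_anticomm)
  have sq: "\<xi> i * \<xi> i = 0" for i
    unfolding \<xi>_sum by (rule sum_square_zero) (rule gen_anticomm gen_square)+
  let ?\<Xi> = "extmap \<xi>"
  have \<Xi>_shift1: "?\<Xi> (shift 1 v) = coprod 2 v" if "v \<in> supp_in (Pow {0, Suc 0})" for v
  proof -
    have "{1..2} = {1, 2 :: nat}" by auto
    then have c: "coprod_gen 2 j = gen (2 + j) + gen (4 + j)" for j by (simp add: coprod_gen_def)
    show ?thesis unfolding shift_def extmap_extmap[OF anti sq]
      by (rule extmap_cong[OF that]) (auto simp: c \<xi>_def add.commute intro!: arg_cong[where f = gen])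
  qed
  have \<Xi>_shift: "?\<Xi> (shift k v) = shift (Suc k) v" if "2 \<le> k" for k v
    unfolding shift_def extmap_extmap[OF anti sq] using that by (simp add: \<xi>_def add.commute)
  have \<Xi>_tau: "?\<Xi> (tau k as) = tau (Suc k) as" if "2 \<le> k" for k as
    using that by (induction as arbitrary: k) (simp_all add: extmap_mult[OF anti sq] \<Xi>_shift)
  have \<Xi>_coprod: "?\<Xi> (coprod (Suc n) v) = coprod (Suc (Suc n)) v" if "v \<in> supp_in (Pow {0, Suc 0})" for v
    unfolding extmap_extmap[OF anti sq]
  proof (rule extmap_cong[OF that])
    fix j assume j: "j \<in> {0, Suc 0}"
    have "?\<Xi> (coprod_gen (Suc n) j) = (\<Sum>i\<in>{1..Suc n}. \<xi> (2 * i + j))"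
      by (simp add: coprod_gen_def extmap_sum del: sum.cl_ivl_Suc)
    also have "{1..Suc n} = insert 1 {2..Suc n}" by auto
    also have "(\<Sum>i\<in>insert 1 {2..Suc n}. \<xi> (2 * i + j)) = \<xi> (2 + j) + (\<Sum>i\<in>{2..Suc n}. gen (2 * Suc i + j))"
      by (subst sum.insert) (auto simp: \<xi>_def intro!: sum.cong)
    also have "(\<Sum>i\<in>{2..Suc n}. gen (2 * Suc i + j)) = (\<Sum>i\<in>{3..Suc (Suc n)}. gen (2 * i + j))"
      using sum.shift_bounds_cl_Suc_ivl[of "\<lambda>i. gen (2 * i + j)" 2 "Suc n"] by (simp add: eval_nat_numeral del: sum.cl_ivl_Suc)
    also have "\<xi> (2 + j) = (\<Sum>i\<in>{1, 2}. gen (2 * i + j))" using j by (auto simp: \<xi>_def intro!: arg_cong[where f = gen])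
    also have "(\<Sum>i\<in>{1, 2}. gen (2 * i + j)) + (\<Sum>i\<in>{3..Suc (Suc n)}. gen (2 * i + j)) = (\<Sum>i\<in>{1, 2} \<union> {3..Suc (Suc n)}. gen (2 * i + j))"
      by (rule sum.union_disjoint[symmetric]) auto
    also have "{1, 2} \<union> {3..Suc (Suc n)} = {1..Suc (Suc n)}" by auto
    finally show "?\<Xi> (coprod_gen (Suc n) j) = coprod_gen (Suc (Suc n)) j" by (simp only: coprod_gen_def)
  qed
  let ?in = "\<lambda>as. coset_ext ?T (\<lambda>bs. pure_tensor U_ring (bs @ tl as)) (coproduct (hd as))"
  have inner: "?in as \<in> carrier ?T \<and> ?\<psi> (?in as) = ?\<Xi> (tau 1 as)" if as: "as \<in> tensor_gens U_ring (Suc n)" for as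
  proof -
    obtain a as' where as': "as = a # as'" using as by (cases as) (auto simp: tensor_gens_iff)
    have a: "a \<in> carrier U_ring" "length as' = n" "set as' \<subseteq> homU"
      using as homU_closed by (auto simp: as' tensor_gens_iff)
    \<comment> \<open>The two entries \<open>bs\<close> take the place of the first factor, so the
      old tail now starts in factor 3.\<close>
    have f: "pure_tensor U_ring (bs @ tl as) \<in> carrier ?T \<and> ?\<psi> (pure_tensor U_ring (bs @ tl as)) = tau 1 bs * tau 3 as'"
      if "c \<in> coproduct a" "bs \<in> Poly_Mapping.keys c" for c bs
    proof -
      have "bs \<in> tensor_gens U_ring 2" using TP_elem(2)[OF coproduct_model(1)[OF a(1)] that(1)] that(2) by blast
      then have bs: "length bs = 2" "bs @ as' \<in> tensor_gens U_ring (Suc (Suc n))"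
        using a by (auto simp: tensor_gens_iff)
      show ?thesis using pure_tensor_TP[OF bs(2)] bs(1) by (simp add: as' tau_append eval_nat_numeral)
    qed
    have lin: "lin (\<lambda>bs. tau 1 bs * tau 3 as') c = coprod 2 (psi_U a) * tau 3 as'" if "c \<in> coproduct a" for c
      using TP_elem(2)[OF coproduct_model(1)[OF a(1)] that] coproduct_model(2)[OF a(1)] by (simp add: lin_mult_right)
    have hd: "hd as = a" by (simp add: as')
    have "?\<Xi> (tau 1 as) = coprod 2 (psi_U a) * tau 3 as'"
      using \<Xi>_shift1[OF U.psi_supp[OF a(1)]] \<Xi>_tau[of 2 as'] by (simp add: as' extmap_mult[OF anti sq] eval_nat_numeral)
    with T.coset_ext_model[OF TP_elem(1)[OF coproduct_model(1)[OF a(1)]] f lin]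
    show ?thesis unfolding hd by simp
  qed
  let ?u = "iter_coproduct n u"
  have uc: "?u \<in> carrier (tensor_power U_ring (Suc n))" using Suc by blast
  have f: "?in as \<in> carrier ?T \<and> ?\<psi> (?in as) = ?\<Xi> (tau 1 as)" if "c \<in> ?u" "as \<in> Poly_Mapping.keys c" for c as
    using inner TP_elem(2)[OF uc that(1)] that(2) by blast
  have lin: "lin (\<lambda>as. ?\<Xi> (tau 1 as)) c = coprod (Suc (Suc n)) (psi_U u)" if "c \<in> ?u" for c
  proof -
    have "lin (\<lambda>as. ?\<Xi> (tau 1 as)) c = ?\<Xi> (lin (tau 1) c)"
      by (rule lin_compose_additive[symmetric]) (rule extmap_additive)
    also have "\<dots> = ?\<Xi> (coprod (Suc n) (psi_U u))" using TP_elem(2)[OF uc that] Suc by simp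
    finally show ?thesis using \<Xi>_coprod[OF U.psi_supp[OF u]] by simp
  qed
  from T.coset_ext_model[OF TP_elem(1)[OF uc] f lin] show ?case by (simp add: Let_def)
qed

section \<open>The state space of the closed tuple of pants\<close>

text \<open>Transfers a property of values from generators to the group. With the integers as Q it
  shows that coordinates are integral, with \<open>{0}\<close> that the boundary coefficients add up
  to zero.\<close>

lemma (in group) additive_generate:
  fixes f :: "'a \<Rightarrow> 'r::ring_1"
  assumes f: "\<And>x y. x \<in> carrier G \<Longrightarrow> y \<in> carrier G \<Longrightarrow> f (x \<otimes> y) = f x + f y"
    and Q: "\<And>x y. x \<in> Q \<Longrightarrow> y \<in> Q \<Longrightarrow> x - y \<in> Q" "0 \<in> Q"
    and K: "K \<subseteq> carrier G" "\<And>x. x \<in> K \<Longrightarrow> f x \<in> Q" and x: "x \<in> generate G K"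
  shows "f x \<in> Q"
proof -
  have one: "f \<one> = 0" using f[of \<one> \<one>] by simp
  have inv: "f (inv y) = - f y" if "y \<in> carrier G" for y
    using f[of "inv y" y] that by (simp add: one eq_neg_iff_add_eq_0)
  have neg: "- a \<in> Q" if "a \<in> Q" for a using Q(1)[OF Q(2) that] by simp
  show ?thesis using x
  proof (induction x rule: generate.induct)
    case (eng h1 h2)
    then have "h1 \<in> carrier G" "h2 \<in> carrier G" using generate_in_carrier[OF K(1)] by auto
    then show ?case using Q(1)[OF eng(3) neg[OF eng(4)]] by (simp add: f)
  qed (use K neg in \<open>auto simp: one Q(2) inv\<close>)
qed

text \<open>The basis vectors \<open>e_i\<close> and \<open>\<sigma>_i\<close> carry the indices \<open>2 * i\<close> and \<open>2 * i + 1\<close> of \<open>E\<close> and \<open>F\<close>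
  in the \<open>i\<close>-th tensor factor.\<close>

locale pants_basis =
  fixes p :: nat and X :: "'a topology" and C :: "nat \<Rightarrow> real \<Rightarrow> 'a" and q :: "nat \<Rightarrow> 'a" and e :: "nat \<Rightarrow> real \<Rightarrow> 'a"
    and k :: "'a H1_class \<Rightarrow> nat \<Rightarrow> int" and b :: "nat \<Rightarrow> 'a H1_class"
  assumes p1: "1 \<le> p"
    and basis: "group_basis (pants_H1 p X q) k (JT p) b"
    and b_even: "i \<in> {1..p} \<Longrightarrow> b (2 * i) = path_class X (q ` {0..p}) (e i)"
    and b_odd: "i \<in> {1..p} \<Longrightarrow> b (Suc (2 * i)) = sigma_class p X C q i"
    and bc_closed: "i \<le> p \<Longrightarrow> boundary_class p X C q i \<in> carrier (pants_H1 p X q)"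
    and phi_0: "x \<in> carrier (pants_H1 p X q) \<Longrightarrow> pants_phi p X q 0 x = (\<Sum>i\<in>{1..p}. - ((- 1) ^ (p - i)) * k x (2 * i))"
    and phi_i: "x \<in> carrier (pants_H1 p X q) \<Longrightarrow> i \<in> {1..p} \<Longrightarrow> pants_phi p X q i x = (- 1) ^ (p - i) * k x (2 * i)"
    and k_bc_0: "j \<in> JT p \<Longrightarrow> k (boundary_class p X C q 0) j = (if odd j then (- 1) ^ (p - j div 2) else 0)"
    and k_bc: "i \<in> {1..p} \<Longrightarrow> j \<in> JT p \<Longrightarrow> k (boundary_class p X C q i) j = (if j = Suc (2 * i) then - ((- 1) ^ (p - i)) else 0)"

lemma pants_basis_exists:
  fixes p :: nat and X :: "'a topology" and C :: "nat \<Rightarrow> real \<Rightarrow> 'a"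
    and q :: "nat \<Rightarrow> 'a" and e :: "nat \<Rightarrow> real \<Rightarrow> 'a"
  assumes p: "1 \<le> p"
    and "closed_pants p X C"
    and "\<And>i. i \<le> p \<Longrightarrow> q i \<in> C i ` {0..1}"
    and "\<And>i. i \<in> {1..p} \<Longrightarrow> pathin X (e i) \<and> inj_on (e i) {0..1}"
    and "\<And>i. i \<in> {1..p} \<Longrightarrow> even (p - i) \<Longrightarrow> e i 0 = q 0 \<and> e i 1 = q i"
    and "\<And>i. i \<in> {1..p} \<Longrightarrow> odd (p - i) \<Longrightarrow> e i 0 = q i \<and> e i 1 = q 0"
  obtains k b where "pants_basis p X C q e k b"
proof -
  define H where "H = pants_H1 p X q"
  define ec where "ec = (\<lambda>i. path_class X (q ` {0..p}) (e i))"
  define bc where "bc = boundary_class p X C q"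
  define \<phi> where "\<phi> = pants_phi p X q"
  \<comment> \<open>The sign of the alternating orientations: it is 1 exactly when
    \<open>e i\<close> ends at \<open>q i\<close> and \<open>\<sigma>_i\<close> is the inverse of
    the boundary class.\<close>
  define s :: "nat \<Rightarrow> int" where "s i = (- 1) ^ (p - i)" for i
  have ss: "s i * s i = 1" for i by (simp add: s_def flip: power_add mult_2)
  have ssc: "complex_of_int (s i) * complex_of_int (s i) = 1" for i using ss[of i] by (simp flip: of_int_mult)
  have ec_ap: "path_class X (q ` {0..p}) (e i) = ec i" for i by (simp add: ec_def)
  have "\<exists>W. pants_homology_facts p X C q e W" by (rule pants_homology) (fact assms)+
  then obtain W where W: "pants_homology_facts p X C q e W" by blast
  note W' = pants_homology_facts.ec_closed[OF W] pants_homology_facts.bc_closed[OF W] pants_homology_facts.generate_classes[OF W]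
    pants_homology_facts.phi_mult[OF W] pants_homology_facts.W_mult[OF W] pants_homology_facts.phi_ec[OF W]
    pants_homology_facts.phi_bc[OF W] pants_homology_facts.W_bc[OF W]
  note W'' = W'[folded H_def ec_def bc_def \<phi>_def s_def, unfolded ec_ap]
  note ecH = W''(1) and bcH = W''(2) and gen = W''(3) and phi_mult = W''(4) and W_mult = W''(5)
    and phi_ec = W''(6) and phi_bc = W''(7) and W_bc = W''(8)
  interpret comm_group H unfolding H_def pants_H1_def by simp
  let ?K = "ec ` {1..p} \<union> bc ` {1..p}"
  have K: "?K \<subseteq> carrier H" using ecH bcH by auto
  \<comment> \<open>the coordinates of \<open>\<sigma>_i\<close> are winding numbers, corrected to vanish on the arcs\<close>
  define \<kappa> :: "'a H1_class \<Rightarrow> nat \<Rightarrow> complex" where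
    "\<kappa> x j = (if even j then of_int (s (j div 2) * \<phi> (j div 2) x)
       else of_int (s (j div 2)) * (W (j div 2) x - (\<Sum>l\<in>{1..p}. of_int (s l * \<phi> l x) * W (j div 2) (ec l))))" for x j
  have jt: "j div 2 \<in> {1..p}" if "j \<in> JT p" for j using that by (auto simp: JT_def)
  have \<kappa>_mult: "\<kappa> (x \<otimes>\<^bsub>H\<^esub> y) j = \<kappa> x j + \<kappa> y j" if "x \<in> carrier H" "y \<in> carrier H" "j \<in> JT p" for x y j
    using that jt[OF that(3)] by (simp add: \<kappa>_def phi_mult W_mult algebra_simps sum.distrib)
  have \<kappa>_ec: "\<kappa> (ec l) j = (if j = 2 * l then 1 else 0)" if l: "l \<in> {1..p}" and j: "j \<in> JT p" for l j
  proof (cases "even j")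
    case True
    then show ?thesis using phi_ec[of "j div 2" l] jt[OF j] l by (auto simp: \<kappa>_def ssc elim!: evenE)
  next
    case False
    \<comment> \<open>Among the boundary coefficients of an arc at the points \<open>q 1\<close> to
      \<open>q p\<close> only its own is nonzero, and \<open>s l * s l = 1\<close>; so the
      correction equals the winding of the arc.\<close>
    have "(\<Sum>l'\<in>{1..p}. of_int (s l' * \<phi> l' (ec l)) * W (j div 2) (ec l')) = (\<Sum>l'\<in>{1..p}. if l' = l then W (j div 2) (ec l) else 0)"
      using ss[of l] l by (intro sum.cong refl) (auto simp: phi_ec simp del: of_int_mult)
    also have "\<dots> = W (j div 2) (ec l)" using l by simp
    finally show ?thesis using False by (auto simp: \<kappa>_def simp del: of_int_mult)
  qed
  have \<kappa>_bc: "\<kappa> (bc l) j = (if odd j then of_int (s (j div 2)) * W (j div 2) (bc l) else 0)" if "l \<le> p" for l j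
    using phi_bc[OF that] by (simp add: \<kappa>_def)
  \<comment> \<open>Generators suffice, and on the arcs the possibly non-integral winding numbers
    have cancelled.\<close>
  have \<kappa>_int: "\<kappa> x j \<in> \<int>" if "x \<in> carrier H" "j \<in> JT p" for x j
  proof (rule additive_generate[where f = "\<lambda>x. \<kappa> x j"])
    show "x \<in> generate H ?K" using that gen by simp
    show "\<kappa> x j \<in> \<int>" if "x \<in> ?K" for x
      using that \<open>j \<in> JT p\<close> jt[OF \<open>j \<in> JT p\<close>] by (auto simp: \<kappa>_ec \<kappa>_bc W_bc)
  qed (use \<kappa>_mult \<open>j \<in> JT p\<close> K in auto)
  \<comment> \<open>At indices in \<open>JT p\<close> the values are integers, so the floor of the
    real part only changes their type.\<close>
  define k where "k x j = \<lfloor>Re (\<kappa> x j)\<rfloor>" for x j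
  have k: "of_int (k x j) = \<kappa> x j" if "x \<in> carrier H" "j \<in> JT p" for x j
    using \<kappa>_int[OF that] by (auto simp: k_def elim!: Ints_cases)
  have kI: "k x j = n" if "x \<in> carrier H" "j \<in> JT p" "\<kappa> x j = of_int n" for x j n
    using k[OF that(1,2)] that(3) by (simp only: of_int_eq_iff)
  have k_mult: "k (x \<otimes>\<^bsub>H\<^esub> y) j = k x j + k y j" if "x \<in> carrier H" "y \<in> carrier H" "j \<in> JT p" for x y j
    using that by (intro kI) (simp_all add: \<kappa>_mult k)
  \<comment> \<open>\<open>group_basis\<close> asks for additivity at every index; setting the
    coordinates to 0 outside \<open>JT p\<close> ensures it.\<close>
  define k' where "k' x j = (if j \<in> JT p then k x j else 0)" for x j
  define b where "b j = (if even j then ec (j div 2) else sigma_class p X C q (j div 2))" for j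
  have sig: "sigma_class p X C q i = (if even (p - i) then inv\<^bsub>H\<^esub> (bc i) else bc i)" for i
    by (simp add: sigma_class_def H_def bc_def)
  have bH: "b j \<in> carrier H" if "j \<in> JT p" for j
    using jt[OF that] ecH bcH by (auto simp: b_def sig)
  have k_inv: "k (inv\<^bsub>H\<^esub> x) j = - k x j" if "x \<in> carrier H" "j \<in> JT p" for x j
  proof -
    have "k \<one>\<^bsub>H\<^esub> j = 0" using k_mult[of "\<one>\<^bsub>H\<^esub>" "\<one>\<^bsub>H\<^esub>" j] that by simp
    then show ?thesis using k_mult[of "inv\<^bsub>H\<^esub> x" x j] that by simp
  qed
  have k_ec: "k (ec l) j = (if j = 2 * l then 1 else 0)" if "l \<in> {1..p}" "j \<in> JT p" for l j
    using that ecH by (intro kI) (auto simp: \<kappa>_ec)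
  have k_bc: "k (bc l) j = (if j = Suc (2 * l) then - s l else 0)" if "l \<in> {1..p}" "j \<in> JT p" for l j
    using that bcH jt[OF that(2)] by (intro kI) (auto simp: \<kappa>_bc W_bc elim!: oddE)
  have k_bc0: "k (bc 0) j = (if odd j then s (j div 2) else 0)" if "j \<in> JT p" for j
    using that bcH jt[OF that] by (intro kI) (auto simp: \<kappa>_bc W_bc)
  have k_b: "k (b i) j = (if i = j then 1 else 0)" if i: "i \<in> JT p" and j: "j \<in> JT p" for i j
  proof (cases "even i")
    case True
    then show ?thesis using k_ec[OF jt[OF i] j] by (auto simp: b_def)
  next
    case False
    then have "i = Suc (2 * (i div 2))" by presburger
    then show ?thesis using False k_bc[OF jt[OF i] j] k_inv[OF bcH j, of "i div 2"] jt[OF i]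
      by (auto simp: b_def sig s_def)
  qed
  have gb: "generate H (b ` JT p) = carrier H"
  proof
    have bK: "b ` JT p \<subseteq> carrier H" using bH by auto
    show "generate H (b ` JT p) \<subseteq> carrier H" using generate_incl[OF bK] .
    interpret S: subgroup "generate H (b ` JT p)" H by (rule generate_is_subgroup[OF bK])
    have mem: "b j \<in> generate H (b ` JT p)" if "j \<in> JT p" for j using that by (intro generate.incl imageI)
    have "ec i \<in> generate H (b ` JT p)" "bc i \<in> generate H (b ` JT p)" if i: "i \<in> {1..p}" for i
    proof -
      have j: "2 * i \<in> JT p" "Suc (2 * i) \<in> JT p" using i by (auto simp: JT_def)
      show "ec i \<in> generate H (b ` JT p)" using mem[OF j(1)] by (simp add: b_def)
      have "sigma_class p X C q i \<in> generate H (b ` JT p)" using mem[OF j(2)] by (simp add: b_def)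
      moreover have "inv\<^bsub>H\<^esub> (inv\<^bsub>H\<^esub> (bc i)) = bc i" using bcH i by simp
      ultimately show "bc i \<in> generate H (b ` JT p)"
        unfolding sig using S.m_inv_closed[of "inv\<^bsub>H\<^esub> (bc i)"] by (auto split: if_splits)
    qed
    then have "?K \<subseteq> generate H (b ` JT p)" by auto
    from generate_subgroup_incl[OF this S.subgroup_axioms] show "carrier H \<subseteq> generate H (b ` JT p)"
      unfolding gen .
  qed
  have phi_k: "\<phi> i x = s i * k x (2 * i)" if "x \<in> carrier H" "i \<in> {1..p}" for x i
  proof -
    have j: "2 * i \<in> JT p" using that by (auto simp: JT_def)
    have "k x (2 * i) = s i * \<phi> i x" using that j by (intro kI) (auto simp: \<kappa>_def)
    then show ?thesis using ss[of i] by (simp flip: mult.assoc)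
  qed
  \<comment> \<open>The two ends of an arc contribute opposite coefficients and closed curves
    contribute none. This expresses the coefficient at \<open>q 0\<close> by the others.\<close>
  have phi_sum: "\<phi> 0 x + (\<Sum>i\<in>{1..p}. \<phi> i x) \<in> {0}" if "x \<in> carrier H" for x
  proof (rule additive_generate[where f = "\<lambda>x. \<phi> 0 x + (\<Sum>i\<in>{1..p}. \<phi> i x)"])
    show "x \<in> generate H ?K" using that gen by simp
    show "\<phi> 0 x + (\<Sum>i\<in>{1..p}. \<phi> i x) \<in> {0}" if x: "x \<in> ?K" for x
    proof -
      have "\<phi> 0 (ec l) + (\<Sum>i\<in>{1..p}. \<phi> i (ec l)) = 0" if l: "l \<in> {1..p}" for l
      proof -
        have "(\<Sum>i\<in>{1..p}. \<phi> i (ec l)) = (\<Sum>i\<in>{1..p}. if i = l then s l else 0)"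
          using l by (intro sum.cong refl) (auto simp: phi_ec)
        then show ?thesis using l by (simp add: phi_ec)
      qed
      then show ?thesis using x by (auto simp: phi_bc)
    qed
  qed (use K in \<open>auto simp: phi_mult sum.distrib\<close>)
  have "pants_basis p X C q e k' b"
  proof (rule pants_basis.intro, fold H_def bc_def)
    show "pants_phi p X q 0 x = (\<Sum>i\<in>{1..p}. - ((- 1) ^ (p - i)) * k' x (2 * i))" if "x \<in> carrier H" for x
    proof -
      have "(\<Sum>i\<in>{1..p}. - ((- 1) ^ (p - i)) * k' x (2 * i)) = (\<Sum>i\<in>{1..p}. - \<phi> i x)"
        using that by (intro sum.cong refl) (auto simp: phi_k k'_def s_def JT_def)
      then show ?thesis using phi_sum[OF that] by (simp add: sum_negf \<phi>_def)
    qed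
    show "group_basis H k' (JT p) b"
      by unfold_locales (use bH gb in \<open>auto simp: k'_def k_mult k_b finite_JT\<close>)
    show "pants_phi p X q i x = (- 1) ^ (p - i) * k' x (2 * i)" if "x \<in> carrier H" "i \<in> {1..p}" for x i
    proof -
      have "2 * i \<in> JT p" using that by (auto simp: JT_def)
      then show ?thesis using phi_k[OF that] by (simp add: k'_def \<phi>_def s_def)
    qed
  qed (use p in \<open>auto simp: b_def ec_def k'_def k_bc k_bc0 s_def bcH\<close>)
  then show ?thesis by (rule that)
qed

section \<open>Contractions on words\<close>

lemma lcon_sum: "lcon i (sum f I) = (\<Sum>j\<in>I. lcon i (f j))"
  by (induction I rule: infinite_finite_induct) (simp_all add: lcon_additive)

lemma rcon_sum: "rcon i (sum f I) = (\<Sum>j\<in>I. rcon i (f j))"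
  by (induction I rule: infinite_finite_induct) (simp_all add: rcon_additive)

text \<open>Iterating the antiderivation rule, D passes m letters before it meets
  \<open>xs ! m\<close>, which produces the alternating sum in the action of
  \<open>E\<close>.\<close>

lemma left_contraction_prod:
  fixes D :: "ext \<Rightarrow> ext" and \<phi> :: "'x \<Rightarrow> int"
  assumes "D 1 = 0" "\<And>x v. x \<in> set xs \<Longrightarrow> D (f x * v) = of_int (\<phi> x) * v - f x * D v"
  shows "D (prod_list (map f xs)) =
    (\<Sum>m<length xs. of_int ((- 1) ^ m * \<phi> (xs ! m)) * prod_list (map f (take m xs @ drop (Suc m) xs)))"
  using assms(2)
proof (induction xs)
  case (Cons a xs)
  have "D (prod_list (map f (a # xs))) = of_int (\<phi> a) * prod_list (map f xs) - f a * D (prod_list (map f xs))"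
    using Cons(2) by simp
  also have "f a * D (prod_list (map f xs)) = (\<Sum>m<length xs. f a * (of_int ((- 1) ^ m * \<phi> (xs ! m)) * prod_list (map f (take m xs @ drop (Suc m) xs))))"
    using Cons by (simp add: sum_distrib_left)
  also have "of_int (\<phi> a) * prod_list (map f xs) - \<dots> =
     (\<Sum>m<length (a # xs). of_int ((- 1) ^ m * \<phi> ((a # xs) ! m)) * prod_list (map f (take m (a # xs) @ drop (Suc m) (a # xs))))"
    unfolding length_Cons sum.lessThan_Suc_shift
    by (simp add: mult_of_int_left[of "f a"] sum_negf del: of_int_mult)
  finally show ?case .
qed (simp add: assms(1))

text \<open>Coming from the right, D passes the \<open>length xs - Suc m\<close> letters that follow
  \<open>xs ! m\<close>.\<close>

lemma right_contraction_prod: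
  fixes D :: "ext \<Rightarrow> ext" and \<phi> :: "'x \<Rightarrow> int"
  assumes "D 1 = 0" "\<And>x v. x \<in> set xs \<Longrightarrow> D (v * f x) = of_int (\<phi> x) * v - D v * f x"
  shows "D (prod_list (map f xs)) =
    (\<Sum>m<length xs. of_int ((- 1) ^ (length xs - Suc m) * \<phi> (xs ! m)) * prod_list (map f (take m xs @ drop (Suc m) xs)))"
  using assms(2)
proof (induction xs rule: rev_induct)
  case (snoc a xs)
  have "D (prod_list (map f (xs @ [a]))) = of_int (\<phi> a) * prod_list (map f xs) - D (prod_list (map f xs)) * f a"
    using snoc(2) by simp
  also have "D (prod_list (map f xs)) * f a = (\<Sum>m<length xs. of_int ((- 1) ^ (length xs - Suc m) * \<phi> (xs ! m)) * prod_list (map f (take m xs @ drop (Suc m) xs)) * f a)"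
    using snoc by (simp add: sum_distrib_right)
  also have "\<dots> = (\<Sum>m<length xs. - (of_int ((- 1) ^ (length (xs @ [a]) - Suc m) * \<phi> ((xs @ [a]) ! m)) *
      prod_list (map f (take m (xs @ [a]) @ drop (Suc m) (xs @ [a])))))"
  proof (intro sum.cong refl)
    fix m assume "m \<in> {..<length xs}"
    then have m: "m < length xs" by simp
    then have "length (xs @ [a]) - Suc m = Suc (length xs - Suc m)" by simp
    then have "(- 1 :: int) ^ (length (xs @ [a]) - Suc m) = - ((- 1) ^ (length xs - Suc m))" by simp
    then show "of_int ((- 1) ^ (length xs - Suc m) * \<phi> (xs ! m)) * prod_list (map f (take m xs @ drop (Suc m) xs)) * f a
      = - (of_int ((- 1) ^ (length (xs @ [a]) - Suc m) * \<phi> ((xs @ [a]) ! m)) * prod_list (map f (take m (xs @ [a]) @ drop (Suc m) (xs @ [a]))))"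
      using m by (simp add: nth_append mult.assoc)
  qed
  finally show ?case by (simp add: sum_negf add.commute)
qed (simp add: assms(1))

context group_basis
begin

lemma lcon_val:
  assumes "i \<in> J"
  shows "lcon i (E.val x * v) = of_int (k x i) * v - E.val x * lcon i v"
proof -
  have "lcon i (E.val x * v) = (\<Sum>j\<in>J. (if i = j then of_int (k x i) * v else 0) - of_int (k x j) * (gen j * lcon i v))"
    unfolding E.val_def sum_distrib_right lcon_sum
    by (intro sum.cong refl) (auto simp: mult.assoc lcon_additive lcon_gen_mult right_diff_distrib)
  also have "\<dots> = of_int (k x i) * v - E.val x * lcon i v"
    using assms finite_J by (simp add: sum_subtractf E.val_def sum_distrib_right mult.assoc)
  finally show ?thesis .
qed

lemma rcon_val:
  assumes "i \<in> J"
  shows "rcon i (v * E.val x) = of_int (k x i) * v - rcon i v * E.val x"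
proof -
  have "rcon i (v * E.val x) = (\<Sum>j\<in>J. (if i = j then of_int (k x i) * v else 0) - of_int (k x j) * (rcon i v * gen j))"
    unfolding E.val_def sum_distrib_left rcon_sum
    by (intro sum.cong refl) (auto simp: mult_of_int_left rcon_additive rcon_mult_gen right_diff_distrib)
  also have "\<dots> = of_int (k x i) * v - rcon i v * E.val x"
    using assms finite_J by (simp add: sum_subtractf E.val_def sum_distrib_left mult_of_int_left)
  finally show ?thesis .
qed

lemma wedge_delete_closed:
  "set xs \<subseteq> carrier H \<Longrightarrow> wedge H (take m xs @ drop (Suc m) xs) \<in> carrier (exterior H)"
  by (intro wedge_closed) (use set_take_subset[of m xs] set_drop_subset[of "Suc m" xs] in auto)

text \<open>A formula given on words descends to the exterior algebra as soon as its coordinates on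
  words come from an additive map D of \<open>ext\<close>.\<close>

lemma contraction_model:
  assumes D: "\<And>v w. D (v - w) = D v - D w"
    and D_prod: "\<And>xs. set xs \<subseteq> carrier H \<Longrightarrow> D (prod_list (map E.val xs)) =
      (\<Sum>m<length xs. of_int (n m xs) * prod_list (map E.val (take m xs @ drop (Suc m) xs)))"
    and A: "A \<in> carrier (exterior H)"
  shows "coset_ext (exterior H) (\<lambda>xs. \<Oplus>\<^bsub>exterior H\<^esub>m \<in> {..<length xs}.
        [n m xs] \<cdot>\<^bsub>exterior H\<^esub> wedge H (take m xs @ drop (Suc m) xs)) A \<in> carrier (exterior H)"
    and "E.psi (coset_ext (exterior H) (\<lambda>xs. \<Oplus>\<^bsub>exterior H\<^esub>m \<in> {..<length xs}.
        [n m xs] \<cdot>\<^bsub>exterior H\<^esub> wedge H (take m xs @ drop (Suc m) xs)) A) = D (E.psi A)"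
proof -
  let ?f = "\<lambda>xs. \<Oplus>\<^bsub>exterior H\<^esub>m \<in> {..<length xs}. [n m xs] \<cdot>\<^bsub>exterior H\<^esub> wedge H (take m xs @ drop (Suc m) xs)"
  have f: "?f xs \<in> carrier (exterior H) \<and> E.psi (?f xs) = D (prod_list (map E.val xs))"
    if "c \<in> A" "xs \<in> Poly_Mapping.keys c" for c xs
  proof -
    have xs: "set xs \<subseteq> carrier H" using exterior_elem(2)[OF A that(1)] that(2) by auto
    have cl: "(\<lambda>m. [n m xs] \<cdot>\<^bsub>exterior H\<^esub> wedge H (take m xs @ drop (Suc m) xs)) \<in> {..<length xs} \<rightarrow> carrier (exterior H)"
      using wedge_delete_closed[OF xs] by auto
    show ?thesis
      using X.finsum_closed[OF cl] X.psi_finsum[OF cl] wedge_delete_closed[OF xs] D_prod[OF xs]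
      by (simp add: X.psi_int_pow psi_wedge)
  qed
  have "lin (\<lambda>xs. D (prod_list (map E.val xs))) c = D (E.psi A)" if "c \<in> A" for c
    using exterior_elem(2)[OF A that] lin_compose_additive[of D, OF D] by metis
  note * = X.coset_ext_model[where h = "\<lambda>xs. D (prod_list (map E.val xs))", OF exterior_elem(1)[OF A] _ this]
  show "coset_ext (exterior H) ?f A \<in> carrier (exterior H)" "E.psi (coset_ext (exterior H) ?f A) = D (E.psi A)"
    by (rule *, erule (1) f, assumption)+
qed

lemma dgs_card: "finite S \<Longrightarrow> E.dgs S = (int (card S), of_nat (card S))"
  unfolding E.dgs_def by (induction S rule: finite_induct) (simp_all add: zero_prod_def)

end

text \<open>An index in E counts -1 when missing from S and 0 when present, one less than its
  exterior degree in either case. Over all of E this is the shift of degree and parity by its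
  cardinality.\<close>

lemma dgs_sym_diff:
  assumes "finite S" "finite E" "\<forall>j\<in>E. even j" "\<forall>j\<in>S. even j \<longrightarrow> j \<in> E"
  shows "dgs (sym_diff S E) + (int (card E), of_nat (card E)) = (int (card S), of_nat (card S))"
  using assms(1,4)
proof (induction S rule: finite_induct)
  case empty
  have "dgs E = (- int (card E), of_nat (card E))"
    using assms(2,3) by (induction E rule: finite_induct) (auto simp: dgs_def dgT_def zero_prod_def)
  then show ?case by (simp add: zero_prod_def)
next
  case (insert j S)
  define T where "T = sym_diff S E"
  have fT: "finite T" using insert(1) assms(2) by (simp add: T_def)
  have "dgs (sym_diff (Set.insert j S) E) = (1, 1) + dgs T"
  proof (cases "even j")
    case True
    then have "sym_diff (Set.insert j S) E = T - {j}" "j \<in> T" using insert(2,4) by (auto simp: T_def)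
    moreover from this(2) have "dgs T = dgT j + dgs (T - {j})"
      using fT unfolding dgs_def by (intro sum.remove) auto
    moreover have "(1, 1) + ((- 1, 1) + x) = x" for x :: "int \<times> bit"
      by (cases x) (simp add: add.assoc[symmetric])
    ultimately show ?thesis using True by (simp add: dgT_def)
  next
    case False
    then have "j \<notin> E" using assms(3) by blast
    then have "sym_diff (Set.insert j S) E = Set.insert j T" "j \<notin> T" using insert(2) by (auto simp: T_def)
    then show ?thesis using fT False by (simp add: dgs_def dgT_def)
  qed
  moreover have "dgs T + (int (card E), of_nat (card E)) = (int (card S), of_nat (card S))"
    unfolding T_def using insert by simp
  ultimately show ?case using insert(1,2) by (simp add: add.assoc)
qed

text \<open>The index set of the monomial with exponents \<open>\<delta>\<close> at the even and
  \<open>\<delta>'\<close> at the odd indices; \<open>j div 2\<close> is the number of the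
  factor.\<close>

definition exps_set :: "nat \<Rightarrow> (nat \<Rightarrow> nat) \<Rightarrow> (nat \<Rightarrow> nat) \<Rightarrow> nat set" where
  "exps_set n \<delta> \<delta>' = {j. j div 2 \<in> {1..n} \<and> (if even j then \<delta> else \<delta>') (j div 2) \<noteq> 0}"

lemma exps_set_mem:
  "2 * i \<in> exps_set n \<delta> \<delta>' \<longleftrightarrow> i \<in> {1..n} \<and> \<delta> i \<noteq> 0"
  "Suc (2 * i) \<in> exps_set n \<delta> \<delta>' \<longleftrightarrow> i \<in> {1..n} \<and> \<delta>' i \<noteq> 0"
  by (auto simp: exps_set_def)

lemma prod_list_exps_set:
  assumes "\<And>i. i \<in> {1..n} \<Longrightarrow> \<delta> i \<in> {0, 1} \<and> \<delta>' i \<in> {0, 1}"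
  shows "prod_list (map (\<lambda>i. gen (2 * i) ^ \<delta> i * gen (Suc (2 * i)) ^ \<delta>' i) [1..<Suc n]) = bas (exps_set n \<delta> \<delta>')"
  using assms
proof (induction n)
  case 0
  then show ?case by (simp add: exps_set_def bas_empty)
next
  case (Suc n)
  let ?T = "(if \<delta> (Suc n) = 0 then {} else {2 * Suc n}) \<union> (if \<delta>' (Suc n) = 0 then {} else {Suc (2 * Suc n)})"
  have "\<delta> (Suc n) \<in> {0, 1}" "\<delta>' (Suc n) \<in> {0, 1}" using Suc(2)[of "Suc n"] by auto
  then have T: "gen (2 * Suc n) ^ \<delta> (Suc n) * gen (Suc (2 * Suc n)) ^ \<delta>' (Suc n) = bas ?T"
    using bas_mult_less[of "{2 * Suc n}" "{Suc (2 * Suc n)}"]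
    by (elim insertE emptyE) (simp_all add: bas_empty gen_def insert_commute)
  have "exps_set (Suc n) \<delta> \<delta>' = exps_set n \<delta> \<delta>' \<union> ?T"
  proof (intro subset_antisym subsetI)
    fix j assume "j \<in> exps_set (Suc n) \<delta> \<delta>'"
    then show "j \<in> exps_set n \<delta> \<delta>' \<union> ?T"
      by (cases "even j") (auto simp: exps_set_def le_Suc_eq elim!: evenE oddE)
  qed (auto simp: exps_set_def split: if_splits)
  moreover have "bas (exps_set n \<delta> \<delta>') * bas ?T = bas (exps_set n \<delta> \<delta>' \<union> ?T)"
    by (rule bas_mult_less) (fastforce simp: exps_set_def split: if_splits)
  moreover have "prod_list (map (\<lambda>i. gen (2 * i) ^ \<delta> i * gen (Suc (2 * i)) ^ \<delta>' i) [1..<Suc (Suc n)]) =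
     bas (exps_set n \<delta> \<delta>') * (gen (2 * Suc n) ^ \<delta> (Suc n) * gen (Suc (2 * Suc n)) ^ \<delta>' (Suc n))"
    using Suc(1)[OF Suc(2)] by simp
  ultimately show ?case using T by simp
qed

lemma tau_map: "tau k (map f [k..<k + n]) = prod_list (map (\<lambda>i. shift i (psi_U (f i))) [k..<k + n])"
proof (induction n arbitrary: k)
  case (Suc n)
  have "[k..<k + Suc n] = k # [Suc k..<Suc k + n]" by (simp add: upt_conv_Cons)
  with Suc[of "Suc k"] show ?case by simp
qed simp

context pants_basis
begin

sublocale G: group_basis "pants_H1 p X q" k "JT p" b
  by (rule basis)

text \<open>\<open>E_i\<close> acts by contraction along \<open>e_i\<close>, so that a monomial without \<open>e_i\<close> has to match one with
  \<open>E_i\<close>: flipping the indices of all \<open>e_i\<close> turns the actions into multiplications.\<close>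

definition evens :: "nat set" where "evens = (*) 2 ` {1..p}"
definition psi_Z :: "'a state \<Rightarrow> ext" where "psi_Z A = flip evens (G.E.psi A)"

lemma finite_evens: "finite evens" and even_evens: "j \<in> evens \<Longrightarrow> even j"
  by (auto simp: evens_def)

lemma mem_evens: "2 * i \<in> evens \<longleftrightarrow> i \<in> {1..p}" "Suc (2 * i) \<notin> evens"
  unfolding evens_def by auto presburger

lemma card_evens: "card evens = p"
  unfolding evens_def by (subst card_image) (auto simp: inj_on_def)

lemma evens_subset: "evens \<subseteq> JT p"
  by (auto simp: evens_def JT_def)

lemma even_JT_evens: "j \<in> JT p \<Longrightarrow> even j \<Longrightarrow> j \<in> evens"
  by (auto simp: evens_def JT_def elim!: evenE)

lemma index_JT: "i \<in> {1..p} \<Longrightarrow> 2 * i \<in> JT p" "i \<in> {1..p} \<Longrightarrow> Suc (2 * i) \<in> JT p"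
  by (auto simp: JT_def)

text \<open>Of the indices of the arcs, \<open>i - 1\<close> lie below \<open>2 * i\<close> and i
  lie below \<open>2 * i + 1\<close>. These are the signs that the flip causes in the left
  action.\<close>

lemma below_evens:
  assumes "i \<in> {1..p}"
  shows "below (2 * i) evens = - ((- 1) ^ i)" "below (Suc (2 * i)) evens = (- 1) ^ i"
proof -
  have "{j \<in> evens. j < 2 * i} = (*) 2 ` {1..<i}" "{j \<in> evens. j < Suc (2 * i)} = (*) 2 ` {1..i}"
    using assms by (auto simp: evens_def)
  then have "card {j \<in> evens. j < 2 * i} = i - 1" "card {j \<in> evens. j < Suc (2 * i)} = i"
    by (simp_all add: card_image inj_on_def)
  then show "below (2 * i) evens = - ((- 1) ^ i)" "below (Suc (2 * i)) evens = (- 1) ^ i"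
    using assms by (cases i; simp add: parity_sign_def)+
qed

text \<open>The value equals the orientation sign of \<open>e_i\<close> and
  \<open>\<sigma>_i\<close>, against which it cancels in the right action.\<close>

lemma above_evens:
  assumes "i \<in> {1..p}"
  shows "above (2 * i) evens = (- 1) ^ (p - i)" "above (Suc (2 * i)) evens = (- 1) ^ (p - i)"
proof -
  have "{j \<in> evens. 2 * i < j} = (*) 2 ` {i<..p}" "{j \<in> evens. Suc (2 * i) < j} = (*) 2 ` {i<..p}"
    using assms by (auto simp: evens_def)
  then have "card {j \<in> evens. 2 * i < j} = p - i" "card {j \<in> evens. Suc (2 * i) < j} = p - i"
    by (simp_all add: card_image inj_on_def)
  then show "above (2 * i) evens = (- 1) ^ (p - i)" "above (Suc (2 * i)) evens = (- 1) ^ (p - i)"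
    by (simp_all add: parity_sign_def)
qed

lemma pants_state_simps [simp]:
  "carrier (pants_state p X q) = carrier (exterior (pants_H1 p X q))"
  "\<zero>\<^bsub>pants_state p X q\<^esub> = \<zero>\<^bsub>exterior (pants_H1 p X q)\<^esub>"
  "A \<oplus>\<^bsub>pants_state p X q\<^esub> B = A \<oplus>\<^bsub>exterior (pants_H1 p X q)\<^esub> B"
  by (simp_all add: pants_state_def)

text \<open>Flipping the indices of the p arcs lowers the exterior degree by p and shifts the parity
  by p, which is the regrading built into \<open>pants_state\<close>.\<close>

lemma dgs_flip:
  assumes "S \<subseteq> JT p"
  shows "dgs (sym_diff S evens) = (d, c) \<longleftrightarrow> G.E.dgs S = (d + int p, c + of_nat (p mod 2))"
proof -
  have f: "finite S" using assms finite_JT by (rule finite_subset)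
  have "dgs (sym_diff S evens) + (int p, of_nat p) = G.E.dgs S"
    using dgs_sym_diff[OF f finite_evens] assms even_evens even_JT_evens
    by (auto simp: G.dgs_card[OF f] card_evens)
  moreover have "(of_nat (p mod 2) :: bit) = of_nat p"
    by (cases "even p") (auto simp: bit_of_nat_iff even_iff_mod_2_eq_zero odd_iff_mod_2_eq_one)
  ultimately show ?thesis by (cases "dgs (sym_diff S evens)") auto
qed

lemma flip_evens_supp: "v \<in> supp_in (Pow (JT p)) \<Longrightarrow> flip evens v \<in> supp_in (Pow (JT p))"
  by (erule flip_supp) (use evens_subset in auto)

sublocale Z: ext_model "pants_state p X q" psi_Z "JT p" dgs
proof
  have fb: "bij_betw (flip evens) (supp_in (Pow (JT p))) (supp_in (Pow (JT p)))"
    by (rule bij_betw_byWitness[where f' = "flip evens"]) (auto simp: flip_flip[OF finite_evens] flip_evens_supp)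
  show "bij_betw psi_Z (carrier (pants_state p X q)) (supp_in (Pow (JT p)))"
    using bij_betw_trans[OF G.X.bij fb] by (simp add: psi_Z_def[abs_def] o_def)
  show "hpart (pants_state p X q) d \<subseteq> carrier (pants_state p X q)" for d
    using G.X.hpart_closed by (cases d) (simp add: pants_state_def)
  show "psi_Z ` hpart (pants_state p X q) d = supp_in {S \<in> Pow (JT p). dgs S = d}" for d
  proof -
    obtain n c where d: "d = (n, c)" by (cases d)
    let ?d = "(n + int p, c + of_nat (p mod 2))"
    have sd: "sym_diff (sym_diff S evens) evens = S" for S by auto
    have "psi_Z ` hpart (pants_state p X q) d = flip evens ` (G.E.psi ` hpart (exterior (pants_H1 p X q)) ?d)"
      by (simp add: pants_state_def d psi_Z_def[abs_def] image_image)
    also have "\<dots> = flip evens ` supp_in {S \<in> Pow (JT p). G.E.dgs S = ?d}" unfolding G.X.psi_hpart ..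
    also have "\<dots> = supp_in {S \<in> Pow (JT p). dgs S = d}"
    proof (intro subset_antisym subsetI)
      fix v assume "v \<in> flip evens ` supp_in {S \<in> Pow (JT p). G.E.dgs S = ?d}"
      then obtain w where w: "v = flip evens w" "w \<in> supp_in {S \<in> Pow (JT p). G.E.dgs S = ?d}" by blast
      show "v \<in> supp_in {S \<in> Pow (JT p). dgs S = d}"
        unfolding w(1) by (rule flip_supp[OF w(2)]) (use evens_subset in \<open>auto simp: dgs_flip d\<close>)
    next
      fix v assume v: "v \<in> supp_in {S \<in> Pow (JT p). dgs S = d}"
      have "flip evens v \<in> supp_in {S \<in> Pow (JT p). G.E.dgs S = ?d}"
      proof (rule flip_supp[OF v])
        fix S assume S: "S \<in> {S \<in> Pow (JT p). dgs S = d}"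
        then have "sym_diff S evens \<subseteq> JT p" using evens_subset by auto
        with S show "sym_diff S evens \<in> {S \<in> Pow (JT p). G.E.dgs S = ?d}"
          using dgs_flip[of "sym_diff S evens" n c] unfolding sd by (simp add: d)
      qed
      then show "v \<in> flip evens ` supp_in {S \<in> Pow (JT p). G.E.dgs S = ?d}"
        by (rule image_eqI[rotated]) (simp add: flip_flip[OF finite_evens])
    qed
    finally show ?thesis .
  qed
qed (auto simp: psi_Z_def finite_JT flip_additive G.X.psi_add G.X.add_mem)

end

context pants_basis
begin

section \<open>The two actions in coordinates\<close>

abbreviation (input) "HP \<equiv> pants_H1 p X q"

text \<open>The outer circle is closed and winds once around every hole, so it is the sum of the
  inner circles run against their boundary orientation; the signs express these by the
  \<open>\<sigma>_i\<close>.\<close>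

lemma val_boundary_0: "G.E.val (boundary_class p X C q 0) = (\<Sum>i\<in>{1..p}. of_int ((- 1) ^ (p - i)) * gen (Suc (2 * i)))"
proof -
  have "G.E.val (boundary_class p X C q 0) = (\<Sum>j\<in>(\<lambda>i. Suc (2 * i)) ` {1..p}. of_int ((- 1) ^ (p - j div 2)) * gen j)"
    unfolding G.E.val_def
    by (rule sum.mono_neutral_cong_right[OF finite_JT]) (auto simp: index_JT k_bc_0 JT_def elim!: oddE)
  also have "\<dots> = (\<Sum>i\<in>{1..p}. of_int ((- 1) ^ (p - i)) * gen (Suc (2 * i)))"
    by (subst sum.reindex) (auto simp: inj_on_def intro!: sum.cong)
  finally show ?thesis .
qed

lemma val_inv_boundary:
  assumes i: "i \<in> {1..p}"
  shows "G.E.val (inv\<^bsub>HP\<^esub> (boundary_class p X C q i)) = of_int ((- 1) ^ (p - i)) * gen (Suc (2 * i))"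
proof -
  have "G.E.val (inv\<^bsub>HP\<^esub> (boundary_class p X C q i)) =
      (\<Sum>j\<in>JT p. if j = Suc (2 * i) then of_int ((- 1) ^ (p - i)) * gen (Suc (2 * i)) else 0)"
    unfolding G.E.val_def using i bc_closed[of i] by (intro sum.cong refl) (auto simp: G.k_inv k_bc)
  then show ?thesis using index_JT[OF i] finite_JT by simp
qed

text \<open>For both generators the i-th summand acquires \<open>(-1) ^ (p - i)\<close> from the
  orientations and \<open>(-1) ^ i\<close> from the flip. The product is \<open>(-1) ^ p\<close> for
  every i, which the factor \<open>(-1) ^ \<pi>\<close> of the action removes.\<close>

lemma left_gen_model:
  assumes A: "A \<in> carrier (exterior HP)"
  shows "left_gen p X C q g A \<in> carrier (exterior HP)" and "psi_Z (left_gen p X C q g A) = coprod_gen p (gidx g) * psi_Z A"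
proof -
  have sgn: "of_int ((- 1) ^ (p mod 2)) * (\<Sum>i\<in>{1..p}. of_int (n i) * v i) = (\<Sum>i\<in>{1..p}. v i)"
    if "\<And>i. i \<in> {1..p} \<Longrightarrow> (- 1) ^ (p mod 2) * n i = 1" for n and v :: "nat \<Rightarrow> ext"
    unfolding sum_distrib_left of_int_of_int_mult using that by (intro sum.cong refl) simp
  have p2: "(- 1 :: int) ^ (p mod 2) = (- 1) ^ p" by (cases "even p") (auto simp: even_iff_mod_2_eq_zero odd_iff_mod_2_eq_one)
  have e: "(- 1 :: int) ^ (p mod 2) * ((- 1) ^ (p - i) * (- 1) ^ i) = 1" if "i \<in> {1..p}" for i
    using that by (simp add: p2 flip: power_add mult_2)
  have "left_gen p X C q g A \<in> carrier (exterior HP) \<and> psi_Z (left_gen p X C q g A) = coprod_gen p (gidx g) * psi_Z A"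
  proof (cases g)
    case GenE
    \<comment> \<open>Contraction with the boundary coefficient at \<open>q 0\<close>, written
      through its coordinate expansion.\<close>
    define D where "D v = (\<Sum>i\<in>{1..p}. of_int (- ((- 1) ^ (p - i))) * lcon (2 * i) v)" for v
    have D_diff: "D (v - w) = D v - D w" for v w
      by (simp add: D_def lcon_additive right_diff_distrib sum_subtractf sum_negf)
    have D1: "D 1 = 0" using lcon_bas[of "{}"] by (simp add: D_def bas_empty)
    have D_val: "D (G.E.val x * v) = of_int (pants_phi p X q 0 x) * v - G.E.val x * D v" if "x \<in> carrier HP" for x v
    proof -
      have "D (G.E.val x * v) = (\<Sum>i\<in>{1..p}. of_int (- ((- 1) ^ (p - i)) * k x (2 * i)) * v -
          G.E.val x * (of_int (- ((- 1) ^ (p - i))) * lcon (2 * i) v))"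
        unfolding D_def
        by (intro sum.cong refl) (simp only: G.lcon_val[OF index_JT(1)] right_diff_distrib of_int_of_int_mult mult_of_int_left[of "G.E.val x"])
      also have "\<dots> = of_int (pants_phi p X q 0 x) * v - G.E.val x * D v"
        unfolding phi_0[OF that] D_def sum_subtractf by (simp only: of_int_sum sum_distrib_left sum_distrib_right)
      finally show ?thesis .
    qed
    have D_prod: "D (prod_list (map G.E.val xs)) =
      (\<Sum>m<length xs. of_int ((- 1) ^ m * pants_phi p X q 0 (xs ! m)) * prod_list (map G.E.val (take m xs @ drop (Suc m) xs)))"
      if "set xs \<subseteq> carrier HP" for xs
      by (rule left_contraction_prod[OF D1 D_val]) (use that in auto)
    note * = G.contraction_model[of D "\<lambda>m xs. (- 1) ^ m * pants_phi p X q 0 (xs ! m)", OF D_diff D_prod A]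
    \<comment> \<open>The minus sign of the coefficient at \<open>q 0\<close> meets the one in
      \<open>below (2 * i) evens\<close>.\<close>
    have "flip evens (D (G.E.psi A)) = (\<Sum>i\<in>{1..p}. of_int ((- 1) ^ (p - i) * (- 1) ^ i) * (gen (2 * i) * psi_Z A))"
      unfolding D_def flip_sum psi_Z_def
      by (intro sum.cong refl)
         (simp only: flip_additive flip_lcon[OF finite_evens] mem_evens below_evens of_int_of_int_mult mult_minus_left mult_minus_right minus_minus)
    then have "of_int ((- 1) ^ (p mod 2)) * flip evens (D (G.E.psi A)) = coprod_gen p 0 * psi_Z A"
      using sgn[OF e] by (simp only: coprod_gen_def sum_distrib_right add_0_right)
    then show ?thesis using * GenE
      by (simp add: Let_def G.X.psi_int_pow psi_Z_def flip_additive del: of_int_power)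
  next
    case GenF
    let ?w = "wedge HP [boundary_class p X C q 0]"
    have w: "?w \<in> carrier (exterior HP)" by (intro G.wedge_closed) (simp add: bc_closed)
    have "flip evens (G.E.val (boundary_class p X C q 0) * G.E.psi A) = (\<Sum>i\<in>{1..p}. of_int ((- 1) ^ (p - i) * (- 1) ^ i) * (gen (2 * i + 1) * psi_Z A))"
      unfolding val_boundary_0 sum_distrib_right flip_sum psi_Z_def mult.assoc
      by (intro sum.cong refl)
         (simp only: flip_additive flip_gen_mult[OF finite_evens mem_evens(2)] below_evens of_int_of_int_mult Suc_eq_plus1[symmetric])
    then have "of_int ((- 1) ^ (p mod 2)) * flip evens (G.E.val (boundary_class p X C q 0) * G.E.psi A) = coprod_gen p 1 * psi_Z A"
      using sgn[OF e] by (simp only: coprod_gen_def sum_distrib_right)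
    then show ?thesis using w A GenF
      by (simp add: Let_def G.X.psi_int_pow G.X.mult_mem G.X.psi_mult G.psi_wedge psi_Z_def flip_additive del: of_int_power)
  qed
  then show "left_gen p X C q g A \<in> carrier (exterior HP)" "psi_Z (left_gen p X C q g A) = coprod_gen p (gidx g) * psi_Z A"
    by blast+
qed

text \<open>Orientation and flip both contribute \<open>(-1) ^ (p - i)\<close> here, so the signs
  cancel for each i separately and no overall factor is left.\<close>

lemma right_gen_model:
  assumes i: "i \<in> {1..p}" and A: "A \<in> carrier (exterior HP)"
  shows "right_gen p X C q i g A \<in> carrier (exterior HP)" and "psi_Z (right_gen p X C q i g A) = psi_Z A * gen (2 * i + gidx g)"
proof -
  have ss: "of_int ((- 1) ^ n) * (of_int ((- 1) ^ n) * v) = (v :: ext)" for n v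
    by (rule of_int_sq_mult) (simp flip: power_add mult_2)
  have "right_gen p X C q i g A \<in> carrier (exterior HP) \<and> psi_Z (right_gen p X C q i g A) = psi_Z A * gen (2 * i + gidx g)"
  proof (cases g)
    case GenE
    define D where "D v = of_int ((- 1) ^ (p - i)) * rcon (2 * i) v" for v
    have D_diff: "D (v - w) = D v - D w" for v w
      by (simp add: D_def rcon_additive right_diff_distrib)
    have D1: "D 1 = 0" using rcon_bas[of "{}"] by (simp add: D_def bas_empty)
    have D_val: "D (v * G.E.val x) = of_int (pants_phi p X q i x) * v - D v * G.E.val x" if "x \<in> carrier HP" for x v
      unfolding D_def G.rcon_val[OF index_JT(1)[OF i]] phi_i[OF that i]
      by (simp add: right_diff_distrib mult.assoc)
    have D_prod: "D (prod_list (map G.E.val xs)) =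
      (\<Sum>m<length xs. of_int ((- 1) ^ (length xs - Suc m) * pants_phi p X q i (xs ! m)) * prod_list (map G.E.val (take m xs @ drop (Suc m) xs)))"
      if "set xs \<subseteq> carrier HP" for xs
      by (rule right_contraction_prod[OF D1 D_val]) (use that in auto)
    note * = G.contraction_model[of D "\<lambda>m xs. (- 1) ^ (length xs - Suc m) * pants_phi p X q i (xs ! m)", OF D_diff D_prod A]
    have "flip evens (D (G.E.psi A)) = psi_Z A * gen (2 * i)"
      using i by (simp only: D_def flip_additive flip_rcon[OF finite_evens] mem_evens above_evens ss psi_Z_def)
    then show ?thesis using * GenE by (simp add: Let_def psi_Z_def)
  next
    case GenF
    let ?w = "wedge HP [inv\<^bsub>HP\<^esub> (boundary_class p X C q i)]"
    have w: "?w \<in> carrier (exterior HP)" using i by (intro G.wedge_closed) (simp add: bc_closed)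
    have "flip evens (G.E.psi A * G.E.val (inv\<^bsub>HP\<^esub> (boundary_class p X C q i))) = psi_Z A * gen (Suc (2 * i))"
      unfolding val_inv_boundary[OF i] mult_of_int_left
      by (simp only: flip_additive flip_mult_gen[OF finite_evens mem_evens(2)] above_evens[OF i] ss psi_Z_def)
    then show ?thesis using w A GenF
      by (simp add: Let_def G.X.mult_mem G.X.psi_mult G.psi_wedge psi_Z_def)
  qed
  then show "right_gen p X C q i g A \<in> carrier (exterior HP)" "psi_Z (right_gen p X C q i g A) = psi_Z A * gen (2 * i + gidx g)"
    by blast+
qed

lemma pants_left_model:
  assumes u: "u \<in> carrier U_ring" and A: "A \<in> carrier (exterior HP)"
  shows "pants_left p X C q u A \<in> carrier (exterior HP)" "psi_Z (pants_left p X C q u A) = coprod p (psi_U u) * psi_Z A"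
proof -
  let ?w = "\<lambda>w. prod_list (map (\<lambda>g. gen (gidx g)) w)"
  let ?f = "\<lambda>w. foldr (left_gen p X C q) w A"
  have f: "?f w \<in> carrier (exterior HP) \<and> psi_Z (?f w) = coprod p (?w w) * psi_Z A" for w
    by (induction w) (simp_all add: A left_gen_model coprod_mult mult.assoc)
  have lin: "lin (\<lambda>w. coprod p (?w w) * psi_Z A) c = coprod p (psi_U u) * psi_Z A" if "c \<in> u" for c
    unfolding lin_mult_right U_elem(2)[OF u that, symmetric]
    by (subst lin_compose_additive[where F = "coprod p"]) (simp_all add: extmap_additive)
  note * = Z.coset_ext_model[where h = "\<lambda>w. coprod p (?w w) * psi_Z A", OF U_elem(1)[OF u] _ lin]
  show "pants_left p X C q u A \<in> carrier (exterior HP)" "psi_Z (pants_left p X C q u A) = coprod p (psi_U u) * psi_Z A"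
    unfolding pants_left_def pants_state_simps(1)[symmetric] by (rule *; simp add: f)+
qed

lemma pants_right_factor_model:
  assumes i: "i \<in> {1..p}" and u: "u \<in> carrier U_ring" and A: "A \<in> carrier (exterior HP)"
  shows "pants_right_factor p X C q i A u \<in> carrier (exterior HP)" "psi_Z (pants_right_factor p X C q i A u) = psi_Z A * shift i (psi_U u)"
proof -
  let ?w = "\<lambda>w. prod_list (map (\<lambda>g. gen (gidx g)) w)"
  let ?f = "\<lambda>w. foldl (\<lambda>B g. right_gen p X C q i g B) A w"
  have f: "?f w \<in> carrier (exterior HP) \<and> psi_Z (?f w) = psi_Z A * shift i (?w w)" for w
    by (induction w rule: rev_induct) (simp_all add: A right_gen_model[OF i] shift_mult mult.assoc)
  have lin: "lin (\<lambda>w. psi_Z A * shift i (?w w)) c = psi_Z A * shift i (psi_U u)" if "c \<in> u" for c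
    unfolding lin_mult_left U_elem(2)[OF u that, symmetric]
    by (subst lin_compose_additive[where F = "shift i"]) (simp_all add: shift_additive)
  note * = Z.coset_ext_model[where h = "\<lambda>w. psi_Z A * shift i (?w w)", OF U_elem(1)[OF u] _ lin]
  show "pants_right_factor p X C q i A u \<in> carrier (exterior HP)" "psi_Z (pants_right_factor p X C q i A u) = psi_Z A * shift i (psi_U u)"
    unfolding pants_right_factor_def pants_state_simps(1)[symmetric] by (rule *; simp add: f)+
qed

lemma pants_right_model:
  assumes t: "t \<in> carrier (tensor_power U_ring p)" and A: "A \<in> carrier (exterior HP)"
  shows "pants_right p X C q A t \<in> carrier (exterior HP)" "psi_Z (pants_right p X C q A t) = psi_Z A * psi_T t"
proof -
  let ?f = "\<lambda>as. foldl (\<lambda>B (i, a). pants_right_factor p X C q i B a) A (zip [1..<Suc p] as)"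
  \<comment> \<open>The induction needs suffixes of the tensor that start in an arbitrary factor m
    and act on an arbitrary state.\<close>
  have gen: "foldl (\<lambda>B (i, a). pants_right_factor p X C q i B a) A (zip [m..<m + length as] as) \<in> carrier (exterior HP) \<and>
      psi_Z (foldl (\<lambda>B (i, a). pants_right_factor p X C q i B a) A (zip [m..<m + length as] as)) = psi_Z A * tau m as"
    if "set as \<subseteq> carrier U_ring" "1 \<le> m" "m + length as \<le> Suc p" "A \<in> carrier (exterior HP)" for as m A
    using that
  proof (induction as arbitrary: m A)
    case (Cons a as)
    have l: "[m..<m + length (a # as)] = m # [Suc m..<Suc m + length as]" by (simp add: upt_conv_Cons del: upt_Suc)
    have "m \<in> {1..p}" "a \<in> carrier U_ring" using Cons by auto
    note r = pants_right_factor_model[OF this Cons(5)]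
    show ?case unfolding l using Cons(1)[of "Suc m" "pants_right_factor p X C q m A a"] Cons(2-4) r
      by (simp add: mult.assoc)
  qed simp
  have f: "?f as \<in> carrier (exterior HP) \<and> psi_Z (?f as) = psi_Z A * tau 1 as" if "c \<in> t" "as \<in> Poly_Mapping.keys c" for c as
  proof -
    have "as \<in> tensor_gens U_ring p" using TP_elem(2)[OF t that(1)] that(2) by blast
    then have "length as = p" "set as \<subseteq> carrier U_ring" using homU_closed by (auto simp: tensor_gens_iff)
    then show ?thesis using gen[of as 1] A by simp
  qed
  have lin: "lin (\<lambda>as. psi_Z A * tau 1 as) c = psi_Z A * psi_T t" if "c \<in> t" for c
    using TP_elem(2)[OF t that] by (simp add: lin_mult_left)
  note * = Z.coset_ext_model[where h = "\<lambda>as. psi_Z A * tau 1 as", OF TP_elem(1)[OF t] _ lin]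
  show "pants_right p X C q A t \<in> carrier (exterior HP)" "psi_Z (pants_right p X C q A t) = psi_Z A * psi_T t"
    unfolding pants_right_def pants_state_simps(1)[symmetric] by (rule *; use f in simp)+
qed

section \<open>The map on basis elements\<close>

lemma basis_wedge_model:
  assumes \<delta>: "\<And>i. i \<in> {1..p} \<Longrightarrow> \<delta> i \<in> {0, 1} \<and> \<delta>' i \<in> {0, 1}"
  shows "basis_wedge p X C q e \<delta> \<delta>' \<in> carrier (exterior HP)" "psi_Z (basis_wedge p X C q e \<delta> \<delta>') = flip evens (bas (exps_set p \<delta> \<delta>'))"
proof -
  define xs where "xs = concat (map (\<lambda>i. replicate (\<delta> i) (b (2 * i)) @ replicate (\<delta>' i) (b (Suc (2 * i)))) [1..<Suc p])"
  have w: "basis_wedge p X C q e \<delta> \<delta>' = wedge HP xs"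
    unfolding basis_wedge_def xs_def
    by (intro arg_cong[where f = "wedge HP"] arg_cong[where f = concat] map_cong refl) (auto simp: b_even b_odd)
  have "set xs \<subseteq> carrier HP" using index_JT by (auto simp: xs_def G.b_closed)
  then show "basis_wedge p X C q e \<delta> \<delta>' \<in> carrier (exterior HP)" unfolding w by (rule G.wedge_closed)
  have pc: "prod_list (map f (concat xss)) = prod_list (map (\<lambda>xs. prod_list (map f xs)) xss)" for f :: "'a H1_class \<Rightarrow> ext" and xss
    by (induction xss) auto
  have "prod_list (map G.E.val xs) = prod_list (map (\<lambda>i. gen (2 * i) ^ \<delta> i * gen (Suc (2 * i)) ^ \<delta>' i) [1..<Suc p])"
    unfolding xs_def pc map_map o_def
    by (intro arg_cong[where f = prod_list] map_cong refl) (auto simp: G.val_b index_JT prod_list_replicate)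
  then show "psi_Z (basis_wedge p X C q e \<delta> \<delta>') = flip evens (bas (exps_set p \<delta> \<delta>'))"
    unfolding w psi_Z_def G.psi_wedge using prod_list_exps_set[of p \<delta> \<delta>', OF \<delta>] by (simp only:)
qed

lemma finite_exps_set: "finite (exps_set p \<delta> \<delta>')"
  by (rule finite_subset[OF _ finite_JT[of p]]) (auto simp: exps_set_def JT_def)

lemma basis_tensor_model:
  assumes \<delta>: "\<And>i. i \<in> {1..p} \<Longrightarrow> \<delta> i \<in> {0, 1} \<and> \<delta>' i \<in> {0, 1}"
  shows "basis_tensor p \<delta> \<delta>' \<in> carrier (tensor_power U_ring p)" "psi_T (basis_tensor p \<delta> \<delta>') = flip evens (bas (exps_set p \<delta> \<delta>'))"
proof -
  interpret U: ring U_ring by (rule U.ring_M)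
  define f where "f i = U_gen GenE [^]\<^bsub>U_ring\<^esub> (1 - \<delta> i) \<otimes>\<^bsub>U_ring\<^esub> U_gen GenF [^]\<^bsub>U_ring\<^esub> \<delta>' i" for i
  have pow: "U_gen g [^]\<^bsub>U_ring\<^esub> n \<in> homU \<and> psi_U (U_gen g [^]\<^bsub>U_ring\<^esub> n) = gen (gidx g) ^ n" if "n \<in> {0, 1}" for g and n :: nat
    using that U_gen_homU U_one_homU by (auto simp: U.psi_one U_gen_closed psi_U_gen)
  have f: "f i \<in> homU" "psi_U (f i) = gen 0 ^ (1 - \<delta> i) * gen (Suc 0) ^ \<delta>' i" if "i \<in> {1..p}" for i
    using pow[of "1 - \<delta> i" GenE] pow[of "\<delta>' i" GenF] \<delta>[OF that] homU_closed
    by (auto simp: f_def homU_mult U.psi_mult subset_iff)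
  have tg: "map f [1..<Suc p] \<in> tensor_gens U_ring p" using f by (auto simp: tensor_gens_iff)
  have b: "basis_tensor p \<delta> \<delta>' = pure_tensor U_ring (map f [1..<Suc p])" by (simp only: basis_tensor_def f_def[abs_def])
  show "basis_tensor p \<delta> \<delta>' \<in> carrier (tensor_power U_ring p)" unfolding b by (rule pure_tensor_TP[OF tg])
  have spow: "shift i (v ^ n) = shift i v ^ n" for i v n by (induction n) (simp_all add: shift_mult)
  have "psi_T (basis_tensor p \<delta> \<delta>') = prod_list (map (\<lambda>i. shift i (psi_U (f i))) [1..<Suc p])"
    using tau_map[of 1 f p] unfolding b pure_tensor_TP(2)[OF tg] by simp
  also have "\<dots> = prod_list (map (\<lambda>i. gen (2 * i) ^ (1 - \<delta> i) * gen (Suc (2 * i)) ^ \<delta>' i) [1..<Suc p])"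
    by (intro arg_cong[where f = prod_list] map_cong refl) (auto simp: f shift_mult spow)
  also have "\<dots> = bas (exps_set p (\<lambda>i. 1 - \<delta> i) \<delta>')"
    by (rule prod_list_exps_set) (use \<delta> in auto)
  \<comment> \<open>The exponent of E is \<open>1 - \<delta> i\<close>, so the tensor differs from
    the wedge by toggling exactly the indices of the arcs.\<close>
  also have "exps_set p (\<lambda>i. 1 - \<delta> i) \<delta>' = sym_diff (exps_set p \<delta> \<delta>') evens"
  proof (rule Set.set_eqI)
    fix j show "j \<in> exps_set p (\<lambda>i. 1 - \<delta> i) \<delta>' \<longleftrightarrow> j \<in> sym_diff (exps_set p \<delta> \<delta>') evens"
      using \<delta>[of "j div 2"] by (cases "even j") (auto simp: exps_set_mem mem_evens elim!: evenE oddE)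
  qed
  finally show "psi_T (basis_tensor p \<delta> \<delta>') = flip evens (bas (exps_set p \<delta> \<delta>'))"
    by (simp add: flip_bas[OF finite_exps_set])
qed

lemma exps_set_exists:
  assumes "S \<subseteq> JT p"
  shows "\<exists>\<delta> \<delta>'. (\<forall>i\<in>{1..p}. \<delta> i \<in> {0, 1} \<and> \<delta>' i \<in> {0, 1}) \<and> exps_set p \<delta> \<delta>' = S"
proof (intro exI conjI)
  show "exps_set p (\<lambda>i. of_bool (2 * i \<in> S)) (\<lambda>i. of_bool (Suc (2 * i) \<in> S)) = S"
  proof (rule Set.set_eqI)
    fix j show "j \<in> exps_set p (\<lambda>i. of_bool (2 * i \<in> S)) (\<lambda>i. of_bool (Suc (2 * i) \<in> S)) \<longleftrightarrow> j \<in> S"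
      using assms by (cases "even j") (auto simp: exps_set_mem JT_def elim!: evenE oddE)
  qed
qed auto

sublocale T: ext_ring_model "tensor_power U_ring p" psi_T "JT p" dgs
  by (rule TP_model)

text \<open>Basis wedges cover all monomials, so additivity determines the map. In coordinates it is
  the identity, because the flip is already part of \<open>psi_Z\<close>.\<close>

lemma pants_map_model:
  assumes \<Phi>: "is_pants_map p X C q e \<Phi>" and A: "A \<in> carrier (exterior HP)"
  shows "\<Phi> A \<in> carrier (tensor_power U_ring p)" "psi_T (\<Phi> A) = psi_Z A"
proof -
  have mem: "\<Phi> A \<in> carrier (tensor_power U_ring p)" if "A \<in> carrier (exterior HP)" for A
    using \<Phi> that by (auto simp: is_pants_map_def hom_def)
  have add: "\<Phi> (A \<oplus>\<^bsub>exterior HP\<^esub> B) = \<Phi> A \<oplus>\<^bsub>tensor_power U_ring p\<^esub> \<Phi> B" if "A \<in> carrier (exterior HP)" "B \<in> carrier (exterior HP)" for A B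
    using \<Phi> that by (auto simp: is_pants_map_def hom_def)
  show "\<Phi> A \<in> carrier (tensor_power U_ring p)" by (rule mem[OF A])
  have "\<forall>A\<in>carrier (exterior HP). G.E.psi A = v \<longrightarrow> psi_T (\<Phi> A) = flip evens v" if "v \<in> supp_in (Pow (JT p))" for v
  proof -
    \<comment> \<open>Compatibility of \<open>\<Phi>\<close> is given for sums, so a difference is
      rewritten as a sum. Three equal arguments yield the value at zero.\<close>
    have sub: "psi_T (\<Phi> A) = psi_T (\<Phi> B) - psi_T (\<Phi> B')"
      if "A \<in> carrier (exterior HP)" "B \<in> carrier (exterior HP)" "B' \<in> carrier (exterior HP)" "G.E.psi A = G.E.psi B - G.E.psi B'" for A B B'
    proof -
      have "B = A \<oplus>\<^bsub>exterior HP\<^esub> B'" using that by (intro G.X.psi_inj) (simp_all add: G.X.add_mem G.X.psi_add)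
      then show ?thesis using that by (simp add: add mem T.psi_add)
    qed
    have "v \<in> supp_in (Pow (JT p)) \<and> (\<forall>A\<in>carrier (exterior HP). G.E.psi A = v \<longrightarrow> psi_T (\<Phi> A) = flip evens v)"
      using that
    proof (induction v rule: ext_supp_induct)
      case zero
      show ?case using sub[of A A A for A] by (simp add: flip_additive)
    next
      case (bas S)
      then have "S \<subseteq> JT p" by simp
      then obtain \<delta> \<delta>' where d: "\<And>i. i \<in> {1..p} \<Longrightarrow> \<delta> i \<in> {0, 1} \<and> \<delta>' i \<in> {0, 1}" "exps_set p \<delta> \<delta>' = S"
        using exps_set_exists by blast
      let ?B = "basis_wedge p X C q e \<delta> \<delta>'"
      have B: "?B \<in> carrier (exterior HP)" "psi_Z ?B = flip evens (bas S)" using basis_wedge_model[of \<delta> \<delta>', OF d(1)] d(2) by auto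
      then have "G.E.psi ?B = bas S" unfolding psi_Z_def by (metis flip_flip[OF finite_evens])
      moreover have "\<Phi> ?B = basis_tensor p \<delta> \<delta>'" using \<Phi> d(1) unfolding is_pants_map_def by blast
      then have "psi_T (\<Phi> ?B) = flip evens (bas S)" using basis_tensor_model(2)[of \<delta> \<delta>', OF d(1)] d(2) by simp
      ultimately have "psi_T (\<Phi> A) = flip evens (bas S)" if "A \<in> carrier (exterior HP)" "G.E.psi A = bas S" for A
        using G.X.psi_inj[of A ?B] B that by auto
      then show ?case using \<open>S \<subseteq> JT p\<close> by (auto intro!: supp_in_bas)
    next
      case (diff v w)
      obtain B B' where B: "B \<in> carrier (exterior HP)" "G.E.psi B = v" "B' \<in> carrier (exterior HP)" "G.E.psi B' = w"
        using G.X.psi_surj diff by metis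
      then show ?case using diff sub[OF _ B(1,3)] by (simp add: supp_in_diff flip_additive)
    qed
    then show ?thesis by blast
  qed
  then show "psi_T (\<Phi> A) = psi_Z A" using A G.X.psi_supp[OF A] by (simp add: psi_Z_def)
qed

text \<open>The map is obtained by matching coordinates on both sides; restricting it to the carrier
  fixes its values elsewhere, so that uniqueness as a function can hold.\<close>

lemma pants_map_exists: "\<exists>\<Phi>. \<Phi> \<in> extensional (carrier (exterior HP)) \<and> is_pants_map p X C q e \<Phi>"
proof -
  have "\<forall>A. \<exists>t. A \<in> carrier (exterior HP) \<longrightarrow> t \<in> carrier (tensor_power U_ring p) \<and> psi_T t = psi_Z A"
    using T.psi_surj Z.psi_supp by (metis pants_state_simps(1))
  then obtain f where f: "f A \<in> carrier (tensor_power U_ring p)" "psi_T (f A) = psi_Z A" if "A \<in> carrier (exterior HP)" for A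
    by metis
  define \<Phi> where "\<Phi> = restrict f (carrier (exterior HP))"
  have "is_pants_map p X C q e \<Phi>"
    unfolding is_pants_map_def
  proof (intro conjI allI impI)
    show "\<Phi> \<in> hom (add_monoid (pants_state p X q)) (add_monoid (tensor_power U_ring p))"
    proof (rule homI)
      fix A B assume "A \<in> carrier (add_monoid (pants_state p X q))" "B \<in> carrier (add_monoid (pants_state p X q))"
      then have "A \<in> carrier (exterior HP)" "B \<in> carrier (exterior HP)" by simp_all
      then have "\<Phi> (A \<oplus>\<^bsub>exterior HP\<^esub> B) = \<Phi> A \<oplus>\<^bsub>tensor_power U_ring p\<^esub> \<Phi> B"
        using Z.psi_add[of A B] by (intro T.psi_inj) (simp_all add: \<Phi>_def f G.X.add_mem T.add_mem T.psi_add)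
      then show "\<Phi> (A \<otimes>\<^bsub>add_monoid (pants_state p X q)\<^esub> B) = \<Phi> A \<otimes>\<^bsub>add_monoid (tensor_power U_ring p)\<^esub> \<Phi> B" by simp
    qed (simp add: \<Phi>_def f)
    fix \<delta> \<delta>' assume "\<forall>i\<in>{1..p}. \<delta> i \<in> {0, 1 :: nat} \<and> \<delta>' i \<in> {0, 1 :: nat}"
    then have d: "\<And>i. i \<in> {1..p} \<Longrightarrow> \<delta> i \<in> {0, 1} \<and> \<delta>' i \<in> {0, 1}" by blast
    show "\<Phi> (basis_wedge p X C q e \<delta> \<delta>') = basis_tensor p \<delta> \<delta>'"
      using basis_wedge_model[of \<delta> \<delta>', OF d] basis_tensor_model[of \<delta> \<delta>', OF d]
      by (intro T.psi_inj) (simp_all add: \<Phi>_def f)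
  qed
  then show ?thesis by (intro exI[of _ \<Phi>]) (simp add: \<Phi>_def)
qed

lemma pants_map_bimodule_iso:
  assumes \<Phi>: "is_pants_map p X C q e \<Phi>"
  shows "graded_bimodule_iso U_ring (tensor_power U_ring p)
         (pants_state p X q) (pants_left p X C q) (pants_right p X C q)
         (tensor_power U_ring p)
         (\<lambda>u t. iter_coproduct (p - 1) u \<otimes>\<^bsub>tensor_power U_ring p\<^esub> t)
         (\<lambda>t s. t \<otimes>\<^bsub>tensor_power U_ring p\<^esub> s) \<Phi>"
proof -
  let ?Z = "pants_state p X q" and ?T = "tensor_power U_ring p"
  have ic: "iter_coproduct (p - 1) u \<in> carrier ?T" "psi_T (iter_coproduct (p - 1) u) = coprod p (psi_U u)" if "u \<in> carrier U_ring" for u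
    using iter_coproduct_model[OF that, of "p - 1"] p1 by simp_all
  have "graded_bimodule U_ring ?T ?Z (pants_left p X C q) (pants_right p X C q)"
    by (rule model_bimodule[OF U.ext_ring_model_axioms TP_model Z.ext_model_axioms
          extmap_additive(1) coprod_mult extmap_1 coprod_degree])
       (simp_all add: pants_left_model pants_right_model)
  moreover have "graded_bimodule U_ring ?T ?T (\<lambda>u t. iter_coproduct (p - 1) u \<otimes>\<^bsub>?T\<^esub> t) (\<lambda>t s. t \<otimes>\<^bsub>?T\<^esub> s)"
    by (rule model_bimodule[OF U.ext_ring_model_axioms TP_model T.ext_model_axioms
          extmap_additive(1) coprod_mult extmap_1 coprod_degree])
       (simp_all add: T.mult_mem T.psi_mult ic del: One_nat_def)
  moreover note iso = model_iso[OF Z.ext_model_axioms T.ext_model_axioms, of \<Phi>]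
  have "\<Phi> (pants_left p X C q a x) = iter_coproduct (p - 1) a \<otimes>\<^bsub>?T\<^esub> \<Phi> x" if "a \<in> carrier U_ring" "x \<in> carrier ?Z" for a x
    using that by (intro T.psi_inj) (simp_all add: pants_map_model[OF \<Phi>] pants_left_model T.mult_mem T.psi_mult ic del: One_nat_def)
  moreover have "\<Phi> (pants_right p X C q x s) = \<Phi> x \<otimes>\<^bsub>?T\<^esub> s" if "s \<in> carrier ?T" "x \<in> carrier ?Z" for x s
    using that by (intro T.psi_inj) (simp_all add: pants_map_model[OF \<Phi>] pants_right_model T.mult_mem T.psi_mult)
  ultimately show ?thesis
    unfolding graded_bimodule_iso_def using iso by (simp add: pants_map_model[OF \<Phi>])
qed

lemma pants_map_unique:
  assumes "is_pants_map p X C q e \<Phi>" "\<Phi> \<in> extensional (carrier (exterior HP))"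
    and "is_pants_map p X C q e \<Psi>" "\<Psi> \<in> extensional (carrier (exterior HP))"
  shows "\<Phi> = \<Psi>"
  using assms(2,4)
  by (rule extensionalityI) (rule T.psi_inj; simp add: pants_map_model[OF assms(1)] pants_map_model[OF assms(3)])

end

theorem proposition2p7:
  fixes p :: nat and X :: "'a topology" and C :: "nat \<Rightarrow> real \<Rightarrow> 'a"
    and q :: "nat \<Rightarrow> 'a" and e :: "nat \<Rightarrow> real \<Rightarrow> 'a"
  assumes "1 \<le> p"
    and "closed_pants p X C"
    and "\<And>i. i \<le> p \<Longrightarrow> q i \<in> C i ` {0..1}"
    and "\<And>i. i \<in> {1..p} \<Longrightarrow> pathin X (e i) \<and> inj_on (e i) {0..1}"
    and "\<And>i. i \<in> {1..p} \<Longrightarrow> even (p - i) \<Longrightarrow> e i 0 = q 0 \<and> e i 1 = q i"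
    and "\<And>i. i \<in> {1..p} \<Longrightarrow> odd (p - i) \<Longrightarrow> e i 0 = q i \<and> e i 1 = q 0"
  shows "(\<exists>!\<Phi>. \<Phi> \<in> extensional (carrier (pants_state p X q)) \<and> is_pants_map p X C q e \<Phi>) \<and>
    (\<forall>\<Phi>. is_pants_map p X C q e \<Phi> \<longrightarrow>
       graded_bimodule_iso U_ring (tensor_power U_ring p)
         (pants_state p X q) (pants_left p X C q) (pants_right p X C q)
         (tensor_power U_ring p)
         (\<lambda>u t. iter_coproduct (p - 1) u \<otimes>\<^bsub>tensor_power U_ring p\<^esub> t)
         (\<lambda>t s. t \<otimes>\<^bsub>tensor_power U_ring p\<^esub> s)
         \<Phi>)"
proof -
  obtain k b where "pants_basis p X C q e k b"
    using assms by (rule pants_basis_exists)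
  then interpret pants_basis p X C q e k b .
  show ?thesis
    using pants_map_exists pants_map_unique pants_map_bimodule_iso
    unfolding pants_state_simps(1) by blast
qed

end
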